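(* Let $\mathscr G$ be an ample groupoid, $K$ a commutative ring with unit, $x\in\mathscr G^0$, and suppose that $V$ is a simple $KG_x$-module. Then $\mathrm{Ind}_x(V)$ is a simple $K\mathscr G$-module. Moreover, if $K$ is a field, then $\mathrm{Ind}_x(V)$ is finite dimensional if and only if $x$ has finite index and $V$ is finite dimensional. Finally, if $V$ and $W$ are non-isomorphic $KG_x$-modules, then $\mathrm{Ind}_x(V)\not\cong\mathrm{Ind}_x(W)$.
   Context: A groupoid is a small category with all arrows invertible; objects are identified with units, $\mathscr G^0$ is the unit space, $d(g)=g^{-1}g$, $r(g)=gg^{-1}$, and $gh$ is defined iff $d(g)=r(h)$. "Compact" includes Hausdorff. An étale groupoid is a topological groupoid, locally compact (not necessarily Hausdorff), with $\mathscr G^0$ locally compact Hausdorff and $d\colon\mathscr G\to\mathscr G^0$ a local homeomorphism. A slice is an open $U\subseteq\mathscr G$ with $d|_U$, $r|_U$ injective. $\mathscr G$ is ample if it is étale and the compact slices form a basis of its topology. Give $K$ the discrete topology. $K\mathscr G$ is the $K$-module of functions $\mathscr G\to K$ spanned by those $f$ for which there is an open Hausdorff subspace $V$ such that $f$ vanishes outside $V$ and $f|_V$ is continuous with compact support, with convolution product $f\ast g(x)=\sum_{y\in d^{-1}(d(x))}f(xy^{-1})g(y)$. All modules $M$ over a $K$-algebra $A$ are non-degenerate, i.e. $AM=M$ (this includes simple modules). The orbit of $x\in\mathscr G^0$ is $\{r(g)\mid d(g)=x\}$; $x$ has finite index if its orbit is finite. $G_x=\{g\mid d(g)=x=r(g)\}$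 is the isotropy group. $L_x=d^{-1}(x)$, on which $G_x$ acts on the right by multiplication; $KL_x$ is the free $K$-module on $L_x$, a $K\mathscr G$-$KG_x$-bimodule with left action $f\cdot t=\sum_{y\in L_x}f(yt^{-1})y$ for $f\in K\mathscr G$, $t\in L_x$. For a $KG_x$-module $V$, $\mathrm{Ind}_x(V)=KL_x\otimes_{KG_x}V$. *)

theory Defs
  imports "HOL-Analysis.Analysis" "HOL-Algebra.AbelCoset" "HOL-Algebra.Module"
begin

section \<open>Ample groupoids\<close>

text \<open>A groupoid is given by its set of arrows. Objects are identified with identity arrows, so the
  source map \<open>dm\<close>, the range map \<open>rn\<close> and the inverse are maps from arrows to arrows.
  Composition \<open>g \<cdot> h\<close> is meaningful only if \<open>dm g = rn h\<close>.\<close>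

record 'g groupoid = "'g partial_object" +
  dm :: "'g \<Rightarrow> 'g"
  rn :: "'g \<Rightarrow> 'g"
  gcomp :: "'g \<Rightarrow> 'g \<Rightarrow> 'g"  (infixl \<open>\<cdot>\<index>\<close> 70)
  ginv :: "'g \<Rightarrow> 'g"

record 'g top_groupoid = "'g groupoid" +
  gtop :: "'g topology"

locale groupoid =
  fixes G :: "('g, 'e) groupoid_scheme" (structure)
  assumes dm_closed: "g \<in> carrier G \<Longrightarrow> dm G g \<in> carrier G"
    and rn_closed: "g \<in> carrier G \<Longrightarrow> rn G g \<in> carrier G"
    and dm_dm: "g \<in> carrier G \<Longrightarrow> dm G (dm G g) = dm G g"
    and rn_dm: "g \<in> carrier G \<Longrightarrow> rn G (dm G g) = dm G g"
    and dm_rn: "g \<in> carrier G \<Longrightarrow> dm G (rn G g) = rn G g"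
    and rn_rn: "g \<in> carrier G \<Longrightarrow> rn G (rn G g) = rn G g"
    and comp_closed:
      "\<lbrakk>g \<in> carrier G; h \<in> carrier G; dm G g = rn G h\<rbrakk> \<Longrightarrow> g \<cdot> h \<in> carrier G"
    and dm_comp:
      "\<lbrakk>g \<in> carrier G; h \<in> carrier G; dm G g = rn G h\<rbrakk> \<Longrightarrow> dm G (g \<cdot> h) = dm G h"
    and rn_comp:
      "\<lbrakk>g \<in> carrier G; h \<in> carrier G; dm G g = rn G h\<rbrakk> \<Longrightarrow> rn G (g \<cdot> h) = rn G g"
    and comp_assoc:
      "\<lbrakk>g \<in> carrier G; h \<in> carrier G; k \<in> carrier G; dm G g = rn G h; dm G h = rn G k\<rbrakk>
        \<Longrightarrow> g \<cdot> h \<cdot> k = g \<cdot> (h \<cdot> k)"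
    and comp_dm: "g \<in> carrier G \<Longrightarrow> g \<cdot> dm G g = g"
    and rn_comp_self: "g \<in> carrier G \<Longrightarrow> rn G g \<cdot> g = g"
    and ginv_closed: "g \<in> carrier G \<Longrightarrow> ginv G g \<in> carrier G"
    and dm_ginv: "g \<in> carrier G \<Longrightarrow> dm G (ginv G g) = rn G g"
    and rn_ginv: "g \<in> carrier G \<Longrightarrow> rn G (ginv G g) = dm G g"
    and ginv_comp: "g \<in> carrier G \<Longrightarrow> ginv G g \<cdot> g = dm G g"
    and comp_ginv: "g \<in> carrier G \<Longrightarrow> g \<cdot> ginv G g = rn G g"

definition unit_space :: "('g, 'e) groupoid_scheme \<Rightarrow> 'g set" where
  "unit_space G = {u \<in> carrier G. dm G u = u}"

definition composable :: "('g, 'e) groupoid_scheme \<Rightarrow> ('g \<times> 'g) set" where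
  "composable G = {(g, h). g \<in> carrier G \<and> h \<in> carrier G \<and> dm G g = rn G h}"

locale topological_groupoid = groupoid G for G :: "('g, 'e) top_groupoid_scheme" (structure) +
  assumes topspace_gtop: "topspace (gtop G) = carrier G"
    and continuous_comp:
      "continuous_map (subtopology (prod_topology (gtop G) (gtop G)) (composable G)) (gtop G)
        (\<lambda>(g, h). g \<cdot> h)"
    and continuous_ginv: "continuous_map (gtop G) (gtop G) (ginv G)"

definition local_homeomorphism :: "'a topology \<Rightarrow> 'b topology \<Rightarrow> ('a \<Rightarrow> 'b) \<Rightarrow> bool" where
  "local_homeomorphism X Y f \<longleftrightarrow>
    (\<forall>x \<in> topspace X. \<exists>U. openin X U \<and> x \<in> U \<and> openin Y (f ` U) \<and>
      homeomorphic_map (subtopology X U) (subtopology Y (f ` U)) f)"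

locale etale_groupoid = topological_groupoid +
  assumes locally_compact: "locally_compact_space (gtop G)"
    and locally_compact_units: "locally_compact_space (subtopology (gtop G) (unit_space G))"
    and Hausdorff_units: "Hausdorff_space (subtopology (gtop G) (unit_space G))"
    and dm_local_homeo:
      "local_homeomorphism (gtop G) (subtopology (gtop G) (unit_space G)) (dm G)"

definition slice :: "('g, 'e) top_groupoid_scheme \<Rightarrow> 'g set \<Rightarrow> bool" where
  "slice G U \<longleftrightarrow> openin (gtop G) U \<and> inj_on (dm G) U \<and> inj_on (rn G) U"

text \<open>Compactness includes the Hausdorff property.\<close>

definition compact_slice :: "('g, 'e) top_groupoid_scheme \<Rightarrow> 'g set \<Rightarrow> bool" where
  "compact_slice G U \<longleftrightarrow>
    slice G U \<and> compactin (gtop G) U \<and> Hausdorff_space (subtopology (gtop G) U)"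

locale ample_groupoid = etale_groupoid +
  assumes compact_slices_base: "openin (gtop G) = arbitrary union_of compact_slice G"

definition fibre :: "('g, 'e) groupoid_scheme \<Rightarrow> 'g \<Rightarrow> 'g set" where
  "fibre G x = {g \<in> carrier G. dm G g = x}"

definition orbit_of :: "('g, 'e) groupoid_scheme \<Rightarrow> 'g \<Rightarrow> 'g set" where
  "orbit_of G x = rn G ` fibre G x"

definition finite_index :: "('g, 'e) groupoid_scheme \<Rightarrow> 'g \<Rightarrow> bool" where
  "finite_index G x \<longleftrightarrow> finite (orbit_of G x)"

definition isotropy_group :: "('g, 'e) groupoid_scheme \<Rightarrow> 'g \<Rightarrow> 'g monoid" where
  "isotropy_group G x =
    \<lparr>carrier = {g \<in> carrier G. dm G g = x \<and> rn G g = x}, mult = gcomp G, one = x\<rparr>"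


section \<open>Modules over a commutative ring\<close>

text \<open>The ring multiplication and unit that the library's record of modules provides are irrelevant
  for modules and left unspecified in the constructions below.\<close>

definition lin_span :: "('k, 'c) ring_scheme \<Rightarrow> ('k, 'm, 'e) module_scheme \<Rightarrow> 'm set \<Rightarrow> 'm set" where
  "lin_span K M S = \<Inter> {N. submodule N K M \<and> S \<subseteq> N}"

definition finite_dimensional :: "('k, 'c) ring_scheme \<Rightarrow> ('k, 'm, 'e) module_scheme \<Rightarrow> bool" where
  "finite_dimensional K M \<longleftrightarrow> (\<exists>B. finite B \<and> B \<subseteq> carrier M \<and> lin_span K M B = carrier M)"

text \<open>Functions on a set \<open>X\<close> are represented by total functions vanishing outside \<open>X\<close>.\<close>

definition function_module :: "('k, 'c) ring_scheme \<Rightarrow> 'x set \<Rightarrow> ('k, 'x \<Rightarrow> 'k) module" where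
  "function_module K X =
    \<lparr>carrier = {f. range f \<subseteq> carrier K \<and> {x. f x \<noteq> \<zero>\<^bsub>K\<^esub>} \<subseteq> X},
     mult = undefined, one = undefined,
     zero = (\<lambda>_. \<zero>\<^bsub>K\<^esub>), add = (\<lambda>f g x. f x \<oplus>\<^bsub>K\<^esub> g x),
     smult = (\<lambda>k f x. k \<otimes>\<^bsub>K\<^esub> f x)\<rparr>"

definition free_module :: "('k, 'c) ring_scheme \<Rightarrow> 'x set \<Rightarrow> ('k, 'x \<Rightarrow> 'k) module" where
  "free_module K X = function_module K X
    \<lparr>carrier := {f \<in> carrier (function_module K X). finite {x. f x \<noteq> \<zero>\<^bsub>K\<^esub>}}\<rparr>"

definition basis_vec :: "('k, 'c) ring_scheme \<Rightarrow> 'x \<Rightarrow> 'x \<Rightarrow> 'k" where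
  "basis_vec K x = (\<lambda>y. if y = x then \<one>\<^bsub>K\<^esub> else \<zero>\<^bsub>K\<^esub>)"

text \<open>\<open>finsum\<close> is only meaningful on finite sets, whence the restriction to nonzero terms.\<close>

definition fin_supp_sum :: "('k, 'c) ring_scheme \<Rightarrow> ('x \<Rightarrow> 'k) \<Rightarrow> 'x set \<Rightarrow> 'k" where
  "fin_supp_sum K f X = finsum K f {x \<in> X. f x \<noteq> \<zero>\<^bsub>K\<^esub>}"

text \<open>The linear extension to a free module of a map \<open>\<phi>\<close> on basis elements with values in functions.\<close>

definition lin_ext :: "('k, 'c) ring_scheme \<Rightarrow> ('x \<Rightarrow> 'y \<Rightarrow> 'k) \<Rightarrow> ('x \<Rightarrow> 'k) \<Rightarrow> 'y \<Rightarrow> 'k" where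
  "lin_ext K \<phi> u = (\<lambda>y. \<Oplus>\<^bsub>K\<^esub>x \<in> {x. u x \<noteq> \<zero>\<^bsub>K\<^esub>}. u x \<otimes>\<^bsub>K\<^esub> \<phi> x y)"


section \<open>The groupoid algebra and the group algebra\<close>

definition steinberg_generators ::
  "('k, 'c) ring_scheme \<Rightarrow> ('g, 'e) top_groupoid_scheme \<Rightarrow> ('g \<Rightarrow> 'k) set" where
  "steinberg_generators K G = {f \<in> carrier (function_module K (carrier G)).
    \<exists>V. openin (gtop G) V \<and> Hausdorff_space (subtopology (gtop G) V) \<and>
      (\<forall>g. g \<notin> V \<longrightarrow> f g = \<zero>\<^bsub>K\<^esub>) \<and>
      continuous_map (subtopology (gtop G) V) (discrete_topology (carrier K)) f \<and>
      compactin (subtopology (gtop G) V)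
        (subtopology (gtop G) V closure_of {g \<in> V. f g \<noteq> \<zero>\<^bsub>K\<^esub>})}"

definition convolution ::
  "('k, 'c) ring_scheme \<Rightarrow> ('g, 'e) groupoid_scheme \<Rightarrow> ('g \<Rightarrow> 'k) \<Rightarrow> ('g \<Rightarrow> 'k) \<Rightarrow> 'g \<Rightarrow> 'k" where
  "convolution K G f g = (\<lambda>x. if x \<in> carrier G
    then fin_supp_sum K (\<lambda>y. f (x \<cdot>\<^bsub>G\<^esub> ginv G y) \<otimes>\<^bsub>K\<^esub> g y) (fibre G (dm G x)) else \<zero>\<^bsub>K\<^esub>)"

definition steinberg_algebra ::
  "('k, 'c) ring_scheme \<Rightarrow> ('g, 'e) top_groupoid_scheme \<Rightarrow> ('k, 'g \<Rightarrow> 'k) module" where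
  "steinberg_algebra K G = function_module K (carrier G)
    \<lparr>carrier := lin_span K (function_module K (carrier G)) (steinberg_generators K G),
     mult := convolution K G\<rparr>"

definition group_algebra ::
  "('k, 'c) ring_scheme \<Rightarrow> ('h, 'e) monoid_scheme \<Rightarrow> ('k, 'h \<Rightarrow> 'k) module" where
  "group_algebra K H = free_module K (carrier H)
    \<lparr>mult := (\<lambda>a b. lin_ext K (\<lambda>g. lin_ext K (\<lambda>h. basis_vec K (g \<otimes>\<^bsub>H\<^esub> h)) b) a),
     one := basis_vec K \<one>\<^bsub>H\<^esub>\<rparr>"


section \<open>Non-degenerate modules over algebras\<close>

text \<open>Left modules over a \<open>K\<close>-algebra \<open>A\<close> (not necessarily unital), and bimodules over two
  such algebras. A record of type \<open>('k, 'a) module\<close> serves as the algebra, its fields \<open>smult\<close> and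
  \<open>mult\<close> being the \<open>K\<close>-action and the product.\<close>

record ('k, 'a, 'm) amodule = "('k, 'm) module" +
  lact :: "'a \<Rightarrow> 'm \<Rightarrow> 'm"

record ('k, 'a, 'b, 'm) bimodule = "('k, 'a, 'm) amodule" +
  ract :: "'m \<Rightarrow> 'b \<Rightarrow> 'm"

locale nondegenerate_module = Module.module K M
  for K :: "('k, 'c) ring_scheme" and A :: "('k, 'a, 'd) module_scheme"
    and M :: "('k, 'a, 'm, 'e) amodule_scheme" +
  assumes lact_closed: "\<lbrakk>a \<in> carrier A; m \<in> carrier M\<rbrakk> \<Longrightarrow> lact M a m \<in> carrier M"
    and lact_add_left: "\<lbrakk>a \<in> carrier A; b \<in> carrier A; m \<in> carrier M\<rbrakk>
      \<Longrightarrow> lact M (a \<oplus>\<^bsub>A\<^esub> b) m = lact M a m \<oplus>\<^bsub>M\<^esub> lact M b m"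
    and lact_add_right: "\<lbrakk>a \<in> carrier A; m \<in> carrier M; n \<in> carrier M\<rbrakk>
      \<Longrightarrow> lact M a (m \<oplus>\<^bsub>M\<^esub> n) = lact M a m \<oplus>\<^bsub>M\<^esub> lact M a n"
    and lact_mult: "\<lbrakk>a \<in> carrier A; b \<in> carrier A; m \<in> carrier M\<rbrakk>
      \<Longrightarrow> lact M (a \<otimes>\<^bsub>A\<^esub> b) m = lact M a (lact M b m)"
    and lact_smult_left: "\<lbrakk>k \<in> carrier K; a \<in> carrier A; m \<in> carrier M\<rbrakk>
      \<Longrightarrow> lact M (k \<odot>\<^bsub>A\<^esub> a) m = k \<odot>\<^bsub>M\<^esub> lact M a m"
    and lact_smult_right: "\<lbrakk>k \<in> carrier K; a \<in> carrier A; m \<in> carrier M\<rbrakk>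
      \<Longrightarrow> lact M a (k \<odot>\<^bsub>M\<^esub> m) = k \<odot>\<^bsub>M\<^esub> lact M a m"
    and nondegenerate:
      "lin_span K M {lact M a m | a m. a \<in> carrier A \<and> m \<in> carrier M} = carrier M"

definition asubmodule :: "'m set \<Rightarrow> ('k, 'c) ring_scheme \<Rightarrow> ('k, 'a, 'd) module_scheme
    \<Rightarrow> ('k, 'a, 'm, 'e) amodule_scheme \<Rightarrow> bool" where
  "asubmodule N K A M \<longleftrightarrow>
    submodule N K M \<and> (\<forall>a \<in> carrier A. \<forall>n \<in> N. lact M a n \<in> N)"

definition simple_amodule :: "('k, 'c) ring_scheme \<Rightarrow> ('k, 'a, 'd) module_scheme
    \<Rightarrow> ('k, 'a, 'm, 'e) amodule_scheme \<Rightarrow> bool" where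
  "simple_amodule K A M \<longleftrightarrow> nondegenerate_module K A M \<and> carrier M \<noteq> {\<zero>\<^bsub>M\<^esub>} \<and>
    (\<forall>N. asubmodule N K A M \<longrightarrow> N = {\<zero>\<^bsub>M\<^esub>} \<or> N = carrier M)"

definition amodule_isomorphic :: "('k, 'c) ring_scheme \<Rightarrow> ('k, 'a, 'd) module_scheme
    \<Rightarrow> ('k, 'a, 'm, 'e) amodule_scheme \<Rightarrow> ('k, 'a, 'n, 'f) amodule_scheme \<Rightarrow> bool" where
  "amodule_isomorphic K A M N \<longleftrightarrow> (\<exists>\<phi>. bij_betw \<phi> (carrier M) (carrier N) \<and>
    (\<forall>m \<in> carrier M. \<forall>n \<in> carrier M. \<phi> (m \<oplus>\<^bsub>M\<^esub> n) = \<phi> m \<oplus>\<^bsub>N\<^esub> \<phi> n) \<and>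
    (\<forall>k \<in> carrier K. \<forall>m \<in> carrier M. \<phi> (k \<odot>\<^bsub>M\<^esub> m) = k \<odot>\<^bsub>N\<^esub> \<phi> m) \<and>
    (\<forall>a \<in> carrier A. \<forall>m \<in> carrier M. \<phi> (lact M a m) = lact N a (\<phi> m)))"


section \<open>Tensor products and induced modules\<close>

text \<open>The tensor product over \<open>B\<close> of an \<open>A\<close>-\<open>B\<close>-bimodule \<open>M\<close> and a left \<open>B\<close>-module \<open>N\<close> is the free
  \<open>K\<close>-module on pairs modulo the relations making \<open>(m, n) \<mapsto> m \<otimes> n\<close> \<open>K\<close>-bilinear and
  \<open>B\<close>-balanced. Its elements are cosets of the submodule \<open>R\<close> of relations; operations on them are
  computed on all representatives at once, in the style of \<open>rcoset_mult\<close>.\<close>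

definition tensor_free :: "('k, 'c) ring_scheme \<Rightarrow> ('k, 'a, 'b, 'm, 'e) bimodule_scheme
    \<Rightarrow> ('k, 'b, 'n, 'f) amodule_scheme \<Rightarrow> ('k, 'm \<times> 'n \<Rightarrow> 'k) module" where
  "tensor_free K M N = free_module K (carrier M \<times> carrier N)"

definition tensor_relations :: "('k, 'c) ring_scheme \<Rightarrow> ('k, 'a, 'b, 'm, 'e) bimodule_scheme
    \<Rightarrow> ('k, 'b, 'd) module_scheme \<Rightarrow> ('k, 'b, 'n, 'f) amodule_scheme \<Rightarrow> ('m \<times> 'n \<Rightarrow> 'k) set" where
  "tensor_relations K M B N = (let F = tensor_free K M N; e = (\<lambda>m n. basis_vec K (m, n)) in
    lin_span K F
     ({e (m \<oplus>\<^bsub>M\<^esub> m') n \<ominus>\<^bsub>F\<^esub> (e m n \<oplus>\<^bsub>F\<^esub> e m' n) | m m' n.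
          m \<in> carrier M \<and> m' \<in> carrier M \<and> n \<in> carrier N} \<union>
      {e m (n \<oplus>\<^bsub>N\<^esub> n') \<ominus>\<^bsub>F\<^esub> (e m n \<oplus>\<^bsub>F\<^esub> e m n') | m n n'.
          m \<in> carrier M \<and> n \<in> carrier N \<and> n' \<in> carrier N} \<union>
      {e (k \<odot>\<^bsub>M\<^esub> m) n \<ominus>\<^bsub>F\<^esub> k \<odot>\<^bsub>F\<^esub> e m n | k m n.
          k \<in> carrier K \<and> m \<in> carrier M \<and> n \<in> carrier N} \<union>
      {e m (k \<odot>\<^bsub>N\<^esub> n) \<ominus>\<^bsub>F\<^esub> k \<odot>\<^bsub>F\<^esub> e m n | k m n.
          k \<in> carrier K \<and> m \<in> carrier M \<and> n \<in> carrier N} \<union>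
      {e (ract M m b) n \<ominus>\<^bsub>F\<^esub> e m (lact N b n) | m b n.
          m \<in> carrier M \<and> b \<in> carrier B \<and> n \<in> carrier N}))"

definition tensor_product :: "('k, 'c) ring_scheme \<Rightarrow> ('k, 'a, 'b, 'm, 'e) bimodule_scheme
    \<Rightarrow> ('k, 'b, 'd) module_scheme \<Rightarrow> ('k, 'b, 'n, 'f) amodule_scheme
    \<Rightarrow> ('k, 'a, ('m \<times> 'n \<Rightarrow> 'k) set) amodule" where
  "tensor_product K M B N = (let F = tensor_free K M N; R = tensor_relations K M B N in
    \<lparr>carrier = a_rcosets\<^bsub>F\<^esub> R, mult = undefined, one = undefined,
     zero = R, add = set_add F,
     smult = (\<lambda>k X. \<Union>u \<in> X. R +>\<^bsub>F\<^esub> (k \<odot>\<^bsub>F\<^esub> u)),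
     lact = (\<lambda>a X. \<Union>u \<in> X. R +>\<^bsub>F\<^esub> lin_ext K (\<lambda>(m, n). basis_vec K (lact M a m, n)) u)\<rparr>)"

text \<open>The bimodule \<open>KL\<^sub>x\<close>: the left action extends
  \<open>f \<cdot> t = (\<Sum>y \<in> L\<^sub>x. f (y t\<inverse>) y)\<close> linearly in \<open>t\<close>, and the right action extends
  \<open>(t, g) \<mapsto> t g\<close> bilinearly.\<close>

definition fibre_bimodule :: "('k, 'c) ring_scheme \<Rightarrow> ('g, 'e) groupoid_scheme \<Rightarrow> 'g
    \<Rightarrow> ('k, 'g \<Rightarrow> 'k, 'g \<Rightarrow> 'k, 'g \<Rightarrow> 'k) bimodule" where
  "fibre_bimodule K G x = (let F = free_module K (fibre G x) in
    \<lparr>carrier = carrier F, mult = undefined, one = undefined,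
     zero = zero F, add = add F, smult = smult F,
     lact = (\<lambda>f. lin_ext K
       (\<lambda>t y. if y \<in> fibre G x then f (y \<cdot>\<^bsub>G\<^esub> ginv G t) else \<zero>\<^bsub>K\<^esub>)),
     ract = (\<lambda>u a. lin_ext K (\<lambda>t. lin_ext K (\<lambda>g. basis_vec K (t \<cdot>\<^bsub>G\<^esub> g)) a) u)\<rparr>)"

definition induced_module :: "('k, 'c) ring_scheme \<Rightarrow> ('g, 'e) groupoid_scheme \<Rightarrow> 'g
    \<Rightarrow> ('k, 'g \<Rightarrow> 'k, 'v, 'f) amodule_scheme
    \<Rightarrow> ('k, 'g \<Rightarrow> 'k, (('g \<Rightarrow> 'k) \<times> 'v \<Rightarrow> 'k) set) amodule" where
  "induced_module K G x V =
    tensor_product K (fibre_bimodule K G x) (group_algebra K (isotropy_group G x)) V"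

end

theory Submission
  imports Defs
begin

text \<open>For \<open>t\<close> in \<open>L\<^sub>x\<close> let \<open>embed t v = t \<otimes> v\<close>; the balanced map sending \<open>(s, v)\<close> to \<open>(t\<inverse>s) v\<close> if
  \<open>s\<close> and \<open>t\<close> have the same range, and to \<open>0\<close> otherwise, induces \<open>coord t\<close> on the tensor product, a
  retraction of \<open>embed t\<close>. Thus \<open>Ind\<^sub>x(V)\<close> is the direct sum of copies of \<open>V\<close> indexed by the orbit
  of \<open>x\<close>, which gives the claim on dimensions. The indicator function of a compact slice \<open>U\<close> maps
  \<open>t \<otimes> v\<close> to \<open>ut \<otimes> v\<close> if \<open>u\<close> is the arrow in \<open>U\<close> with source \<open>r(t)\<close>, and to \<open>0\<close> if there is none.
  As the unit space is Hausdorff, \<open>U\<close> can be taken so small that it kills all but one of the finitely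
  many components of a given vector \<open>w\<close>, and then it turns \<open>w\<close> into \<open>s \<otimes> coord t w\<close>. Hence the
  vectors \<open>v\<close> for which a submodule contains all \<open>s \<otimes> v\<close> form a submodule of \<open>V\<close>, nonzero if the
  given one is. In the same way \<open>x \<otimes> V\<close> is characterised in terms of the action, so that an
  isomorphism of induced modules restricts to one of \<open>V\<close> and \<open>W\<close>.\<close>

section \<open>Linear maps and free modules\<close>

text \<open>The tensor product is a quotient of the free module on all pairs, and its classes have
  no canonical representatives. Even that \<open>x \<otimes> v\<close> is nonzero for nonzero
  \<open>v\<close> can only be seen through a map out of the quotient. Such maps exist because
  \<open>KL_x\<close> is free as a right module over the group algebra, with a transversal of the
  ranges as a basis: for \<open>s\<close> with the range of \<open>t\<close>, the element
  \<open>t^-1 s\<close> is the coefficient of \<open>s\<close> at the basis element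
  \<open>t\<close>. Nearly all identities follow one induction principle: the arguments at which an
  identity holds form a submodule (a preimage, kernel or equalizer of linear maps), and this
  submodule contains a generating set. The generators are basis vectors in a free module, pure
  tensors in the tensor product, and finally the elements \<open>t \<otimes> v\<close> with
  \<open>t\<close> an arrow. Arrows cannot be separated by open sets, as the groupoid may fail to be
  Hausdorff. The components of a vector, however, are told apart by the ranges of arrows, which are
  units, and a slice can be cut down by a condition on the sources of its arrows alone.\<close>

lemma submoduleI':
  assumes "Module.module K M" "H \<subseteq> carrier M" "\<zero>\<^bsub>M\<^esub> \<in> H"
    and "\<And>a b. \<lbrakk>a \<in> H; b \<in> H\<rbrakk> \<Longrightarrow> a \<oplus>\<^bsub>M\<^esub> b \<in> H"
    and sm: "\<And>k a. \<lbrakk>k \<in> carrier K; a \<in> H\<rbrakk> \<Longrightarrow> k \<odot>\<^bsub>M\<^esub> a \<in> H"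
  shows "submodule H K M"
proof -
  interpret M: Module.module K M by fact
  show ?thesis
  proof (rule M.submoduleI)
    fix a assume a: "a \<in> H"
    then have "a \<in> carrier M" using assms(2) by auto
    then have "\<ominus>\<^bsub>M\<^esub> a = (\<ominus>\<^bsub>K\<^esub> \<one>\<^bsub>K\<^esub>) \<odot>\<^bsub>M\<^esub> a" by (simp add: M.smult_l_minus)
    with sm[OF _ a] show "\<ominus>\<^bsub>M\<^esub> a \<in> H" by simp
  qed (use assms in auto)
qed

lemma submodule_subset: "submodule H K M \<Longrightarrow> H \<subseteq> carrier M"
  unfolding submodule_def subgroup_def by simp

lemma submodule_zero: "submodule H K M \<Longrightarrow> \<zero>\<^bsub>M\<^esub> \<in> H"
  unfolding submodule_def subgroup_def by simp

lemma submodule_add: "\<lbrakk>submodule H K M; a \<in> H; b \<in> H\<rbrakk> \<Longrightarrow> a \<oplus>\<^bsub>M\<^esub> b \<in> H"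
  unfolding submodule_def subgroup_def by simp

lemma submodule_smult: "\<lbrakk>submodule H K M; k \<in> carrier K; a \<in> H\<rbrakk> \<Longrightarrow> k \<odot>\<^bsub>M\<^esub> a \<in> H"
  unfolding submodule_def submodule_axioms_def by simp

lemma submodule_finsum:
  assumes "Module.module K M" "submodule H K M" "f \<in> A \<rightarrow> H"
  shows "finsum M f A \<in> H"
proof -
  interpret M: Module.module K M by fact
  have H: "H \<subseteq> carrier M" using assms(2) by (rule submodule_subset)
  show ?thesis
    using assms(3)
  proof (induction A rule: infinite_finite_induct)
    case (insert a A)
    then have "finsum M f (insert a A) = f a \<oplus>\<^bsub>M\<^esub> finsum M f A"
      using H by (intro M.finsum_insert) (auto simp: Pi_iff)
    with insert show ?case by (auto intro: submodule_add[OF assms(2)])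
  qed (auto simp: submodule_zero[OF assms(2)])
qed

lemma lin_span_least: "\<lbrakk>submodule N K M; S \<subseteq> N\<rbrakk> \<Longrightarrow> lin_span K M S \<subseteq> N"
  unfolding lin_span_def by auto

lemma lin_span_superset: "S \<subseteq> lin_span K M S"
  unfolding lin_span_def by auto

lemma lin_span_submodule:
  assumes "Module.module K M" "S \<subseteq> carrier M"
  shows "submodule (lin_span K M S) K M"
proof (rule submoduleI'[OF assms(1)])
  have "submodule (carrier M) K M" by (rule Module.module.carrier_is_submodule[OF assms(1)])
  then show "lin_span K M S \<subseteq> carrier M" using assms(2) by (rule lin_span_least)
qed (auto simp: lin_span_def intro: submodule_zero submodule_add submodule_smult)

text \<open>The last premise has the shape of the conclusions of \<open>free_module_span\<close>,
  \<open>tens_span\<close> and \<open>embed_span\<close>, so that generation by one set is deduced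
  from generation by another without handling linear combinations.\<close>

lemma lin_span_eq_carrierI:
  assumes "Module.module K M" "S \<subseteq> carrier M"
    and "\<And>N. \<lbrakk>submodule N K M; S \<subseteq> N\<rbrakk> \<Longrightarrow> carrier M \<subseteq> N"
  shows "lin_span K M S = carrier M"
proof
  have sub: "submodule (lin_span K M S) K M" by (rule lin_span_submodule[OF assms(1,2)])
  then show "lin_span K M S \<subseteq> carrier M" by (rule submodule_subset)
  show "carrier M \<subseteq> lin_span K M S" by (rule assms(3)[OF sub lin_span_superset])
qed

section \<open>Linear maps and the submodules they define\<close>

definition lin_map :: "('k, 'c) ring_scheme \<Rightarrow> ('k, 'm, 'e) module_scheme
    \<Rightarrow> ('k, 'n, 'f) module_scheme \<Rightarrow> ('m \<Rightarrow> 'n) \<Rightarrow> bool" where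
  "lin_map K M N f \<longleftrightarrow> f \<in> carrier M \<rightarrow> carrier N \<and>
    (\<forall>m \<in> carrier M. \<forall>n \<in> carrier M. f (m \<oplus>\<^bsub>M\<^esub> n) = f m \<oplus>\<^bsub>N\<^esub> f n) \<and>
    (\<forall>k \<in> carrier K. \<forall>m \<in> carrier M. f (k \<odot>\<^bsub>M\<^esub> m) = k \<odot>\<^bsub>N\<^esub> f m)"

lemma lin_mapI:
  assumes "\<And>m. m \<in> carrier M \<Longrightarrow> f m \<in> carrier N"
    and "\<And>m n. \<lbrakk>m \<in> carrier M; n \<in> carrier M\<rbrakk> \<Longrightarrow> f (m \<oplus>\<^bsub>M\<^esub> n) = f m \<oplus>\<^bsub>N\<^esub> f n"
    and "\<And>k m. \<lbrakk>k \<in> carrier K; m \<in> carrier M\<rbrakk> \<Longrightarrow> f (k \<odot>\<^bsub>M\<^esub> m) = k \<odot>\<^bsub>N\<^esub> f m"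
  shows "lin_map K M N f"
  using assms unfolding lin_map_def by auto

lemma lin_map_closed: "\<lbrakk>lin_map K M N f; m \<in> carrier M\<rbrakk> \<Longrightarrow> f m \<in> carrier N"
  unfolding lin_map_def by auto

lemma lin_map_add:
  "\<lbrakk>lin_map K M N f; m \<in> carrier M; n \<in> carrier M\<rbrakk> \<Longrightarrow> f (m \<oplus>\<^bsub>M\<^esub> n) = f m \<oplus>\<^bsub>N\<^esub> f n"
  unfolding lin_map_def by auto

lemma lin_map_smult:
  "\<lbrakk>lin_map K M N f; k \<in> carrier K; m \<in> carrier M\<rbrakk> \<Longrightarrow> f (k \<odot>\<^bsub>M\<^esub> m) = k \<odot>\<^bsub>N\<^esub> f m"
  unfolding lin_map_def by auto

lemma lin_map_comp: "\<lbrakk>lin_map K M N f; lin_map K N P g\<rbrakk> \<Longrightarrow> lin_map K M P (\<lambda>m. g (f m))"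
  unfolding lin_map_def by (auto simp: Pi_iff)

text \<open>The module axioms of \<open>M\<close> are used for closure: the two functions agree only
  on the carrier, so sums and multiples must be known to lie there.\<close>

lemma lin_map_cong:
  assumes "lin_map K M N f" "Module.module K M" "\<And>m. m \<in> carrier M \<Longrightarrow> f m = g m"
  shows "lin_map K M N g"
proof -
  interpret M: Module.module K M by fact
  show ?thesis using assms(1,3) unfolding lin_map_def by (auto simp: Pi_iff)
qed

lemma lin_map_zero:
  assumes "Module.module K M" "Module.module K N" "lin_map K M N f"
  shows "f \<zero>\<^bsub>M\<^esub> = \<zero>\<^bsub>N\<^esub>"
proof -
  interpret M: Module.module K M by fact
  interpret N: Module.module K N by fact
  have "f (\<zero>\<^bsub>K\<^esub> \<odot>\<^bsub>M\<^esub> \<zero>\<^bsub>M\<^esub>) = \<zero>\<^bsub>K\<^esub> \<odot>\<^bsub>N\<^esub> f \<zero>\<^bsub>M\<^esub>"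
    using assms(3) by (intro lin_map_smult) auto
  then show ?thesis using lin_map_closed[OF assms(3), of "\<zero>\<^bsub>M\<^esub>"] by simp
qed

lemma lin_map_uminus:
  assumes "Module.module K M" "Module.module K N" "lin_map K M N f" "m \<in> carrier M"
  shows "f (\<ominus>\<^bsub>M\<^esub> m) = \<ominus>\<^bsub>N\<^esub> f m"
proof -
  interpret M: Module.module K M by fact
  interpret N: Module.module K N by fact
  have "\<ominus>\<^bsub>M\<^esub> m = (\<ominus>\<^bsub>K\<^esub> \<one>\<^bsub>K\<^esub>) \<odot>\<^bsub>M\<^esub> m" using assms(4) by (simp add: M.smult_l_minus)
  then have "f (\<ominus>\<^bsub>M\<^esub> m) = (\<ominus>\<^bsub>K\<^esub> \<one>\<^bsub>K\<^esub>) \<odot>\<^bsub>N\<^esub> f m"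
    using assms(4) by (simp only: lin_map_smult[OF assms(3)] M.R.one_closed M.R.a_inv_closed)
  then show ?thesis using lin_map_closed[OF assms(3,4)] by (simp add: N.smult_l_minus)
qed

lemma lin_map_minus:
  assumes "Module.module K M" "Module.module K N" "lin_map K M N f" "m \<in> carrier M" "n \<in> carrier M"
  shows "f (m \<ominus>\<^bsub>M\<^esub> n) = f m \<ominus>\<^bsub>N\<^esub> f n"
proof -
  interpret M: Module.module K M by fact
  show ?thesis unfolding a_minus_def
    using assms lin_map_uminus[OF assms(1-3,5)] by (simp add: lin_map_add[OF assms(3)])
qed

lemma lin_map_sum:
  assumes "Module.module K N" "lin_map K M N f" "lin_map K M N g"
  shows "lin_map K M N (\<lambda>m. f m \<oplus>\<^bsub>N\<^esub> g m)"
proof -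
  interpret N: Module.module K N by fact
  note fc = lin_map_closed[OF assms(2)] and gc = lin_map_closed[OF assms(3)]
  show ?thesis
    by (rule lin_mapI)
      (use fc gc in \<open>auto simp: lin_map_add[OF assms(2)] lin_map_add[OF assms(3)]
         lin_map_smult[OF assms(2)] lin_map_smult[OF assms(3)] N.smult_r_distr N.M.a_ac\<close>)
qed

text \<open>Rests on the commutativity of \<open>K\<close>, which lets the two scalars change
  places.\<close>

lemma lin_map_scale:
  assumes "Module.module K N" "lin_map K M N f" "c \<in> carrier K"
  shows "lin_map K M N (\<lambda>m. c \<odot>\<^bsub>N\<^esub> f m)"
proof -
  interpret N: Module.module K N by fact
  note fc = lin_map_closed[OF assms(2)]
  show ?thesis
  proof (rule lin_mapI)
    fix k m assume km: "k \<in> carrier K" "m \<in> carrier M"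
    have "c \<odot>\<^bsub>N\<^esub> (k \<odot>\<^bsub>N\<^esub> f m) = k \<odot>\<^bsub>N\<^esub> (c \<odot>\<^bsub>N\<^esub> f m)"
      using km assms(3) fc by (metis N.R.m_comm N.smult_assoc1)
    then show "c \<odot>\<^bsub>N\<^esub> f (k \<odot>\<^bsub>M\<^esub> m) = k \<odot>\<^bsub>N\<^esub> (c \<odot>\<^bsub>N\<^esub> f m)"
      using km by (simp add: lin_map_smult[OF assms(2)])
  qed (use fc assms(3) in \<open>auto simp: lin_map_add[OF assms(2)] N.smult_r_distr\<close>)
qed

text \<open>Serves as an induction principle: if \<open>f\<close> maps a generating set into
  \<open>H\<close>, the preimage is everything, hence \<open>f\<close> maps everything into
  \<open>H\<close>.\<close>

lemma submodule_vimage: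
  assumes "Module.module K M" "Module.module K N" "lin_map K M N f" "submodule H K N"
  shows "submodule {m \<in> carrier M. f m \<in> H} K M"
proof -
  interpret M: Module.module K M by fact
  show ?thesis
    by (rule submoduleI'[OF assms(1)])
      (use assms in \<open>auto simp: lin_map_zero lin_map_add lin_map_smult
         intro: submodule_zero submodule_add submodule_smult\<close>)
qed

lemma submodule_singleton_zero: "Module.module K M \<Longrightarrow> submodule {\<zero>\<^bsub>M\<^esub>} K M"
proof -
  assume M: "Module.module K M"
  then interpret M: Module.module K M .
  show ?thesis by (rule submoduleI'[OF M]) auto
qed

lemma submodule_kernel:
  assumes "Module.module K M" "Module.module K N" "lin_map K M N f"
  shows "submodule {m \<in> carrier M. f m = \<zero>\<^bsub>N\<^esub>} K M"
  using submodule_vimage[OF assms submodule_singleton_zero[OF assms(2)]] by simp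

text \<open>Together with a spanning lemma this says that linear maps agreeing on generators agree;
  see \<open>lin_map_eqI\<close> and \<open>tens_eqI\<close>.\<close>

lemma submodule_equalizer:
  assumes "Module.module K M" "Module.module K N" "lin_map K M N f" "lin_map K M N g"
  shows "submodule {m \<in> carrier M. f m = g m} K M"
proof -
  interpret M: Module.module K M by fact
  show ?thesis
    by (rule submoduleI'[OF assms(1)])
      (auto simp: lin_map_zero[OF assms(1-3)] lin_map_zero[OF assms(1,2,4)]
         lin_map_add[OF assms(3)] lin_map_add[OF assms(4)]
         lin_map_smult[OF assms(3)] lin_map_smult[OF assms(4)])
qed

text \<open>All module axioms are equations or existence statements, so they pass along a surjection
  that respects the operations. Applied to the quotient map onto the tensor product, and to the
  identity when two records differ only in fields that the module axioms do not see.\<close>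

lemma module_surj_image:
  assumes "Module.module K M" and im: "f ` carrier M = carrier Q"
    and add: "\<And>m n. \<lbrakk>m \<in> carrier M; n \<in> carrier M\<rbrakk> \<Longrightarrow> f m \<oplus>\<^bsub>Q\<^esub> f n = f (m \<oplus>\<^bsub>M\<^esub> n)"
    and sm: "\<And>k m. \<lbrakk>k \<in> carrier K; m \<in> carrier M\<rbrakk> \<Longrightarrow> k \<odot>\<^bsub>Q\<^esub> f m = f (k \<odot>\<^bsub>M\<^esub> m)"
    and zero: "\<zero>\<^bsub>Q\<^esub> = f \<zero>\<^bsub>M\<^esub>"
  shows "Module.module K Q"
proof -
  interpret M: Module.module K M by fact
  have ex: "\<exists>m \<in> carrier M. q = f m" if "q \<in> carrier Q" for q using that im by auto
  have cl: "f m \<in> carrier Q" if "m \<in> carrier M" for m using that im by auto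
  show ?thesis
  proof (rule moduleI)
    show "abelian_group Q"
    proof (rule abelian_groupI)
      fix a assume "a \<in> carrier Q"
      then obtain m where "m \<in> carrier M" "a = f m" using ex by blast
      then show "\<exists>y \<in> carrier Q. y \<oplus>\<^bsub>Q\<^esub> a = \<zero>\<^bsub>Q\<^esub>"
        by (intro bexI[of _ "f (\<ominus>\<^bsub>M\<^esub> m)"]) (auto simp: add zero cl M.M.l_neg)
    qed (auto dest!: ex simp: add zero cl M.M.a_ac)
  qed (auto dest!: ex simp: add sm zero cl M.R.is_cring M.smult_l_distr M.smult_r_distr M.smult_assoc1)
qed

section \<open>Free modules and their universal property\<close>

definition free_lift :: "('k, 'c) ring_scheme \<Rightarrow> ('k, 'm, 'e) module_scheme
    \<Rightarrow> ('x \<Rightarrow> 'm) \<Rightarrow> ('x \<Rightarrow> 'k) \<Rightarrow> 'm" where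
  "free_lift K P b u = (\<Oplus>\<^bsub>P\<^esub>x \<in> {x. u x \<noteq> \<zero>\<^bsub>K\<^esub>}. u x \<odot>\<^bsub>P\<^esub> b x)"

text \<open>The common form of the product of a group algebra and of the right action on
  \<open>KL_x\<close>: a product of basis elements, extended bilinearly.\<close>

definition bil_ext :: "('k, 'c) ring_scheme \<Rightarrow> ('x \<Rightarrow> 'y \<Rightarrow> 'z)
    \<Rightarrow> ('x \<Rightarrow> 'k) \<Rightarrow> ('y \<Rightarrow> 'k) \<Rightarrow> 'z \<Rightarrow> 'k" where
  "bil_ext K \<psi> u a = lin_ext K (\<lambda>x. lin_ext K (\<lambda>y. basis_vec K (\<psi> x y)) a) u"

context cring
begin

lemma function_module_simps [simp]:
  "\<zero>\<^bsub>function_module R X\<^esub> = (\<lambda>_. \<zero>)"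
  "f \<oplus>\<^bsub>function_module R X\<^esub> g = (\<lambda>x. f x \<oplus> g x)"
  "k \<odot>\<^bsub>function_module R X\<^esub> f = (\<lambda>x. k \<otimes> f x)"
  by (auto simp: function_module_def)

lemma function_module_carrier_iff:
  "f \<in> carrier (function_module R X) \<longleftrightarrow> (\<forall>x. f x \<in> carrier R) \<and> (\<forall>x. x \<notin> X \<longrightarrow> f x = \<zero>)"
  by (auto simp: function_module_def)

lemma free_module_simps [simp]:
  "\<zero>\<^bsub>free_module R X\<^esub> = (\<lambda>_. \<zero>)"
  "f \<oplus>\<^bsub>free_module R X\<^esub> g = (\<lambda>x. f x \<oplus> g x)"
  "k \<odot>\<^bsub>free_module R X\<^esub> f = (\<lambda>x. k \<otimes> f x)"
  by (auto simp: free_module_def function_module_def)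

lemma free_module_carrier_iff:
  "f \<in> carrier (free_module R X) \<longleftrightarrow>
    (\<forall>x. f x \<in> carrier R) \<and> (\<forall>x. x \<notin> X \<longrightarrow> f x = \<zero>) \<and> finite {x. f x \<noteq> \<zero>}"
  by (auto simp: free_module_def function_module_def)

lemma free_module_carrierI:
  assumes "\<And>x. f x \<in> carrier R" "\<And>x. x \<notin> X \<Longrightarrow> f x = \<zero>" "finite S" "{x. f x \<noteq> \<zero>} \<subseteq> S"
  shows "f \<in> carrier (free_module R X)"
  using assms by (simp add: free_module_carrier_iff finite_subset)

lemma module_function_module: "Module.module R (function_module R X)"
proof (rule moduleI)
  show "abelian_group (function_module R X)"
  proof (rule abelian_groupI)
    fix f assume "f \<in> carrier (function_module R X)"
    then show "\<exists>g \<in> carrier (function_module R X).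
        g \<oplus>\<^bsub>function_module R X\<^esub> f = \<zero>\<^bsub>function_module R X\<^esub>"
      by (intro bexI[of _ "\<lambda>x. \<ominus> f x"]) (auto simp: function_module_carrier_iff l_neg)
  qed (auto simp: function_module_carrier_iff a_ac)
qed (auto simp: function_module_carrier_iff is_cring l_distr r_distr m_assoc)

lemma submodule_free_module:
  "submodule (carrier (free_module R X)) R (function_module R X)"
proof (rule submoduleI'[OF module_function_module])
  fix f g assume "f \<in> carrier (free_module R X)" "g \<in> carrier (free_module R X)"
  moreover have "{x. f x \<oplus> g x \<noteq> \<zero>} \<subseteq> {x. f x \<noteq> \<zero>} \<union> {x. g x \<noteq> \<zero>}" by auto
  ultimately show "f \<oplus>\<^bsub>function_module R X\<^esub> g \<in> carrier (free_module R X)"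
    by (auto simp: free_module_carrier_iff intro: finite_subset)
next
  fix k f assume "k \<in> carrier R" "f \<in> carrier (free_module R X)"
  moreover from this have "{x. k \<otimes> f x \<noteq> \<zero>} \<subseteq> {x. f x \<noteq> \<zero>}" by auto
  ultimately show "k \<odot>\<^bsub>function_module R X\<^esub> f \<in> carrier (free_module R X)"
    by (auto simp: free_module_carrier_iff intro: finite_subset)
qed (auto simp: free_module_carrier_iff function_module_carrier_iff)

lemma module_free_module: "Module.module R (free_module R X)"
proof -
  have "Module.module R (function_module R X\<lparr>carrier := carrier (free_module R X)\<rparr>)"
    by (rule submodule.submodule_is_module[OF submodule_free_module module_function_module])
  then show ?thesis by (simp add: free_module_def)
qed

lemma basis_vec_closed: "x \<in> X \<Longrightarrow> basis_vec R x \<in> carrier (free_module R X)"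
proof -
  have "{y. basis_vec R x y \<noteq> \<zero>} \<subseteq> {x}" by (auto simp: basis_vec_def)
  then show "x \<in> X \<Longrightarrow> ?thesis"
    using finite_subset by (auto simp: free_module_carrier_iff) (auto simp: basis_vec_def)
qed

text \<open>Connects \<open>lin_ext\<close>, which adds up values in \<open>K\<close> point by
  point, with \<open>free_lift\<close>, which adds up elements of a module.\<close>

lemma finsum_free_module_apply:
  assumes "f \<in> A \<rightarrow> carrier (free_module R X)"
  shows "finsum (free_module R X) f A y = (\<Oplus>a\<in>A. f a y)"
proof -
  interpret F: Module.module R "free_module R X" by (rule module_free_module)
  show ?thesis using assms
  proof (induction A rule: infinite_finite_induct)
    case (insert a A)
    then have "finsum (free_module R X) f (insert a A) =
        f a \<oplus>\<^bsub>free_module R X\<^esub> finsum (free_module R X) f A"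
      by (intro F.finsum_insert) auto
    with insert show ?case by (subst finsum_insert) (auto simp: free_module_carrier_iff Pi_iff)
  qed auto
qed

lemma free_module_expand:
  assumes u: "u \<in> carrier (free_module R X)"
  shows "u = finsum (free_module R X) (\<lambda>x. u x \<odot>\<^bsub>free_module R X\<^esub> basis_vec R x) {x. u x \<noteq> \<zero>}"
proof
  fix y
  interpret F: Module.module R "free_module R X" by (rule module_free_module)
  let ?S = "{x. u x \<noteq> \<zero>}"
  have S: "finite ?S" "?S \<subseteq> X" and uc: "\<And>x. u x \<in> carrier R"
    using u by (auto simp: free_module_carrier_iff)
  have "(\<lambda>x. u x \<odot>\<^bsub>free_module R X\<^esub> basis_vec R x) \<in> ?S \<rightarrow> carrier (free_module R X)"
    using S(2) by (intro Pi_I F.smult_closed uc basis_vec_closed) auto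
  then have "finsum (free_module R X) (\<lambda>x. u x \<odot>\<^bsub>free_module R X\<^esub> basis_vec R x) ?S y =
      (\<Oplus>x\<in>?S. u x \<otimes> basis_vec R x y)"
    by (simp add: finsum_free_module_apply)
  also have "\<dots> = (\<Oplus>x\<in>?S. if y = x then u x else \<zero>)"
    by (rule finsum_cong) (auto simp: basis_vec_def uc simp_implies_def)
  also have "\<dots> = u y"
  proof (cases "y \<in> ?S")
    case True
    then show ?thesis using S uc by (simp add: finsum_singleton)
  next
    case False
    then have "(\<Oplus>x\<in>?S. if y = x then u x else \<zero>) = (\<Oplus>x\<in>?S. \<zero>)"
      by (intro finsum_cong) (auto simp: simp_implies_def)
    then show ?thesis using False by simp
  qed
  finally show "u y = finsum (free_module R X) (\<lambda>x. u x \<odot>\<^bsub>free_module R X\<^esub> basis_vec R x) ?S y" ..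
qed

text \<open>By the finite expansion in basis vectors. This is the induction principle that reduces
  later claims on free modules to basis vectors.\<close>

lemma free_module_span:
  assumes "submodule N R (free_module R X)" "\<And>x. x \<in> X \<Longrightarrow> basis_vec R x \<in> N"
  shows "carrier (free_module R X) \<subseteq> N"
proof
  fix u assume u: "u \<in> carrier (free_module R X)"
  show "u \<in> N"
  proof (subst free_module_expand[OF u], rule submodule_finsum[OF module_free_module assms(1)], rule)
    fix x assume "x \<in> {x. u x \<noteq> \<zero>}"
    then show "u x \<odot>\<^bsub>free_module R X\<^esub> basis_vec R x \<in> N"
      using u by (intro submodule_smult[OF assms(1)] assms(2)) (auto simp: free_module_carrier_iff)
  qed
qed

lemma lin_map_eqI:
  assumes "Module.module R P" "lin_map R (free_module R X) P f" "lin_map R (free_module R X) P g"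
    and "\<And>x. x \<in> X \<Longrightarrow> f (basis_vec R x) = g (basis_vec R x)"
    and "u \<in> carrier (free_module R X)"
  shows "f u = g u"
proof -
  have "carrier (free_module R X) \<subseteq> {u \<in> carrier (free_module R X). f u = g u}"
    by (rule free_module_span[OF submodule_equalizer[OF module_free_module assms(1-3)]])
      (simp add: assms(4) basis_vec_closed)
  then show ?thesis using assms(5) by auto
qed

text \<open>The supports of \<open>u\<close>, \<open>v\<close> and their sum differ, so their lifts
  can be compared only over a common finite index set.\<close>

lemma free_lift_superset:
  assumes "Module.module R P" "b \<in> X \<rightarrow> carrier P" "u \<in> carrier (free_module R X)"
    and "finite A" "A \<subseteq> X" "{x. u x \<noteq> \<zero>} \<subseteq> A"
  shows "free_lift R P b u = (\<Oplus>\<^bsub>P\<^esub>x \<in> A. u x \<odot>\<^bsub>P\<^esub> b x)"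
proof -
  interpret P: Module.module R P by fact
  show ?thesis unfolding free_lift_def
    using assms(2-) by (intro P.add.finprod_mono_neutral_cong_left)
      (auto simp: free_module_carrier_iff Pi_iff subset_iff)
qed

lemma lin_map_free_lift:
  assumes "Module.module R P" "b \<in> X \<rightarrow> carrier P"
  shows "lin_map R (free_module R X) P (free_lift R P b)"
proof (rule lin_mapI)
  interpret P: Module.module R P by fact
  interpret F: Module.module R "free_module R X" by (rule module_free_module)
  note sup = free_lift_superset[OF assms]
  fix u assume u: "u \<in> carrier (free_module R X)"
  then show "free_lift R P b u \<in> carrier P"
    unfolding free_lift_def using assms(2)
    by (intro P.finsum_closed) (auto simp: free_module_carrier_iff Pi_iff)
  {
    fix v assume v: "v \<in> carrier (free_module R X)"
    let ?A = "{x. u x \<noteq> \<zero>} \<union> {x. v x \<noteq> \<zero>}"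
    have A: "finite ?A" "?A \<subseteq> X" and [simp]: "\<And>x. u x \<in> carrier R" "\<And>x. v x \<in> carrier R"
      using u v by (auto simp: free_module_carrier_iff)
    have b: "b x \<in> carrier P" if "x \<in> ?A" for x using that A(2) assms(2) by blast
    have "free_lift R P b (u \<oplus>\<^bsub>free_module R X\<^esub> v) = (\<Oplus>\<^bsub>P\<^esub>x\<in>?A. (u x \<oplus> v x) \<odot>\<^bsub>P\<^esub> b x)"
      using F.a_closed[OF u v] A by (subst sup) auto
    also have "\<dots> = (\<Oplus>\<^bsub>P\<^esub>x\<in>?A. u x \<odot>\<^bsub>P\<^esub> b x \<oplus>\<^bsub>P\<^esub> v x \<odot>\<^bsub>P\<^esub> b x)"
      using b by (intro P.finsum_cong) (auto simp: P.smult_l_distr simp_implies_def)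
    also have "\<dots> = free_lift R P b u \<oplus>\<^bsub>P\<^esub> free_lift R P b v"
      using b A by (subst (1 2) sup[OF _ A]) (auto simp: u v intro!: P.finsum_addf)
    finally show "free_lift R P b (u \<oplus>\<^bsub>free_module R X\<^esub> v) = free_lift R P b u \<oplus>\<^bsub>P\<^esub> free_lift R P b v" .
  }
  fix k assume k: "k \<in> carrier R"
  \<comment> \<open>The ring may have zero divisors, so the support of the multiple can be smaller
    than that of \<open>u\<close>; the latter still serves as an index set for both.\<close>
  let ?A = "{x. u x \<noteq> \<zero>}"
  have A: "finite ?A" "?A \<subseteq> X" and [simp]: "\<And>x. u x \<in> carrier R"
    using u by (auto simp: free_module_carrier_iff)
  have b: "b x \<in> carrier P" if "x \<in> ?A" for x using that A(2) assms(2) by blast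
  have "free_lift R P b (k \<odot>\<^bsub>free_module R X\<^esub> u) = (\<Oplus>\<^bsub>P\<^esub>x\<in>?A. (k \<otimes> u x) \<odot>\<^bsub>P\<^esub> b x)"
    using F.smult_closed[OF k u] A k by (subst sup) auto
  also have "\<dots> = (\<Oplus>\<^bsub>P\<^esub>x\<in>?A. k \<odot>\<^bsub>P\<^esub> (u x \<odot>\<^bsub>P\<^esub> b x))"
    using b k by (intro P.finsum_cong) (auto simp: P.smult_assoc1 simp_implies_def)
  also have "\<dots> = k \<odot>\<^bsub>P\<^esub> free_lift R P b u"
    unfolding free_lift_def using b A k by (subst P.finsum_smult_ldistr) auto
  finally show "free_lift R P b (k \<odot>\<^bsub>free_module R X\<^esub> u) = k \<odot>\<^bsub>P\<^esub> free_lift R P b u" .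
qed

lemma free_lift_basis:
  assumes "Module.module R P" "b x \<in> carrier P"
  shows "free_lift R P b (basis_vec R x) = b x"
proof -
  interpret P: Module.module R P by fact
  have b1: "basis_vec R x \<in> carrier (free_module R {x})" by (rule basis_vec_closed) simp
  \<comment> \<open>Summing over the singleton instead of the support covers the zero ring as well,
    where the support of a basis vector is empty.\<close>
  have "free_lift R P b (basis_vec R x) = (\<Oplus>\<^bsub>P\<^esub>y \<in> {x}. basis_vec R x y \<odot>\<^bsub>P\<^esub> b y)"
    using assms by (intro free_lift_superset[OF assms(1) _ b1]) (auto simp: basis_vec_def)
  also have "\<dots> = b x" using assms(2) by (simp add: basis_vec_def)
  finally show ?thesis .
qed

lemma lin_ext_eq_free_lift:
  assumes "\<phi> \<in> X \<rightarrow> carrier (free_module R Y)" "u \<in> carrier (free_module R X)"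
  shows "lin_ext R \<phi> u = free_lift R (free_module R Y) \<phi> u"
proof
  fix y
  interpret F: Module.module R "free_module R Y" by (rule module_free_module)
  have "(\<lambda>x. u x \<odot>\<^bsub>free_module R Y\<^esub> \<phi> x) \<in> {x. u x \<noteq> \<zero>} \<rightarrow> carrier (free_module R Y)"
    using assms by (intro Pi_I F.smult_closed) (auto simp: free_module_carrier_iff[of u])
  then show "lin_ext R \<phi> u y = free_lift R (free_module R Y) \<phi> u y"
    unfolding lin_ext_def free_lift_def by (simp add: finsum_free_module_apply)
qed

lemma lin_map_lin_ext:
  assumes "\<phi> \<in> X \<rightarrow> carrier (free_module R Y)"
  shows "lin_map R (free_module R X) (free_module R Y) (lin_ext R \<phi>)"
  by (rule lin_map_cong[OF lin_map_free_lift[OF module_free_module assms] module_free_module])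
    (simp add: lin_ext_eq_free_lift[OF assms])

lemma lin_ext_basis:
  assumes "\<phi> x \<in> carrier (free_module R Y)"
  shows "lin_ext R \<phi> (basis_vec R x) = \<phi> x"
proof -
  have "lin_ext R \<phi> (basis_vec R x) = free_lift R (free_module R Y) \<phi> (basis_vec R x)"
    by (rule lin_ext_eq_free_lift[of _ "{x}"]) (auto simp: assms basis_vec_closed)
  then show ?thesis using assms by (simp add: free_lift_basis[OF module_free_module])
qed

text \<open>For each identity in the parameter \<open>a\<close>, both sides are linear in
  \<open>u\<close>, so it is enough to compare them at basis vectors, where the identity is the
  linearity of \<open>\<psi> x\<close>.\<close>

lemma lin_map_lin_ext_param:
  assumes P: "Module.module R P"
    and \<psi>: "\<And>x. x \<in> X \<Longrightarrow> lin_map R P (free_module R Y) (\<psi> x)"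
    and u: "u \<in> carrier (free_module R X)"
  shows "lin_map R P (free_module R Y) (\<lambda>a. lin_ext R (\<lambda>x. \<psi> x a) u)"
proof -
  interpret P: Module.module R P by fact
  have lin: "lin_map R (free_module R X) (free_module R Y) (lin_ext R (\<lambda>x. \<psi> x a))"
    if "a \<in> carrier P" for a
    by (rule lin_map_lin_ext) (use that \<psi> in \<open>auto intro: lin_map_closed\<close>)
  have base: "lin_ext R (\<lambda>x. \<psi> x a) (basis_vec R x) = \<psi> x a" if "a \<in> carrier P" "x \<in> X" for a x
    by (rule lin_ext_basis) (use that \<psi> in \<open>auto intro: lin_map_closed\<close>)
  show ?thesis
  proof (rule lin_mapI)
    show "lin_ext R (\<lambda>x. \<psi> x a) u \<in> carrier (free_module R Y)" if "a \<in> carrier P" for a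
      using lin_map_closed[OF lin[OF that] u] .
  next
    fix a b assume ab: "a \<in> carrier P" "b \<in> carrier P"
    show "lin_ext R (\<lambda>x. \<psi> x (a \<oplus>\<^bsub>P\<^esub> b)) u =
        lin_ext R (\<lambda>x. \<psi> x a) u \<oplus>\<^bsub>free_module R Y\<^esub> lin_ext R (\<lambda>x. \<psi> x b) u"
      by (rule lin_map_eqI[OF module_free_module lin
            lin_map_sum[OF module_free_module lin lin] _ u])
        (use ab in \<open>simp_all add: base lin_map_add[OF \<psi>] del: free_module_simps\<close>)
  next
    fix k a assume ka: "k \<in> carrier R" "a \<in> carrier P"
    show "lin_ext R (\<lambda>x. \<psi> x (k \<odot>\<^bsub>P\<^esub> a)) u = k \<odot>\<^bsub>free_module R Y\<^esub> lin_ext R (\<lambda>x. \<psi> x a) u"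
      by (rule lin_map_eqI[OF module_free_module lin
            lin_map_scale[OF module_free_module lin] _ u])
        (use ka in \<open>simp_all add: base lin_map_smult[OF \<psi>] del: free_module_simps\<close>)
  qed
qed

text \<open>\<open>bil_ext\<close> is a linear extension in its first argument by construction;
  linearity in the second argument is linearity in a parameter of that extension.\<close>

lemma
  assumes \<psi>: "\<And>x y. \<lbrakk>x \<in> X; y \<in> Y\<rbrakk> \<Longrightarrow> \<psi> x y \<in> Z"
  shows bil_ext_lin_left: "a \<in> carrier (free_module R Y) \<Longrightarrow>
      lin_map R (free_module R X) (free_module R Z) (\<lambda>u. bil_ext R \<psi> u a)"
    and bil_ext_lin_right: "u \<in> carrier (free_module R X) \<Longrightarrow>
      lin_map R (free_module R Y) (free_module R Z) (bil_ext R \<psi> u)"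
    and bil_ext_basis: "\<lbrakk>x \<in> X; y \<in> Y\<rbrakk> \<Longrightarrow>
      bil_ext R \<psi> (basis_vec R x) (basis_vec R y) = basis_vec R (\<psi> x y)"
proof -
  have lin: "lin_map R (free_module R Y) (free_module R Z) (lin_ext R (\<lambda>y. basis_vec R (\<psi> x y)))"
    if "x \<in> X" for x
    by (rule lin_map_lin_ext) (use that \<psi> in \<open>auto intro: basis_vec_closed\<close>)
  show left: "lin_map R (free_module R X) (free_module R Z) (\<lambda>u. bil_ext R \<psi> u a)"
    if "a \<in> carrier (free_module R Y)" for a
    unfolding bil_ext_def
    by (rule lin_map_lin_ext) (use that in \<open>auto intro: lin_map_closed[OF lin]\<close>)
  show "lin_map R (free_module R Y) (free_module R Z) (bil_ext R \<psi> u)"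
    if "u \<in> carrier (free_module R X)" for u
    unfolding bil_ext_def by (rule lin_map_lin_ext_param[OF module_free_module lin that])
  show "bil_ext R \<psi> (basis_vec R x) (basis_vec R y) = basis_vec R (\<psi> x y)"
    if "x \<in> X" "y \<in> Y" for x y
  proof -
    have "lin_ext R (\<lambda>y. basis_vec R (\<psi> x y)) (basis_vec R y) = basis_vec R (\<psi> x y)"
      by (rule lin_ext_basis[where Y = Z]) (use that \<psi> in \<open>auto intro: basis_vec_closed\<close>)
    moreover have "bil_ext R \<psi> (basis_vec R x) (basis_vec R y) =
        lin_ext R (\<lambda>y. basis_vec R (\<psi> x y)) (basis_vec R y)"
      unfolding bil_ext_def
      by (rule lin_ext_basis)
        (rule lin_map_closed[OF lin[OF that(1)] basis_vec_closed[OF that(2)]])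
    ultimately show ?thesis by simp
  qed
qed

text \<open>The arguments are expanded one after the other. The second one is expanded while the
  first is a basis vector, so linearity in it is demanded only there.\<close>

lemma bilinear_eqI:
  assumes P: "Module.module R P"
    and "\<And>a. a \<in> carrier (free_module R Y) \<Longrightarrow> lin_map R (free_module R X) P (\<lambda>u. f u a)"
    and "\<And>a. a \<in> carrier (free_module R Y) \<Longrightarrow> lin_map R (free_module R X) P (\<lambda>u. g u a)"
    and "\<And>x. x \<in> X \<Longrightarrow> lin_map R (free_module R Y) P (f (basis_vec R x))"
    and "\<And>x. x \<in> X \<Longrightarrow> lin_map R (free_module R Y) P (g (basis_vec R x))"
    and "\<And>x y. \<lbrakk>x \<in> X; y \<in> Y\<rbrakk> \<Longrightarrow>
      f (basis_vec R x) (basis_vec R y) = g (basis_vec R x) (basis_vec R y)"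
    and "u \<in> carrier (free_module R X)" "a \<in> carrier (free_module R Y)"
  shows "f u a = g u a"
proof -
  have "f (basis_vec R x) a = g (basis_vec R x) a" if "x \<in> X" for x
    by (rule lin_map_eqI[OF P assms(4,5,6)]) (use that assms(8) in auto)
  then show ?thesis
    using lin_map_eqI[OF P assms(2,3)[OF assms(8)], of u] assms(7) by blast
qed

end

section \<open>Tensor products\<close>

text \<open>\<open>A\<close> enters through its operators on \<open>M\<close>: its carrier has to be
  closed under the operations and the operators have to compose accordingly. From \<open>B\<close>
  comes a right action commuting with them. This is what transfers a left action to the tensor
  product.\<close>

locale bimodule_over =
  fixes K :: "('k, 'c) ring_scheme" and A :: "('k, 'a, 'd) module_scheme"
    and B :: "('k, 'b, 'e) module_scheme" and M :: "('k, 'a, 'b, 'm, 'f) bimodule_scheme"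
  assumes module_M: "Module.module K M"
    and A_add_closed: "\<lbrakk>a \<in> carrier A; b \<in> carrier A\<rbrakk> \<Longrightarrow> a \<oplus>\<^bsub>A\<^esub> b \<in> carrier A"
    and A_mult_closed: "\<lbrakk>a \<in> carrier A; b \<in> carrier A\<rbrakk> \<Longrightarrow> a \<otimes>\<^bsub>A\<^esub> b \<in> carrier A"
    and A_smult_closed: "\<lbrakk>k \<in> carrier K; a \<in> carrier A\<rbrakk> \<Longrightarrow> k \<odot>\<^bsub>A\<^esub> a \<in> carrier A"
    and lact_M_lin: "a \<in> carrier A \<Longrightarrow> lin_map K M M (lact M a)"
    and lact_M_add: "\<lbrakk>a \<in> carrier A; b \<in> carrier A; m \<in> carrier M\<rbrakk>
      \<Longrightarrow> lact M (a \<oplus>\<^bsub>A\<^esub> b) m = lact M a m \<oplus>\<^bsub>M\<^esub> lact M b m"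
    and lact_M_mult: "\<lbrakk>a \<in> carrier A; b \<in> carrier A; m \<in> carrier M\<rbrakk>
      \<Longrightarrow> lact M (a \<otimes>\<^bsub>A\<^esub> b) m = lact M a (lact M b m)"
    and lact_M_smult: "\<lbrakk>k \<in> carrier K; a \<in> carrier A; m \<in> carrier M\<rbrakk>
      \<Longrightarrow> lact M (k \<odot>\<^bsub>A\<^esub> a) m = k \<odot>\<^bsub>M\<^esub> lact M a m"
    and ract_closed: "\<lbrakk>m \<in> carrier M; c \<in> carrier B\<rbrakk> \<Longrightarrow> ract M m c \<in> carrier M"
    and lact_ract: "\<lbrakk>a \<in> carrier A; m \<in> carrier M; c \<in> carrier B\<rbrakk>
      \<Longrightarrow> lact M a (ract M m c) = ract M (lact M a m) c"

locale tensor_setting = bimodule_over K A B M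
  for K :: "('k, 'c) ring_scheme" and A :: "('k, 'a, 'd) module_scheme"
    and B :: "('k, 'b, 'e) module_scheme" and M :: "('k, 'a, 'b, 'm, 'f) bimodule_scheme" +
  fixes N :: "('k, 'b, 'n, 'g) amodule_scheme"
  assumes module_N: "Module.module K N"
    and lact_N_closed: "\<lbrakk>b \<in> carrier B; n \<in> carrier N\<rbrakk> \<Longrightarrow> lact N b n \<in> carrier N"

sublocale tensor_setting \<subseteq> K: cring K
  using module_M by (rule Module.module.axioms(1))

context tensor_setting
begin

abbreviation "F \<equiv> free_module K (carrier M \<times> carrier N)"
abbreviation "Rel \<equiv> tensor_relations K M B N"
abbreviation "T \<equiv> tensor_product K M B N"
abbreviation "e m n \<equiv> basis_vec K (m, n)"

definition cls :: "('m \<times> 'n \<Rightarrow> 'k) \<Rightarrow> ('m \<times> 'n \<Rightarrow> 'k) set" where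
  "cls u = Rel +>\<^bsub>F\<^esub> u"

definition tens :: "'m \<Rightarrow> 'n \<Rightarrow> ('m \<times> 'n \<Rightarrow> 'k) set" where
  "tens m n = cls (e m n)"

lemma module_F: "Module.module K F"
  by (rule K.module_free_module)

lemma e_closed: "\<lbrakk>m \<in> carrier M; n \<in> carrier N\<rbrakk> \<Longrightarrow> e m n \<in> carrier F"
  by (rule K.basis_vec_closed) simp

text \<open>The set that \<open>tensor_relations\<close> spans, named so that membership in one of
  its five families can be used directly.\<close>

definition gens :: "('m \<times> 'n \<Rightarrow> 'k) set" where
  "gens = {e (m \<oplus>\<^bsub>M\<^esub> m') n \<ominus>\<^bsub>F\<^esub> (e m n \<oplus>\<^bsub>F\<^esub> e m' n) | m m' n.
          m \<in> carrier M \<and> m' \<in> carrier M \<and> n \<in> carrier N} \<union>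
      {e m (n \<oplus>\<^bsub>N\<^esub> n') \<ominus>\<^bsub>F\<^esub> (e m n \<oplus>\<^bsub>F\<^esub> e m n') | m n n'.
          m \<in> carrier M \<and> n \<in> carrier N \<and> n' \<in> carrier N} \<union>
      {e (k \<odot>\<^bsub>M\<^esub> m) n \<ominus>\<^bsub>F\<^esub> k \<odot>\<^bsub>F\<^esub> e m n | k m n.
          k \<in> carrier K \<and> m \<in> carrier M \<and> n \<in> carrier N} \<union>
      {e m (k \<odot>\<^bsub>N\<^esub> n) \<ominus>\<^bsub>F\<^esub> k \<odot>\<^bsub>F\<^esub> e m n | k m n.
          k \<in> carrier K \<and> m \<in> carrier M \<and> n \<in> carrier N} \<union>
      {e (ract M m b) n \<ominus>\<^bsub>F\<^esub> e m (lact N b n) | m b n.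
          m \<in> carrier M \<and> b \<in> carrier B \<and> n \<in> carrier N}"

lemma Rel_eq: "Rel = lin_span K F gens"
  unfolding tensor_relations_def gens_def Let_def tensor_free_def ..

lemma gens_subset: "gens \<subseteq> carrier F"
proof -
  interpret F: Module.module K F by (rule module_F)
  interpret M: Module.module K M by (rule module_M)
  interpret N: Module.module K N by (rule module_N)
  show ?thesis
    unfolding gens_def
    by (auto simp del: K.free_module_simps
        intro!: F.minus_closed F.a_closed F.smult_closed e_closed ract_closed lact_N_closed)
qed

lemma Rel_submodule: "submodule Rel K F"
  unfolding Rel_eq by (rule lin_span_submodule[OF module_F gens_subset])

lemma Rel_subgroup: "subgroup Rel (add_monoid F)"
  using Rel_submodule by (rule submodule.axioms(1))

lemma Rel_abelian_subgroup: "abelian_subgroup Rel F"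
  using Rel_subgroup Module.module.axioms(2)[OF module_F]
  by (intro abelian_subgroupI3) (auto simp: additive_subgroup_def)

lemma cls_self: "u \<in> carrier F \<Longrightarrow> u \<in> cls u"
  unfolding cls_def by (rule abelian_subgroup.a_rcos_self[OF Rel_abelian_subgroup])

lemma cls_subset: "u \<in> carrier F \<Longrightarrow> cls u \<subseteq> carrier F"
proof -
  interpret F: Module.module K F by (rule module_F)
  show "u \<in> carrier F \<Longrightarrow> ?thesis"
    unfolding cls_def by (rule F.a_r_coset_subset_G[OF submodule_subset[OF Rel_submodule]])
qed

lemma mem_cls_iff: "\<lbrakk>u \<in> carrier F; v \<in> carrier F\<rbrakk> \<Longrightarrow> v \<in> cls u \<longleftrightarrow> v \<ominus>\<^bsub>F\<^esub> u \<in> Rel"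
proof -
  interpret F: Module.module K F by (rule module_F)
  show "\<lbrakk>u \<in> carrier F; v \<in> carrier F\<rbrakk> \<Longrightarrow> ?thesis"
    unfolding cls_def a_minus_def
    by (rule abelian_subgroup.a_rcos_module[OF Rel_abelian_subgroup])
qed

lemma cls_eqI:
  assumes "u \<in> carrier F" "v \<in> cls u"
  shows "cls v = cls u"
proof -
  interpret F: Module.module K F by (rule module_F)
  show ?thesis
    using F.a_repr_independence[OF assms(2)[unfolded cls_def] assms(1) Rel_subgroup]
    unfolding cls_def by simp
qed

lemma cls_eq_iff: "\<lbrakk>u \<in> carrier F; v \<in> carrier F\<rbrakk> \<Longrightarrow> cls v = cls u \<longleftrightarrow> v \<ominus>\<^bsub>F\<^esub> u \<in> Rel"
  using cls_eqI cls_self mem_cls_iff by metis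

lemma carrier_T: "carrier T = cls ` carrier F"
  unfolding tensor_product_def Let_def tensor_free_def cls_def by (auto simp: A_RCOSETS_def')

lemma cls_closed: "u \<in> carrier F \<Longrightarrow> cls u \<in> carrier T"
  by (simp add: carrier_T)

lemma add_T: "\<lbrakk>u \<in> carrier F; v \<in> carrier F\<rbrakk> \<Longrightarrow> cls u \<oplus>\<^bsub>T\<^esub> cls v = cls (u \<oplus>\<^bsub>F\<^esub> v)"
  unfolding tensor_product_def Let_def tensor_free_def cls_def
  using abelian_subgroup.a_rcos_sum[OF Rel_abelian_subgroup, of u v] by simp

lemma zero_T: "\<zero>\<^bsub>T\<^esub> = cls \<zero>\<^bsub>F\<^esub>"
proof -
  interpret F: Module.module K F by (rule module_F)
  show ?thesis
    unfolding tensor_product_def Let_def tensor_free_def cls_def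
    using F.a_coset_add_zero[OF submodule_subset[OF Rel_submodule]] by simp
qed

text \<open>Scalar multiplication and action on classes are defined as unions over all
  representatives. Such a union collapses to one coset once the value is independent of the
  representative.\<close>

lemma UN_cls:
  assumes "u \<in> carrier F" "\<And>v. v \<in> cls u \<Longrightarrow> g v = g u"
  shows "(\<Union>v \<in> cls u. g v) = g u"
  using cls_self[OF assms(1)] assms(2) by blast

lemma smult_T:
  assumes k: "k \<in> carrier K" and u: "u \<in> carrier F"
  shows "k \<odot>\<^bsub>T\<^esub> cls u = cls (k \<odot>\<^bsub>F\<^esub> u)"
proof -
  interpret F: Module.module K F by (rule module_F)
  have "k \<odot>\<^bsub>T\<^esub> cls u = (\<Union>v \<in> cls u. cls (k \<odot>\<^bsub>F\<^esub> v))"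
    unfolding tensor_product_def Let_def tensor_free_def cls_def by simp
  also have "\<dots> = cls (k \<odot>\<^bsub>F\<^esub> u)"
  proof (rule UN_cls[OF u])
    fix v assume v: "v \<in> cls u"
    then have vc: "v \<in> carrier F" using cls_subset[OF u] by auto
    have "k \<odot>\<^bsub>F\<^esub> (v \<ominus>\<^bsub>F\<^esub> u) = k \<odot>\<^bsub>F\<^esub> v \<ominus>\<^bsub>F\<^esub> k \<odot>\<^bsub>F\<^esub> u"
      unfolding a_minus_def using k u vc
      by (simp add: F.smult_r_distr F.smult_r_minus del: K.free_module_simps)
    moreover have "k \<odot>\<^bsub>F\<^esub> (v \<ominus>\<^bsub>F\<^esub> u) \<in> Rel"
      using v vc u k by (intro submodule_smult[OF Rel_submodule]) (simp_all add: mem_cls_iff)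
    ultimately show "cls (k \<odot>\<^bsub>F\<^esub> v) = cls (k \<odot>\<^bsub>F\<^esub> u)"
      using k u vc by (simp add: cls_eq_iff F.smult_closed del: K.free_module_simps)
  qed
  finally show ?thesis .
qed

lemma module_T: "Module.module K T"
  by (rule module_surj_image[OF module_F, of cls]) (simp_all add: carrier_T add_T smult_T zero_T)

lemma lin_map_cls: "lin_map K F T cls"
  by (rule lin_mapI) (simp_all add: cls_closed add_T smult_T)

lemma tens_closed: "\<lbrakk>m \<in> carrier M; n \<in> carrier N\<rbrakk> \<Longrightarrow> tens m n \<in> carrier T"
  unfolding tens_def by (intro cls_closed e_closed)

lemma cls_eq_of_gens: "\<lbrakk>u \<in> carrier F; v \<in> carrier F; v \<ominus>\<^bsub>F\<^esub> u \<in> gens\<rbrakk> \<Longrightarrow> cls v = cls u"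
  using lin_span_superset[of gens K F] by (auto simp: cls_eq_iff Rel_eq)

lemma
  shows tens_add_left: "\<lbrakk>m \<in> carrier M; m' \<in> carrier M; n \<in> carrier N\<rbrakk>
      \<Longrightarrow> tens (m \<oplus>\<^bsub>M\<^esub> m') n = tens m n \<oplus>\<^bsub>T\<^esub> tens m' n"
    and tens_add_right: "\<lbrakk>m \<in> carrier M; n \<in> carrier N; n' \<in> carrier N\<rbrakk>
      \<Longrightarrow> tens m (n \<oplus>\<^bsub>N\<^esub> n') = tens m n \<oplus>\<^bsub>T\<^esub> tens m n'"
    and tens_smult_left: "\<lbrakk>k \<in> carrier K; m \<in> carrier M; n \<in> carrier N\<rbrakk>
      \<Longrightarrow> tens (k \<odot>\<^bsub>M\<^esub> m) n = k \<odot>\<^bsub>T\<^esub> tens m n"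
    and tens_smult_right: "\<lbrakk>k \<in> carrier K; m \<in> carrier M; n \<in> carrier N\<rbrakk>
      \<Longrightarrow> tens m (k \<odot>\<^bsub>N\<^esub> n) = k \<odot>\<^bsub>T\<^esub> tens m n"
    and tens_balanced: "\<lbrakk>m \<in> carrier M; b \<in> carrier B; n \<in> carrier N\<rbrakk>
      \<Longrightarrow> tens (ract M m b) n = tens m (lact N b n)"
proof -
  interpret F: Module.module K F by (rule module_F)
  interpret M: Module.module K M by (rule module_M)
  interpret N: Module.module K N by (rule module_N)
  note c = e_closed F.a_closed F.smult_closed M.a_closed N.a_closed M.smult_closed N.smult_closed
    ract_closed lact_N_closed
  show "tens (m \<oplus>\<^bsub>M\<^esub> m') n = tens m n \<oplus>\<^bsub>T\<^esub> tens m' n"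
    if "m \<in> carrier M" "m' \<in> carrier M" "n \<in> carrier N" for m m' n
    unfolding tens_def add_T[OF e_closed[OF that(1,3)] e_closed[OF that(2,3)]]
    using that unfolding gens_def by (intro cls_eq_of_gens c) (simp_all only: gens_def, blast)
  show "tens m (n \<oplus>\<^bsub>N\<^esub> n') = tens m n \<oplus>\<^bsub>T\<^esub> tens m n'"
    if "m \<in> carrier M" "n \<in> carrier N" "n' \<in> carrier N" for m n n'
    unfolding tens_def add_T[OF e_closed[OF that(1,2)] e_closed[OF that(1,3)]]
    using that by (intro cls_eq_of_gens c) (simp_all only: gens_def, blast)
  show "tens (k \<odot>\<^bsub>M\<^esub> m) n = k \<odot>\<^bsub>T\<^esub> tens m n"
    if "k \<in> carrier K" "m \<in> carrier M" "n \<in> carrier N" for k m n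
    unfolding tens_def smult_T[OF that(1) e_closed[OF that(2,3)]]
    using that by (intro cls_eq_of_gens c) (simp_all only: gens_def, blast)
  show "tens m (k \<odot>\<^bsub>N\<^esub> n) = k \<odot>\<^bsub>T\<^esub> tens m n"
    if "k \<in> carrier K" "m \<in> carrier M" "n \<in> carrier N" for k m n
    unfolding tens_def smult_T[OF that(1) e_closed[OF that(2,3)]]
    using that by (intro cls_eq_of_gens c) (simp_all only: gens_def, blast)
  show "tens (ract M m b) n = tens m (lact N b n)"
    if "m \<in> carrier M" "b \<in> carrier B" "n \<in> carrier N" for m b n
    unfolding tens_def
    using that by (intro cls_eq_of_gens c) (simp_all only: gens_def, blast)
qed

lemma lin_map_tens_left: "n \<in> carrier N \<Longrightarrow> lin_map K M T (\<lambda>m. tens m n)"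
  by (rule lin_mapI) (simp_all add: tens_closed tens_add_left tens_smult_left)

lemma lin_map_tens_right: "m \<in> carrier M \<Longrightarrow> lin_map K N T (tens m)"
  by (rule lin_mapI) (simp_all add: tens_closed tens_add_right tens_smult_right)

text \<open>The induction principle for pure tensors, inherited from the free module along the
  quotient map.\<close>

lemma tens_span:
  assumes H: "submodule H K T" and "\<And>m n. \<lbrakk>m \<in> carrier M; n \<in> carrier N\<rbrakk> \<Longrightarrow> tens m n \<in> H"
  shows "carrier T \<subseteq> H"
proof -
  have "carrier F \<subseteq> {u \<in> carrier F. cls u \<in> H}"
    by (rule K.free_module_span[OF submodule_vimage[OF module_F module_T lin_map_cls H]])
      (use assms(2) e_closed in \<open>auto simp: tens_def\<close>)
  then show ?thesis by (auto simp: carrier_T)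
qed

lemma tens_eqI:
  assumes P: "Module.module K P" "lin_map K T P f" "lin_map K T P g"
    and "\<And>m n. \<lbrakk>m \<in> carrier M; n \<in> carrier N\<rbrakk> \<Longrightarrow> f (tens m n) = g (tens m n)"
    and "w \<in> carrier T"
  shows "f w = g w"
proof -
  have "carrier T \<subseteq> {w \<in> carrier T. f w = g w}"
    by (rule tens_span[OF submodule_equalizer[OF module_T P]]) (simp add: assms(4) tens_closed)
  then show ?thesis using assms(5) by auto
qed

section \<open>The universal property of the tensor product\<close>

definition balanced :: "('k, 'p, 'h) module_scheme \<Rightarrow> ('m \<Rightarrow> 'n \<Rightarrow> 'p) \<Rightarrow> bool" where
  "balanced P \<beta> \<longleftrightarrow> (\<forall>n \<in> carrier N. lin_map K M P (\<lambda>m. \<beta> m n)) \<and>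
    (\<forall>m \<in> carrier M. lin_map K N P (\<beta> m)) \<and>
    (\<forall>m \<in> carrier M. \<forall>b \<in> carrier B. \<forall>n \<in> carrier N. \<beta> (ract M m b) n = \<beta> m (lact N b n))"

text \<open>The two additivities, the two homogeneities and the balance of \<open>\<beta>\<close>
  kill one family of generators each; the kernel of \<open>g\<close> is a submodule and so contains
  their span.\<close>

lemma Rel_kernel:
  assumes P: "Module.module K P" and \<beta>: "balanced P \<beta>" and g: "lin_map K F P g"
    and ge: "\<And>m n. \<lbrakk>m \<in> carrier M; n \<in> carrier N\<rbrakk> \<Longrightarrow> g (e m n) = \<beta> m n"
    and u: "u \<in> Rel"
  shows "g u = \<zero>\<^bsub>P\<^esub>"
proof -
  interpret F: Module.module K F by (rule module_F)
  interpret M: Module.module K M by (rule module_M)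
  interpret N: Module.module K N by (rule module_N)
  interpret P: Module.module K P by (rule P)
  note c = e_closed F.a_closed F.smult_closed M.a_closed N.a_closed M.smult_closed N.smult_closed
    ract_closed lact_N_closed
  have \<beta>l: "lin_map K M P (\<lambda>m. \<beta> m n)" if "n \<in> carrier N" for n
    using \<beta> that unfolding balanced_def by blast
  have \<beta>r: "lin_map K N P (\<beta> m)" if "m \<in> carrier M" for m
    using \<beta> that unfolding balanced_def by blast
  have \<beta>b: "\<beta> (ract M m b) n = \<beta> m (lact N b n)"
    if "m \<in> carrier M" "b \<in> carrier B" "n \<in> carrier N" for m b n
    using \<beta> that unfolding balanced_def by blast
  have \<beta>c: "\<beta> m n \<in> carrier P" if "m \<in> carrier M" "n \<in> carrier N" for m n
    using \<beta>r[OF that(1)] that(2) by (rule lin_map_closed)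
  note s = lin_map_minus[OF module_F P g] lin_map_add[OF g] lin_map_smult[OF g] ge
    lin_map_add[OF \<beta>l] lin_map_add[OF \<beta>r] lin_map_smult[OF \<beta>l] lin_map_smult[OF \<beta>r] \<beta>b
  have "gens \<subseteq> {u \<in> carrier F. g u = \<zero>\<^bsub>P\<^esub>}"
  proof
    fix v assume v: "v \<in> gens"
    then have "v \<in> carrier F" using gens_subset by auto
    moreover from v have "g v = \<zero>\<^bsub>P\<^esub>"
      unfolding gens_def
      by (auto simp: s c \<beta>c P.minus_eq P.M.r_neg simp del: K.free_module_simps)
    ultimately show "v \<in> {u \<in> carrier F. g u = \<zero>\<^bsub>P\<^esub>}" by simp
  qed
  then have "Rel \<subseteq> {u \<in> carrier F. g u = \<zero>\<^bsub>P\<^esub>}"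
    unfolding Rel_eq by (rule lin_span_least[OF submodule_kernel[OF module_F P g]])
  then show ?thesis using u by auto
qed

text \<open>Independence of the representative. Used for maps out of the tensor product and, with
  the tensor product itself as target, for its left action.\<close>

lemma balanced_cls_const:
  assumes P: "Module.module K P" and \<beta>: "balanced P \<beta>" and g: "lin_map K F P g"
    and ge: "\<And>m n. \<lbrakk>m \<in> carrier M; n \<in> carrier N\<rbrakk> \<Longrightarrow> g (e m n) = \<beta> m n"
    and u: "u \<in> carrier F" "v \<in> cls u"
  shows "g v = g u"
proof -
  interpret F: Module.module K F by (rule module_F)
  interpret P: Module.module K P by (rule P)
  have v: "v \<in> carrier F" using cls_subset[OF u(1)] u(2) by auto
  have "g (v \<ominus>\<^bsub>F\<^esub> u) = \<zero>\<^bsub>P\<^esub>"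
    by (rule Rel_kernel[OF P \<beta> g ge]) (use u v mem_cls_iff in auto)
  then have "g v \<oplus>\<^bsub>P\<^esub> \<ominus>\<^bsub>P\<^esub> g u = \<zero>\<^bsub>P\<^esub>"
    by (simp add: lin_map_minus[OF module_F P g v u(1)] P.minus_eq)
  then have "\<ominus>\<^bsub>P\<^esub> (\<ominus>\<^bsub>P\<^esub> g u) = g v"
    using lin_map_closed[OF g] u(1) v by (intro P.minus_equality) auto
  then show ?thesis using lin_map_closed[OF g] u(1) by simp
qed

lemma tensor_lift:
  assumes P: "Module.module K P" and \<beta>: "balanced P \<beta>"
  shows "\<exists>f. lin_map K T P f \<and> (\<forall>m \<in> carrier M. \<forall>n \<in> carrier N. f (tens m n) = \<beta> m n)"
proof -
  define g where "g = free_lift K P (\<lambda>(m, n). \<beta> m n)"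
  have \<beta>c: "\<beta> m n \<in> carrier P" if "m \<in> carrier M" "n \<in> carrier N" for m n
    using \<beta> that unfolding balanced_def lin_map_def by blast
  have g: "lin_map K F P g"
    unfolding g_def by (rule K.lin_map_free_lift[OF P]) (auto simp: \<beta>c)
  have ge: "g (e m n) = \<beta> m n" if "m \<in> carrier M" "n \<in> carrier N" for m n
    unfolding g_def using that \<beta>c by (subst K.free_lift_basis[OF P]) auto
  \<comment> \<open>An arbitrary representative is chosen; by \<open>balanced_cls_const\<close> all
    representatives give the same value.\<close>
  define f where "f X = g (SOME u. u \<in> X)" for X
  have fcls: "f (cls u) = g u" if "u \<in> carrier F" for u
    unfolding f_def
  proof (rule balanced_cls_const[OF P \<beta> g _ that])
    show "(SOME v. v \<in> cls u) \<in> cls u"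
      using cls_self[OF that] by (rule someI[where P = "\<lambda>v. v \<in> cls u"])
  qed (rule ge)
  interpret F: Module.module K F by (rule module_F)
  have "lin_map K T P f"
    by (rule lin_mapI)
      (auto simp: carrier_T add_T smult_T fcls lin_map_closed[OF g] lin_map_add[OF g]
        lin_map_smult[OF g] simp del: K.free_module_simps)
  then show ?thesis using ge fcls e_closed unfolding tens_def by auto
qed

text \<open>Balance of \<open>(m, n) \<mapsto> am \<otimes> n\<close> is exactly the commutation
  \<open>lact_ract\<close> of the two actions on \<open>M\<close>, followed by the relation moving
  an element of \<open>B\<close> across the tensor sign.\<close>

lemma balanced_lact: "a \<in> carrier A \<Longrightarrow> balanced T (\<lambda>m n. tens (lact M a m) n)"
  unfolding balanced_def
  by (auto simp: lact_ract tens_balanced lin_map_closed[OF lact_M_lin]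
      intro!: lin_map_comp[OF lact_M_lin lin_map_tens_left] lin_map_tens_right)

lemma
  assumes a: "a \<in> carrier A"
  shows lact_T_lin: "lin_map K T T (lact T a)"
    and lact_T_tens: "\<lbrakk>m \<in> carrier M; n \<in> carrier N\<rbrakk> \<Longrightarrow> lact T a (tens m n) = tens (lact M a m) n"
proof -
  \<comment> \<open>The map on representatives from the definition of the action. Its composite with
    the quotient map extends a balanced map, hence is constant on classes.\<close>
  define h :: "('m \<times> 'n \<Rightarrow> 'k) \<Rightarrow> 'm \<times> 'n \<Rightarrow> 'k" where "h = lin_ext K (\<lambda>(m, n). e (lact M a m) n)"
  have im: "(\<lambda>(m, n). e (lact M a m) n) \<in> carrier M \<times> carrier N \<rightarrow> carrier F"
    using lin_map_closed[OF lact_M_lin[OF a]] e_closed by auto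
  have h: "lin_map K F F h"
    unfolding h_def by (rule K.lin_map_lin_ext[OF im])
  have he: "h (e m n) = e (lact M a m) n" if "m \<in> carrier M" "n \<in> carrier N" for m n
    unfolding h_def using that
    by (subst K.lin_ext_basis[where Y = "carrier M \<times> carrier N"])
      (auto intro: e_closed lin_map_closed[OF lact_M_lin[OF a]])
  have g: "lin_map K F T (\<lambda>u. cls (h u))" by (rule lin_map_comp[OF h lin_map_cls])
  have lact_cls: "lact T a (cls u) = cls (h u)" if u: "u \<in> carrier F" for u
  proof -
    have "lact T a (cls u) = (\<Union>v \<in> cls u. cls (h v))"
      unfolding tensor_product_def Let_def tensor_free_def cls_def h_def by simp
    also have "\<dots> = cls (h u)"
      by (rule UN_cls[OF u], rule balanced_cls_const[OF module_T balanced_lact[OF a] g _ u])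
        (simp_all add: he tens_def)
    finally show ?thesis .
  qed
  interpret F: Module.module K F by (rule module_F)
  show "lin_map K T T (lact T a)"
    by (rule lin_mapI)
      (auto simp: carrier_T add_T smult_T lact_cls lin_map_closed[OF h] lin_map_add[OF h]
        lin_map_smult[OF h] simp del: K.free_module_simps)
  show "lact T a (tens m n) = tens (lact M a m) n" if "m \<in> carrier M" "n \<in> carrier N"
    unfolding tens_def using that by (simp add: lact_cls he e_closed)
qed

lemma lact_T_add:
  assumes "a \<in> carrier A" "b \<in> carrier A" "w \<in> carrier T"
  shows "lact T (a \<oplus>\<^bsub>A\<^esub> b) w = lact T a w \<oplus>\<^bsub>T\<^esub> lact T b w"
  by (rule tens_eqI[OF module_T lact_T_lin lin_map_sum[OF module_T lact_T_lin lact_T_lin] _ assms(3)])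
    (use assms in \<open>simp_all add: A_add_closed lact_T_tens lact_M_add tens_add_left
      lin_map_closed[OF lact_M_lin]\<close>)

lemma lact_T_smult:
  assumes "k \<in> carrier K" "a \<in> carrier A" "w \<in> carrier T"
  shows "lact T (k \<odot>\<^bsub>A\<^esub> a) w = k \<odot>\<^bsub>T\<^esub> lact T a w"
  by (rule tens_eqI[OF module_T lact_T_lin lin_map_scale[OF module_T lact_T_lin] _ assms(3)])
    (use assms in \<open>simp_all add: A_smult_closed lact_T_tens lact_M_smult tens_smult_left
      lin_map_closed[OF lact_M_lin]\<close>)

lemma lact_T_mult:
  assumes "a \<in> carrier A" "b \<in> carrier A" "w \<in> carrier T"
  shows "lact T (a \<otimes>\<^bsub>A\<^esub> b) w = lact T a (lact T b w)"
  by (rule tens_eqI[OF module_T lact_T_lin lin_map_comp[OF lact_T_lin lact_T_lin] _ assms(3)])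
    (use assms in \<open>simp_all add: A_mult_closed lact_T_tens lact_M_mult
      lin_map_closed[OF lact_M_lin]\<close>)

end

section \<open>Induced modules\<close>

text \<open>Functions with finite support on each fibre form an algebra under convolution that contains
  the Steinberg algebra and acts on \<open>KL\<^sub>x\<close> by the same formula. Working over it avoids showing
  that the Steinberg algebra is closed under convolution.\<close>

definition fibre_finite_algebra ::
  "('k, 'c) ring_scheme \<Rightarrow> ('g, 'e) groupoid_scheme \<Rightarrow> ('k, 'g \<Rightarrow> 'k) module" where
  "fibre_finite_algebra K G = function_module K (carrier G)
    \<lparr>carrier := {f \<in> carrier (function_module K (carrier G)).
        \<forall>y. finite {g \<in> fibre G y. f g \<noteq> \<zero>\<^bsub>K\<^esub>}},
     mult := convolution K G\<rparr>"

lemma fibre_iff: "t \<in> fibre G x \<longleftrightarrow> t \<in> carrier G \<and> dm G t = x"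
  by (simp add: fibre_def)

section \<open>Cancellation in a groupoid\<close>

context groupoid
begin

lemmas [simp] = dm_closed rn_closed dm_dm rn_dm dm_rn rn_rn comp_closed dm_comp rn_comp comp_dm
  rn_comp_self ginv_closed dm_ginv rn_ginv ginv_comp comp_ginv

lemma comp_ginv_cancel [simp]:
  "\<lbrakk>g \<in> carrier G; t \<in> carrier G; dm G g = rn G t\<rbrakk> \<Longrightarrow> g \<cdot> t \<cdot> ginv G t = g"
  by (metis comp_assoc comp_dm comp_ginv ginv_closed rn_ginv)

lemma comp_ginv_cancel' [simp]:
  "\<lbrakk>g \<in> carrier G; t \<in> carrier G; dm G g = dm G t\<rbrakk> \<Longrightarrow> g \<cdot> ginv G t \<cdot> t = g"
  by (metis comp_assoc comp_dm dm_ginv ginv_closed ginv_comp rn_ginv)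

lemma ginv_comp_cancel [simp]:
  "\<lbrakk>g \<in> carrier G; t \<in> carrier G; rn G g = rn G t\<rbrakk> \<Longrightarrow> t \<cdot> (ginv G t \<cdot> g) = g"
  by (metis comp_assoc comp_ginv dm_ginv ginv_closed rn_comp_self rn_ginv)

lemma ginv_comp_cancel' [simp]:
  "\<lbrakk>g \<in> carrier G; t \<in> carrier G; dm G t = rn G g\<rbrakk> \<Longrightarrow> ginv G t \<cdot> (t \<cdot> g) = g"
  by (metis comp_assoc dm_ginv ginv_closed ginv_comp rn_comp_self)

lemma ginv_ginv [simp]: "g \<in> carrier G \<Longrightarrow> ginv G (ginv G g) = g"
  by (metis comp_dm comp_ginv_cancel' dm_ginv ginv_closed ginv_comp rn_comp_self rn_ginv)

lemma ginv_prod: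
  assumes "g \<in> carrier G" "h \<in> carrier G" "dm G g = rn G h"
  shows "ginv G (g \<cdot> h) = ginv G h \<cdot> ginv G g"
proof -
  have "ginv G h \<cdot> ginv G g \<cdot> (g \<cdot> h) = dm G h"
    using assms by (simp add: comp_assoc)
  then have "ginv G h \<cdot> ginv G g \<cdot> (g \<cdot> h) \<cdot> ginv G (g \<cdot> h) = dm G h \<cdot> ginv G (g \<cdot> h)"
    by simp
  moreover have "dm G h \<cdot> ginv G (g \<cdot> h) = ginv G (g \<cdot> h)"
    using assms rn_comp_self[of "ginv G (g \<cdot> h)"] by simp
  ultimately show ?thesis using assms by simp
qed

text \<open>The substitution rule behind \<open>lact_M_mult_basis\<close>: putting
  \<open>w = s t^-1\<close> turns a convolution sum at \<open>y t^-1\<close> into a sum over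
  \<open>s\<close> in \<open>L_x\<close>.\<close>

lemma comp_ginv_quotient:
  assumes "y \<in> carrier G" "s \<in> carrier G" "t \<in> carrier G" "dm G y = dm G t" "dm G s = dm G t"
  shows "y \<cdot> ginv G t \<cdot> ginv G (s \<cdot> ginv G t) = y \<cdot> ginv G s"
proof -
  have "ginv G (s \<cdot> ginv G t) = t \<cdot> ginv G s" using assms by (simp add: ginv_prod)
  moreover have "y \<cdot> ginv G t \<cdot> (t \<cdot> ginv G s) = y \<cdot> ginv G t \<cdot> t \<cdot> ginv G s"
    using assms by (subst comp_assoc[of "y \<cdot> ginv G t" t]) auto
  ultimately show ?thesis using assms by simp
qed

end

section \<open>The bimodule \<open>KL_x\<close> over the functions with finite support on
  fibres\<close>

locale pointed_groupoid = groupoid G + K: cring K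
  for G :: "('g, 'e) groupoid_scheme" (structure) and K :: "('k, 'c) ring_scheme" +
  fixes x :: 'g
  assumes x_unit: "x \<in> unit_space G"
begin

abbreviation "L \<equiv> fibre G x"
abbreviation "H \<equiv> carrier (isotropy_group G x)"
abbreviation "A' \<equiv> fibre_finite_algebra K G"
abbreviation "B \<equiv> group_algebra K (isotropy_group G x)"
abbreviation "M \<equiv> fibre_bimodule K G x"

lemma x_closed [simp]: "x \<in> carrier G" and dm_x [simp]: "dm G x = x" and rn_x [simp]: "rn G x = x"
proof -
  show x: "x \<in> carrier G" and d: "dm G x = x" using x_unit by (auto simp: unit_space_def)
  show "rn G x = x" using rn_dm[OF x] d by simp
qed

lemma x_fibre: "x \<in> L"
  by (simp add: fibre_iff)

lemma isotropy_iff: "g \<in> H \<longleftrightarrow> g \<in> carrier G \<and> dm G g = x \<and> rn G g = x"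
  by (simp add: isotropy_group_def)

lemma carrier_A'_iff: "f \<in> carrier A' \<longleftrightarrow> f \<in> carrier (function_module K (carrier G)) \<and>
    (\<forall>y. finite {g \<in> fibre G y. f g \<noteq> \<zero>\<^bsub>K\<^esub>})"
  by (simp add: fibre_finite_algebra_def)

lemma A'_closed: "f \<in> carrier A' \<Longrightarrow> f g \<in> carrier K"
  by (simp add: carrier_A'_iff K.function_module_carrier_iff)

lemma A'_finite: "f \<in> carrier A' \<Longrightarrow> finite {g \<in> fibre G y. f g \<noteq> \<zero>\<^bsub>K\<^esub>}"
  by (simp add: carrier_A'_iff)

lemma A'_ops [simp]:
  "f \<oplus>\<^bsub>A'\<^esub> g = (\<lambda>x. f x \<oplus>\<^bsub>K\<^esub> g x)"
  "k \<odot>\<^bsub>A'\<^esub> f = (\<lambda>x. k \<otimes>\<^bsub>K\<^esub> f x)"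
  "f \<otimes>\<^bsub>A'\<^esub> g = convolution K G f g"
  by (simp_all add: fibre_finite_algebra_def function_module_def)

lemma M_ops:
  "carrier M = carrier (free_module K L)" "\<zero>\<^bsub>M\<^esub> = \<zero>\<^bsub>free_module K L\<^esub>"
  "u \<oplus>\<^bsub>M\<^esub> v = u \<oplus>\<^bsub>free_module K L\<^esub> v" "k \<odot>\<^bsub>M\<^esub> v = k \<odot>\<^bsub>free_module K L\<^esub> v"
  "ract M u a = bil_ext K (gcomp G) u a"
  by (simp_all add: fibre_bimodule_def Let_def bil_ext_def)

lemma module_M': "Module.module K M"
  by (rule module_surj_image[OF K.module_free_module, of "\<lambda>x. x" L])
    (simp_all add: M_ops del: K.free_module_simps)

lemma lin_map_M:
  "lin_map K M P f \<longleftrightarrow> lin_map K (free_module K L) P f"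
  "lin_map K Q M h \<longleftrightarrow> lin_map K Q (free_module K L) h"
  unfolding lin_map_def M_ops by simp_all

lemma B_ops:
  "carrier B = carrier (free_module K H)" "\<zero>\<^bsub>B\<^esub> = \<zero>\<^bsub>free_module K H\<^esub>"
  "a \<oplus>\<^bsub>B\<^esub> b = a \<oplus>\<^bsub>free_module K H\<^esub> b" "k \<odot>\<^bsub>B\<^esub> b = k \<odot>\<^bsub>free_module K H\<^esub> b"
  "a \<otimes>\<^bsub>B\<^esub> b = bil_ext K (gcomp G) a b"
  by (simp_all add: group_algebra_def bil_ext_def free_module_def function_module_def
      isotropy_group_def)

lemma L_comp_H: "\<lbrakk>t \<in> L; g \<in> H\<rbrakk> \<Longrightarrow> t \<cdot> g \<in> L"
  by (simp add: fibre_iff isotropy_iff)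

lemma H_comp_H: "\<lbrakk>g \<in> H; h \<in> H\<rbrakk> \<Longrightarrow> g \<cdot> h \<in> H"
  by (simp add: isotropy_iff)

text \<open>The vector \<open>f \<cdot> t\<close> of \<open>KL_x\<close>: the restriction of
  \<open>f\<close> to the fibre over \<open>r(t)\<close>, carried to \<open>L_x\<close> by right
  multiplication with \<open>t\<close>.\<close>

definition translate :: "('g \<Rightarrow> 'k) \<Rightarrow> 'g \<Rightarrow> 'g \<Rightarrow> 'k" where
  "translate f t y = (if y \<in> L then f (y \<cdot> ginv G t) else \<zero>\<^bsub>K\<^esub>)"

lemma lact_M_eq: "lact M f = lin_ext K (translate f)"
  by (simp add: fibre_bimodule_def Let_def translate_def[abs_def])

lemma inj_on_comp_ginv: "t \<in> L \<Longrightarrow> inj_on (\<lambda>y. y \<cdot> ginv G t) L"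
  by (rule inj_on_inverseI[where g = "\<lambda>z. z \<cdot> t"]) (simp add: fibre_iff)

text \<open>The map \<open>y \<mapsto> y t^-1\<close> embeds \<open>L_x\<close> in the fibre over
  \<open>r(t)\<close>, on which \<open>f\<close> has finite support.\<close>

lemma translate_closed:
  assumes f: "f \<in> carrier A'" and t: "t \<in> L"
  shows "translate f t \<in> carrier (free_module K L)"
proof -
  have "finite ((\<lambda>y. y \<cdot> ginv G t) -` {g \<in> fibre G (rn G t). f g \<noteq> \<zero>\<^bsub>K\<^esub>} \<inter> L)"
    by (rule finite_vimage_IntI[OF A'_finite[OF f] inj_on_comp_ginv[OF t]])
  moreover have "{y. translate f t y \<noteq> \<zero>\<^bsub>K\<^esub>} \<subseteq>
      (\<lambda>y. y \<cdot> ginv G t) -` {g \<in> fibre G (rn G t). f g \<noteq> \<zero>\<^bsub>K\<^esub>} \<inter> L"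
    using t by (auto simp: translate_def fibre_iff)
  ultimately show ?thesis
    by (rule K.free_module_carrierI[rotated 2]) (auto simp: translate_def A'_closed[OF f])
qed

lemma lin_map_lact_M: "f \<in> carrier A' \<Longrightarrow> lin_map K M M (lact M f)"
  unfolding lin_map_M lact_M_eq by (rule K.lin_map_lin_ext) (auto intro: translate_closed)

lemma lact_M_basis: "\<lbrakk>f \<in> carrier A'; t \<in> L\<rbrakk> \<Longrightarrow> lact M f (basis_vec K t) = translate f t"
  unfolding lact_M_eq by (rule K.lin_ext_basis[of "translate f" t L]) (rule translate_closed)

lemma M_eqI:
  assumes "lin_map K M M f" "lin_map K M M g"
    and "\<And>t. t \<in> L \<Longrightarrow> f (basis_vec K t) = g (basis_vec K t)" and "u \<in> carrier M"
  shows "f u = g u"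
  by (rule K.lin_map_eqI[where X = L and P = M and f = f and g = g])
    (use assms module_M' in \<open>simp_all add: lin_map_M M_ops(1)\<close>)

lemma A'_add_closed: "\<lbrakk>f \<in> carrier A'; g \<in> carrier A'\<rbrakk> \<Longrightarrow> f \<oplus>\<^bsub>A'\<^esub> g \<in> carrier A'"
proof -
  assume f: "f \<in> carrier A'" and g: "g \<in> carrier A'"
  have "finite {z \<in> fibre G y. f z \<oplus>\<^bsub>K\<^esub> g z \<noteq> \<zero>\<^bsub>K\<^esub>}" for y
    by (rule finite_subset[OF _ finite_UnI[OF A'_finite[OF f, of y] A'_finite[OF g, of y]]]) auto
  then show ?thesis using f g by (simp add: carrier_A'_iff K.function_module_carrier_iff)
qed

lemma A'_smult_closed: "\<lbrakk>k \<in> carrier K; f \<in> carrier A'\<rbrakk> \<Longrightarrow> k \<odot>\<^bsub>A'\<^esub> f \<in> carrier A'"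
proof -
  assume k: "k \<in> carrier K" and f: "f \<in> carrier A'"
  have "finite {z \<in> fibre G y. k \<otimes>\<^bsub>K\<^esub> f z \<noteq> \<zero>\<^bsub>K\<^esub>}" for y
    by (rule finite_subset[OF _ A'_finite[OF f, of y]]) (auto simp: k)
  then show ?thesis using k f by (simp add: carrier_A'_iff K.function_module_carrier_iff)
qed

text \<open>\<open>convolution\<close> sums over the nonzero terms, a set that varies with
  \<open>z\<close>. The support of \<open>g\<close> on the fibre is a finite index set common to all
  \<open>z\<close> with the same source.\<close>

lemma convolution_eq:
  assumes f: "f \<in> carrier A'" and g: "g \<in> carrier A'" and z: "z \<in> carrier G" "dm G z = y"
  shows "convolution K G f g z =
    (\<Oplus>\<^bsub>K\<^esub>w \<in> {w \<in> fibre G y. g w \<noteq> \<zero>\<^bsub>K\<^esub>}. f (z \<cdot> ginv G w) \<otimes>\<^bsub>K\<^esub> g w)"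
proof -
  have "finsum K (\<lambda>w. f (z \<cdot> ginv G w) \<otimes>\<^bsub>K\<^esub> g w)
      {w \<in> fibre G y. f (z \<cdot> ginv G w) \<otimes>\<^bsub>K\<^esub> g w \<noteq> \<zero>\<^bsub>K\<^esub>} =
    (\<Oplus>\<^bsub>K\<^esub>w \<in> {w \<in> fibre G y. g w \<noteq> \<zero>\<^bsub>K\<^esub>}. f (z \<cdot> ginv G w) \<otimes>\<^bsub>K\<^esub> g w)"
    by (rule K.add.finprod_mono_neutral_cong_left[OF A'_finite[OF g]])
      (auto simp: A'_closed[OF f] A'_closed[OF g])
  then show ?thesis using z by (simp add: convolution_def fin_supp_sum_def)
qed

lemma A'_mult_closed:
  assumes f: "f \<in> carrier A'" and g: "g \<in> carrier A'"
  shows "f \<otimes>\<^bsub>A'\<^esub> g \<in> carrier A'"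
proof -
  have "finite {z \<in> fibre G y. convolution K G f g z \<noteq> \<zero>\<^bsub>K\<^esub>}" for y
  proof (rule finite_subset)
    let ?S = "{w \<in> fibre G y. g w \<noteq> \<zero>\<^bsub>K\<^esub>}"
    \<comment> \<open>A nonzero value at \<open>z\<close> forces a factorization
      \<open>z = v w\<close> with \<open>f v\<close> and \<open>g w\<close> nonzero; there are
      finitely many such \<open>w\<close> in the fibre, and finitely many \<open>v\<close> for each
      of them.\<close>
    let ?U = "\<Union>w \<in> ?S. (\<lambda>v. v \<cdot> w) ` {v \<in> fibre G (rn G w). f v \<noteq> \<zero>\<^bsub>K\<^esub>}"
    show "finite ?U" using A'_finite[OF g] A'_finite[OF f] by blast
    show "{z \<in> fibre G y. convolution K G f g z \<noteq> \<zero>\<^bsub>K\<^esub>} \<subseteq> ?U"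
    proof
      fix z assume z: "z \<in> {z \<in> fibre G y. convolution K G f g z \<noteq> \<zero>\<^bsub>K\<^esub>}"
      then have zc: "z \<in> carrier G" "dm G z = y" by (auto simp: fibre_iff)
      have "\<exists>w \<in> ?S. f (z \<cdot> ginv G w) \<noteq> \<zero>\<^bsub>K\<^esub>"
      proof (rule ccontr)
        assume "\<not> ?thesis"
        then have "(\<Oplus>\<^bsub>K\<^esub>w \<in> ?S. f (z \<cdot> ginv G w) \<otimes>\<^bsub>K\<^esub> g w) = \<zero>\<^bsub>K\<^esub>"
          by (intro K.add.finprod_one_eqI) (auto simp: A'_closed[OF g])
        with z convolution_eq[OF f g zc] show False by simp
      qed
      then obtain w where w: "w \<in> ?S" "f (z \<cdot> ginv G w) \<noteq> \<zero>\<^bsub>K\<^esub>" by blast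
      moreover from this have "z \<cdot> ginv G w \<in> fibre G (rn G w)" "z = z \<cdot> ginv G w \<cdot> w"
        using zc by (auto simp: fibre_iff)
      ultimately show "z \<in> ?U" by blast
    qed
  qed
  moreover have "convolution K G f g z \<in> carrier K" for z
    by (auto simp: convolution_def fin_supp_sum_def A'_closed[OF f] A'_closed[OF g])
  ultimately show ?thesis
    by (simp add: carrier_A'_iff K.function_module_carrier_iff) (simp add: convolution_def)
qed

text \<open>Right multiplication by \<open>t^-1\<close> is a bijection from the support of
  \<open>g \<cdot> t\<close> to that of \<open>g\<close> on the fibre over \<open>r(t)\<close>.
  Reindexing along it identifies the two sums; commutativity of \<open>K\<close> reconciles the
  order of the factors.\<close>

lemma lact_M_mult_basis:
  assumes f: "f \<in> carrier A'" and g: "g \<in> carrier A'" and t: "t \<in> L"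
  shows "translate (convolution K G f g) t = lact M f (translate g t)"
proof
  fix y
  let ?S = "{s. translate g t s \<noteq> \<zero>\<^bsub>K\<^esub>}"
  have S: "?S = {s \<in> L. g (s \<cdot> ginv G t) \<noteq> \<zero>\<^bsub>K\<^esub>}" by (auto simp: translate_def)
  have rhs: "lact M f (translate g t) y =
      (\<Oplus>\<^bsub>K\<^esub>s \<in> ?S. translate g t s \<otimes>\<^bsub>K\<^esub> translate f s y)"
    by (simp add: lact_M_eq lin_ext_def)
  show "translate (convolution K G f g) t y = lact M f (translate g t) y"
  proof (cases "y \<in> L")
    case False
    then have "(\<Oplus>\<^bsub>K\<^esub>s \<in> ?S. translate g t s \<otimes>\<^bsub>K\<^esub> translate f s y) = \<zero>\<^bsub>K\<^esub>"
      by (intro K.add.finprod_one_eqI) (auto simp: translate_def A'_closed[OF g])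
    with False rhs show ?thesis by (simp add: translate_def)
  next
    case True
    let ?h = "\<lambda>s. s \<cdot> ginv G t"
    let ?W = "{w \<in> fibre G (rn G t). g w \<noteq> \<zero>\<^bsub>K\<^esub>}"
    have im: "?h ` ?S = ?W"
    proof
      show "?h ` ?S \<subseteq> ?W" using t by (auto simp: S fibre_iff)
      show "?W \<subseteq> ?h ` ?S"
      proof
        fix w assume w: "w \<in> ?W"
        then have "w \<cdot> t \<in> ?S" "w = ?h (w \<cdot> t)" using t by (auto simp: S fibre_iff)
        then show "w \<in> ?h ` ?S" by blast
      qed
    qed
    have inj: "inj_on ?h ?S"
      by (rule inj_on_subset[OF inj_on_comp_ginv[OF t]]) (auto simp: S)
    have "translate (convolution K G f g) t y = convolution K G f g (y \<cdot> ginv G t)"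
      using True by (simp add: translate_def)
    also have "\<dots> = (\<Oplus>\<^bsub>K\<^esub>w \<in> ?W. f (y \<cdot> ginv G t \<cdot> ginv G w) \<otimes>\<^bsub>K\<^esub> g w)"
      by (rule convolution_eq[OF f g]) (use True t in \<open>auto simp: fibre_iff\<close>)
    also have "\<dots> = (\<Oplus>\<^bsub>K\<^esub>s \<in> ?S. f (y \<cdot> ginv G t \<cdot> ginv G (?h s)) \<otimes>\<^bsub>K\<^esub> g (?h s))"
      unfolding im[symmetric]
      by (rule K.finsum_reindex[OF _ inj]) (auto simp: A'_closed[OF f] A'_closed[OF g])
    also have "\<dots> = (\<Oplus>\<^bsub>K\<^esub>s \<in> ?S. translate g t s \<otimes>\<^bsub>K\<^esub> translate f s y)"
    proof (rule K.finsum_cong')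
      fix s assume "s \<in> ?S"
      then have "s \<in> L" by (simp add: S)
      then show "f (y \<cdot> ginv G t \<cdot> ginv G (?h s)) \<otimes>\<^bsub>K\<^esub> g (?h s) =
          translate g t s \<otimes>\<^bsub>K\<^esub> translate f s y"
        using True t
        by (simp add: translate_def fibre_iff comp_ginv_quotient K.m_comm A'_closed[OF f]
            A'_closed[OF g])
    qed (auto simp: translate_def A'_closed[OF f] A'_closed[OF g])
    finally show ?thesis using rhs by simp
  qed
qed

lemma ract_lin_left: "b \<in> carrier B \<Longrightarrow> lin_map K M M (\<lambda>m. ract M m b)"
  unfolding M_ops(5) lin_map_M B_ops by (rule K.bil_ext_lin_left[OF L_comp_H])

lemma ract_lin_right: "m \<in> carrier M \<Longrightarrow> lin_map K (free_module K H) M (ract M m)"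
  unfolding M_ops(5)[abs_def] M_ops(1) lin_map_M by (rule K.bil_ext_lin_right[OF L_comp_H])

lemma ract_basis: "\<lbrakk>t \<in> L; g \<in> H\<rbrakk> \<Longrightarrow> ract M (basis_vec K t) (basis_vec K g) = basis_vec K (t \<cdot> g)"
  unfolding M_ops by (rule K.bil_ext_basis[OF L_comp_H])

lemma basis_M: "t \<in> L \<Longrightarrow> basis_vec K t \<in> carrier M"
  unfolding M_ops by (rule K.basis_vec_closed)

lemma basis_B: "g \<in> H \<Longrightarrow> basis_vec K g \<in> carrier B"
  unfolding B_ops by (rule K.basis_vec_closed)

text \<open>Right multiplication by \<open>g\<close> permutes \<open>L_x\<close>, so the new
  coefficient at \<open>y\<close> is the old one at \<open>y g^-1\<close>.\<close>

lemma ract_basis_apply: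
  assumes m: "m \<in> carrier M" and g: "g \<in> H"
  shows "ract M m (basis_vec K g) = (\<lambda>y. if y \<in> L then m (y \<cdot> ginv G g) else \<zero>\<^bsub>K\<^esub>)"
proof (rule M_eqI[OF ract_lin_left[OF basis_B[OF g]] _ _ m])
  let ?r = "\<lambda>(m :: 'g \<Rightarrow> 'k) y. if y \<in> L then m (y \<cdot> ginv G g) else \<zero>\<^bsub>K\<^esub>"
  have gL: "g \<in> L" using g by (simp add: isotropy_iff fibre_iff)
  show "lin_map K M M ?r"
    unfolding lin_map_M
  proof (rule lin_mapI)
    fix u assume u: "u \<in> carrier (free_module K L)"
    then have "finite ((\<lambda>y. y \<cdot> ginv G g) -` {y. u y \<noteq> \<zero>\<^bsub>K\<^esub>} \<inter> L)"
      by (intro finite_vimage_IntI[OF _ inj_on_comp_ginv[OF gL]])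
        (auto simp: K.free_module_carrier_iff)
    moreover have "{y. ?r u y \<noteq> \<zero>\<^bsub>K\<^esub>} \<subseteq> (\<lambda>y. y \<cdot> ginv G g) -` {y. u y \<noteq> \<zero>\<^bsub>K\<^esub>} \<inter> L" by auto
    ultimately show "?r u \<in> carrier (free_module K L)"
      using u by (intro K.free_module_carrierI) (auto simp: K.free_module_carrier_iff)
  qed (auto simp: K.free_module_carrier_iff)
  fix t assume t: "t \<in> L"
  have "y \<cdot> ginv G g = t \<longleftrightarrow> y = t \<cdot> g" if "y \<in> L" for y
    using comp_ginv_cancel[of t g] comp_ginv_cancel'[of y g] that t g
    unfolding fibre_iff isotropy_iff by metis
  moreover have "t \<cdot> g \<in> L" using t g by (rule L_comp_H)
  ultimately show "ract M (basis_vec K t) (basis_vec K g) = ?r (basis_vec K t)"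
    unfolding ract_basis[OF t g] by (auto simp: fun_eq_iff basis_vec_def)
qed

text \<open>On \<open>L_x\<close> both sides send \<open>y\<close> to
  \<open>f (y g^-1 t^-1)\<close>, since \<open>(t g)^-1 = g^-1 t^-1\<close>. By bilinearity this
  special case yields the commutation of the two actions.\<close>

lemma lact_ract_basis:
  assumes f: "f \<in> carrier A'" and t: "t \<in> L" and g: "g \<in> H"
  shows "translate f (t \<cdot> g) = ract M (translate f t) (basis_vec K g)"
proof -
  have "translate f t \<in> carrier M" using translate_closed[OF f t] by (simp add: M_ops)
  moreover have "y \<cdot> ginv G (t \<cdot> g) = y \<cdot> ginv G g \<cdot> ginv G t" "y \<cdot> ginv G g \<in> L" if "y \<in> L" for y
    using that t g by (simp_all add: fibre_iff isotropy_iff ginv_prod comp_assoc)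
  ultimately show ?thesis using g by (auto simp: ract_basis_apply translate_def)
qed

sublocale bimodule_over K A' B M
proof (rule bimodule_over.intro)
  show "lact M (a \<oplus>\<^bsub>A'\<^esub> b) m = lact M a m \<oplus>\<^bsub>M\<^esub> lact M b m"
    if "a \<in> carrier A'" "b \<in> carrier A'" "m \<in> carrier M" for a b m
  proof (rule M_eqI[OF lin_map_lact_M lin_map_sum[OF module_M' lin_map_lact_M lin_map_lact_M] _ that(3)])
    show "lact M (a \<oplus>\<^bsub>A'\<^esub> b) (basis_vec K t) =
        lact M a (basis_vec K t) \<oplus>\<^bsub>M\<^esub> lact M b (basis_vec K t)" if t: "t \<in> L" for t
      unfolding lact_M_basis[OF \<open>a \<in> carrier A'\<close> t] lact_M_basis[OF \<open>b \<in> carrier A'\<close> t]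
        lact_M_basis[OF A'_add_closed[OF \<open>a \<in> carrier A'\<close> \<open>b \<in> carrier A'\<close>] t]
      by (auto simp: translate_def M_ops)
  qed (use that A'_add_closed in auto)
  show "lact M (k \<odot>\<^bsub>A'\<^esub> a) m = k \<odot>\<^bsub>M\<^esub> lact M a m"
    if "k \<in> carrier K" "a \<in> carrier A'" "m \<in> carrier M" for k a m
  proof (rule M_eqI[OF lin_map_lact_M lin_map_scale[OF module_M' lin_map_lact_M] _ that(3)])
    show "lact M (k \<odot>\<^bsub>A'\<^esub> a) (basis_vec K t) = k \<odot>\<^bsub>M\<^esub> lact M a (basis_vec K t)" if t: "t \<in> L" for t
      unfolding lact_M_basis[OF \<open>a \<in> carrier A'\<close> t]
        lact_M_basis[OF A'_smult_closed[OF \<open>k \<in> carrier K\<close> \<open>a \<in> carrier A'\<close>] t]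
      using \<open>k \<in> carrier K\<close> by (auto simp: translate_def M_ops)
  qed (use that A'_smult_closed in auto)
  show "lact M (a \<otimes>\<^bsub>A'\<^esub> b) m = lact M a (lact M b m)"
    if "a \<in> carrier A'" "b \<in> carrier A'" "m \<in> carrier M" for a b m
  proof (rule M_eqI[OF lin_map_lact_M lin_map_comp[OF lin_map_lact_M lin_map_lact_M] _ that(3)])
    show "lact M (a \<otimes>\<^bsub>A'\<^esub> b) (basis_vec K t) = lact M a (lact M b (basis_vec K t))" if t: "t \<in> L" for t
      unfolding lact_M_basis[OF \<open>b \<in> carrier A'\<close> t]
        lact_M_basis[OF A'_mult_closed[OF \<open>a \<in> carrier A'\<close> \<open>b \<in> carrier A'\<close>] t]
      using lact_M_mult_basis[OF \<open>a \<in> carrier A'\<close> \<open>b \<in> carrier A'\<close> t] by simp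
  qed (use that A'_mult_closed in auto)
  show "lact M a (ract M m b) = ract M (lact M a m) b"
    if a: "a \<in> carrier A'" and m: "m \<in> carrier M" and b: "b \<in> carrier B" for a m b
  proof (rule K.bilinear_eqI[OF module_M', of H L "\<lambda>m b. lact M a (ract M m b)"
        "\<lambda>m b. ract M (lact M a m) b"])
    note ll = lin_map_lact_M[OF a]
    show "lin_map K (free_module K L) M (\<lambda>m. lact M a (ract M m b))"
      "lin_map K (free_module K L) M (\<lambda>m. ract M (lact M a m) b)"
      if "b \<in> carrier (free_module K H)" for b
      using lin_map_comp[OF ract_lin_left ll] lin_map_comp[OF ll ract_lin_left] that
      unfolding lin_map_M B_ops by auto
    fix t assume t: "t \<in> L"
    show "lin_map K (free_module K H) M (\<lambda>b. lact M a (ract M (basis_vec K t) b))"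
      by (rule lin_map_comp[OF ract_lin_right[OF basis_M[OF t]] ll])
    show "lin_map K (free_module K H) M (ract M (lact M a (basis_vec K t)))"
      by (rule ract_lin_right[OF lin_map_closed[OF ll basis_M[OF t]]])
    fix g assume g: "g \<in> H"
    show "lact M a (ract M (basis_vec K t) (basis_vec K g)) =
        ract M (lact M a (basis_vec K t)) (basis_vec K g)"
      using lact_ract_basis[OF a t g] t g a L_comp_H by (simp add: ract_basis lact_M_basis)
  qed (use m b in \<open>simp_all add: M_ops B_ops\<close>)
qed (use module_M' A'_add_closed A'_smult_closed A'_mult_closed lin_map_lact_M
      lin_map_closed[OF ract_lin_left] in auto)

text \<open>The part of \<open>m\<close> supported on the coset \<open>t G_x\<close>, written as
  \<open>t\<close> times an element of the group algebra: the coordinate at \<open>t\<close> when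
  \<open>KL_x\<close> is regarded as a free right module with \<open>t\<close> in its basis.\<close>

definition pull :: "'g \<Rightarrow> ('g \<Rightarrow> 'k) \<Rightarrow> 'g \<Rightarrow> 'k" where
  "pull t m = (\<lambda>g. if g \<in> H then m (t \<cdot> g) else \<zero>\<^bsub>K\<^esub>)"

lemma lin_map_pull:
  assumes t: "t \<in> L"
  shows "lin_map K M B (pull t)"
  unfolding lin_map_M
proof (rule lin_mapI)
  have inj: "inj_on (\<lambda>g. t \<cdot> g) H"
    by (rule inj_on_inverseI[where g = "\<lambda>z. ginv G t \<cdot> z"])
      (use t in \<open>simp add: fibre_iff isotropy_iff\<close>)
  fix u assume u: "u \<in> carrier (free_module K L)"
  then have "finite ((\<lambda>g. t \<cdot> g) -` {y. u y \<noteq> \<zero>\<^bsub>K\<^esub>} \<inter> H)"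
    by (intro finite_vimage_IntI[OF _ inj]) (auto simp: K.free_module_carrier_iff)
  moreover have "{g. pull t u g \<noteq> \<zero>\<^bsub>K\<^esub>} \<subseteq> (\<lambda>g. t \<cdot> g) -` {y. u y \<noteq> \<zero>\<^bsub>K\<^esub>} \<inter> H"
    by (auto simp: pull_def)
  ultimately show "pull t u \<in> carrier B"
    using u unfolding B_ops
    by (intro K.free_module_carrierI) (auto simp: K.free_module_carrier_iff pull_def)
qed (auto simp: K.free_module_carrier_iff B_ops pull_def)

text \<open>The coset \<open>t G_x\<close> consists of the arrows in \<open>L_x\<close> that have
  the range of \<open>t\<close>, which is the origin of the case distinction.\<close>

lemma pull_basis:
  assumes t: "t \<in> L" and s: "s \<in> L"
  shows "pull t (basis_vec K s) = (if rn G s = rn G t then basis_vec K (ginv G t \<cdot> s) else \<zero>\<^bsub>B\<^esub>)"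
proof -
  have "t \<cdot> g = s \<longleftrightarrow> g = ginv G t \<cdot> s" if "rn G s = rn G t" "g \<in> H" for g
    using ginv_comp_cancel[of s t] ginv_comp_cancel'[of g t] that s t
    unfolding fibre_iff isotropy_iff by metis
  moreover have "rn G s = rn G t" if "t \<cdot> g = s" "g \<in> H" for g
    using that(1)[symmetric] that(2) t by (simp add: fibre_iff isotropy_iff)
  moreover have "ginv G t \<cdot> s \<in> H" if "rn G s = rn G t"
    using that s t by (auto simp: fibre_iff isotropy_iff)
  ultimately show ?thesis by (auto simp: fun_eq_iff pull_def basis_vec_def B_ops)
qed

lemma B_mult_lin_left: "b \<in> carrier B \<Longrightarrow> lin_map K (free_module K H) (free_module K H) (\<lambda>a. a \<otimes>\<^bsub>B\<^esub> b)"
  unfolding B_ops by (rule K.bil_ext_lin_left[OF H_comp_H])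

lemma B_mult_lin_right: "a \<in> carrier B \<Longrightarrow> lin_map K (free_module K H) (free_module K H) (mult B a)"
  unfolding B_ops(1) B_ops(5)[abs_def] by (rule K.bil_ext_lin_right[OF H_comp_H])

lemma B_mult_basis: "\<lbrakk>g \<in> H; h \<in> H\<rbrakk> \<Longrightarrow> basis_vec K g \<otimes>\<^bsub>B\<^esub> basis_vec K h = basis_vec K (g \<cdot> h)"
  unfolding B_ops by (rule K.bil_ext_basis[OF H_comp_H])

lemma lin_map_B:
  "lin_map K B P f \<longleftrightarrow> lin_map K (free_module K H) P f"
  "lin_map K Q B h \<longleftrightarrow> lin_map K Q (free_module K H) h"
  unfolding lin_map_def B_ops by simp_all

lemma module_B: "Module.module K B"
  by (rule module_surj_image[OF K.module_free_module, of "\<lambda>x. x" H])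
    (simp_all add: B_ops del: K.free_module_simps)

text \<open>Right linearity of the coordinate. It makes
  \<open>(m, v) \<mapsto> pull t m \<cdot> v\<close> balanced, hence allows \<open>coord\<close> to
  be defined.\<close>

lemma pull_ract:
  assumes t: "t \<in> L" and m: "m \<in> carrier M" and b: "b \<in> carrier B"
  shows "pull t (ract M m b) = pull t m \<otimes>\<^bsub>B\<^esub> b"
proof (rule K.bilinear_eqI[OF module_B, of H L "\<lambda>m b. pull t (ract M m b)" "\<lambda>m b. pull t m \<otimes>\<^bsub>B\<^esub> b"])
  note lp = lin_map_pull[OF t]
  show "lin_map K (free_module K L) B (\<lambda>m. pull t (ract M m b))"
    "lin_map K (free_module K L) B (\<lambda>m. pull t m \<otimes>\<^bsub>B\<^esub> b)"
    if "b \<in> carrier (free_module K H)" for b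
    using lin_map_comp[OF ract_lin_left lp] lin_map_comp[of K _ B _ B, OF lp] B_mult_lin_left that
    unfolding lin_map_M lin_map_B B_ops(1) by auto
  fix s assume s: "s \<in> L"
  show "lin_map K (free_module K H) B (\<lambda>b. pull t (ract M (basis_vec K s) b))"
    by (rule lin_map_comp[OF ract_lin_right[OF basis_M[OF s]] lp])
  show "lin_map K (free_module K H) B (\<lambda>b. pull t (basis_vec K s) \<otimes>\<^bsub>B\<^esub> b)"
    unfolding lin_map_B by (rule B_mult_lin_right[OF lin_map_closed[OF lp basis_M[OF s]]])
  fix g assume g: "g \<in> H"
  \<comment> \<open>Needed for \<open>s\<close> outside \<open>t G_x\<close>: then
    \<open>s g\<close> lies outside as well and both sides vanish.\<close>
  have z: "\<zero>\<^bsub>B\<^esub> \<otimes>\<^bsub>B\<^esub> basis_vec K g = \<zero>\<^bsub>B\<^esub>"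
    using lin_map_zero[OF K.module_free_module K.module_free_module B_mult_lin_left[OF basis_B[OF g]]]
    unfolding B_ops(2) .
  have "ginv G t \<cdot> s \<in> H" "ginv G t \<cdot> (s \<cdot> g) = ginv G t \<cdot> s \<cdot> g" if "rn G s = rn G t"
    using that s t g by (auto simp: fibre_iff isotropy_iff comp_assoc)
  moreover have "rn G (s \<cdot> g) = rn G s" using s g by (simp add: fibre_iff isotropy_iff)
  ultimately show "pull t (ract M (basis_vec K s) (basis_vec K g)) =
      pull t (basis_vec K s) \<otimes>\<^bsub>B\<^esub> basis_vec K g"
    using s g t L_comp_H by (simp add: ract_basis pull_basis B_mult_basis z)
qed (use m b in \<open>simp_all add: M_ops B_ops\<close>)

end

definition one_on :: "('k, 'c) ring_scheme \<Rightarrow> 'g set \<Rightarrow> 'g \<Rightarrow> 'k" where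
  "one_on K U g = (if g \<in> U then \<one>\<^bsub>K\<^esub> else \<zero>\<^bsub>K\<^esub>)"

section \<open>Components of an induced module along the orbit\<close>

locale induced_setting = pointed_groupoid G K x
  for G :: "('g, 'e) groupoid_scheme" (structure) and K :: "('k, 'c) ring_scheme" and x :: 'g +
  fixes V :: "('k, 'g \<Rightarrow> 'k, 'v, 'f) amodule_scheme"
  assumes nondegenerate_V: "nondegenerate_module K (group_algebra K (isotropy_group G x)) V"
begin

lemma module_V: "Module.module K V"
  using nondegenerate_V by (rule nondegenerate_module.axioms(1))

lemma lact_V_lin: "a \<in> carrier B \<Longrightarrow> lin_map K V V (lact V a)"
  using nondegenerate_V
  by (intro lin_mapI) (auto simp: nondegenerate_module.lact_closed
      nondegenerate_module.lact_add_right nondegenerate_module.lact_smult_right)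

lemma lact_V_lin_left: "v \<in> carrier V \<Longrightarrow> lin_map K B V (\<lambda>a. lact V a v)"
  using nondegenerate_V
  by (intro lin_mapI) (auto simp: nondegenerate_module.lact_closed
      nondegenerate_module.lact_add_left nondegenerate_module.lact_smult_left)

lemma lact_V_mult: "\<lbrakk>a \<in> carrier B; b \<in> carrier B; v \<in> carrier V\<rbrakk>
    \<Longrightarrow> lact V (a \<otimes>\<^bsub>B\<^esub> b) v = lact V a (lact V b v)"
  using nondegenerate_V by (rule nondegenerate_module.lact_mult)

text \<open>The tensor product as a record does not mention the algebra acting from the left, so
  \<open>T\<close> is literally the induced module; facts on its action proved for the larger
  algebra \<open>A'\<close> hold for the Steinberg algebra by restriction.\<close>

sublocale tensor_setting K A' B M V
  by (intro tensor_setting.intro bimodule_over_axioms tensor_setting_axioms.intro module_V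
      lin_map_closed[OF lact_V_lin])

definition act :: "'g \<Rightarrow> 'v \<Rightarrow> 'v" where
  "act g = lact V (basis_vec K g)"

lemma act_lin: "g \<in> H \<Longrightarrow> lin_map K V V (act g)"
  unfolding act_def by (rule lact_V_lin[OF basis_B])

lemma act_closed: "\<lbrakk>g \<in> H; v \<in> carrier V\<rbrakk> \<Longrightarrow> act g v \<in> carrier V"
  by (rule lin_map_closed[OF act_lin])

lemma x_H: "x \<in> H"
  by (simp add: isotropy_iff)

lemma basis_x_mult:
  assumes "b \<in> carrier B"
  shows "basis_vec K x \<otimes>\<^bsub>B\<^esub> b = b"
proof (rule K.lin_map_eqI[where X = H and P = B and g = "\<lambda>b. b"])
  show "lin_map K (free_module K H) B (mult B (basis_vec K x))"
    unfolding lin_map_B by (rule B_mult_lin_right[OF basis_B[OF x_H]])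
  show "lin_map K (free_module K H) B (\<lambda>b. b)"
    by (rule lin_mapI) (simp_all add: B_ops del: K.free_module_simps)
  fix g assume g: "g \<in> H"
  then have "x \<cdot> g = g" using rn_comp_self[of g] by (simp add: isotropy_iff)
  then show "basis_vec K x \<otimes>\<^bsub>B\<^esub> basis_vec K g = basis_vec K g"
    using g x_H by (simp add: B_mult_basis)
qed (use assms module_B in \<open>simp_all add: B_ops\<close>)

text \<open>Non-degeneracy of \<open>V\<close> is used only here: it makes \<open>V\<close> unital.\<close>

lemma act_x:
  assumes "v \<in> carrier V"
  shows "act x v = v"
proof -
  have "lin_map K V V (\<lambda>v. v)" by (rule lin_mapI) simp_all
  note sub = submodule_equalizer[OF module_V module_V act_lin[OF x_H] this]
  have "{lact V a m | a m. a \<in> carrier B \<and> m \<in> carrier V} \<subseteq> {v \<in> carrier V. act x v = v}"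
    by (auto simp: act_def lact_V_mult[symmetric] basis_B x_H basis_x_mult lin_map_closed[OF lact_V_lin])
  then have "lin_span K V {lact V a m | a m. a \<in> carrier B \<and> m \<in> carrier V}
      \<subseteq> {v \<in> carrier V. act x v = v}"
    by (rule lin_span_least[OF sub])
  then show ?thesis using assms nondegenerate_module.nondegenerate[OF nondegenerate_V] by auto
qed

definition embed :: "'g \<Rightarrow> 'v \<Rightarrow> (('g \<Rightarrow> 'k) \<times> 'v \<Rightarrow> 'k) set" where
  "embed t = tens (basis_vec K t)"

lemma embed_lin: "t \<in> L \<Longrightarrow> lin_map K V T (embed t)"
  unfolding embed_def by (rule lin_map_tens_right[OF basis_M])

lemma embed_closed: "\<lbrakk>t \<in> L; v \<in> carrier V\<rbrakk> \<Longrightarrow> embed t v \<in> carrier T"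
  by (rule lin_map_closed[OF embed_lin])

lemma embed_comp: "\<lbrakk>t \<in> L; g \<in> H; v \<in> carrier V\<rbrakk> \<Longrightarrow> embed (t \<cdot> g) v = embed t (act g v)"
  unfolding embed_def act_def
  by (simp add: tens_balanced[symmetric] basis_M basis_B ract_basis)

text \<open>The induction principle for \<open>T\<close>: pure tensors generate, and their left
  factors may be taken to be arrows because \<open>tens\<close> is linear in that factor.\<close>

lemma embed_span:
  assumes N: "submodule N K T" and "\<And>t v. \<lbrakk>t \<in> L; v \<in> carrier V\<rbrakk> \<Longrightarrow> embed t v \<in> N"
  shows "carrier T \<subseteq> N"
proof (rule tens_span[OF N])
  fix m v assume m: "m \<in> carrier M" and v: "v \<in> carrier V"
  note lin = lin_map_tens_left[OF v, unfolded lin_map_M]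
  have "carrier (free_module K L) \<subseteq> {m \<in> carrier (free_module K L). tens m v \<in> N}"
    by (rule K.free_module_span[OF submodule_vimage[OF K.module_free_module module_T lin N]])
      (use assms(2)[OF _ v] in \<open>auto simp: embed_def K.basis_vec_closed\<close>)
  then show "tens m v \<in> N" using m unfolding M_ops by auto
qed

lemma pull_balanced:
  assumes t: "t \<in> L"
  shows "balanced V (\<lambda>m. lact V (pull t m))"
  unfolding balanced_def
  using t by (auto simp: pull_ract lact_V_mult lin_map_closed[OF lin_map_pull]
      intro!: lact_V_lin lin_map_comp[OF lin_map_pull lact_V_lin_left])

text \<open>\<open>tensor_lift\<close> asserts existence only, whence the choice. On the carrier the
  result is determined, as pure tensors generate.\<close>

definition coord :: "'g \<Rightarrow> (('g \<Rightarrow> 'k) \<times> 'v \<Rightarrow> 'k) set \<Rightarrow> 'v" where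
  "coord t = (SOME f. lin_map K T V f \<and>
    (\<forall>m \<in> carrier M. \<forall>v \<in> carrier V. f (tens m v) = lact V (pull t m) v))"

lemma
  assumes t: "t \<in> L"
  shows coord_lin: "lin_map K T V (coord t)"
    and coord_tens: "\<lbrakk>m \<in> carrier M; v \<in> carrier V\<rbrakk> \<Longrightarrow> coord t (tens m v) = lact V (pull t m) v"
  using someI_ex[OF tensor_lift[OF module_V pull_balanced[OF t]], folded coord_def] by auto

lemma coord_embed:
  assumes "t \<in> L" "s \<in> L" "v \<in> carrier V"
  shows "coord t (embed s v) = (if rn G s = rn G t then act (ginv G t \<cdot> s) v else \<zero>\<^bsub>V\<^esub>)"
  using assms lin_map_zero[OF module_B module_V lact_V_lin_left[OF assms(3)]]
  by (simp add: embed_def coord_tens basis_M pull_basis act_def)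

lemma coord_embed_self: "\<lbrakk>t \<in> L; v \<in> carrier V\<rbrakk> \<Longrightarrow> coord t (embed t v) = v"
  by (simp add: coord_embed) (simp add: fibre_iff act_x)

lemma quotient_H: "\<lbrakk>t \<in> L; s \<in> L; rn G s = rn G t\<rbrakk> \<Longrightarrow> ginv G t \<cdot> s \<in> H"
  by (simp add: fibre_iff isotropy_iff)

text \<open>Arrows with the same range differ by an isotropy element, which moves across the tensor
  sign. Hence the image of \<open>embed t\<close> depends only on the range of \<open>t\<close>, and
  the summands are indexed by the orbit.\<close>

lemma embed_change:
  assumes "t \<in> L" "s \<in> L" "rn G s = rn G t" "v \<in> carrier V"
  shows "embed s v = embed t (act (ginv G t \<cdot> s) v)"
  using embed_comp[OF assms(1) quotient_H[OF assms(1-3)] assms(4)] assms(1-3)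
  by (simp add: fibre_iff)

text \<open>Ranges are collected instead of arrows: infinitely many arrows of \<open>L_x\<close> may
  share a range, whereas only finitely many ranges occur.\<close>

definition support :: "(('g \<Rightarrow> 'k) \<times> 'v \<Rightarrow> 'k) set \<Rightarrow> 'g set" where
  "support w = rn G ` {t \<in> L. coord t w \<noteq> \<zero>\<^bsub>V\<^esub>}"

text \<open>The support of a sum lies in the union of the supports, and \<open>embed s v\<close> has
  at most the range of \<open>s\<close> in its support.\<close>

lemma finite_support:
  assumes "w \<in> carrier T"
  shows "finite (support w)"
proof -
  interpret T: Module.module K T by (rule module_T)
  interpret V: Module.module K V by (rule module_V)
  have "submodule {w \<in> carrier T. finite (support w)} K T"
  proof (rule submoduleI'[OF module_T])
    show "\<zero>\<^bsub>T\<^esub> \<in> {w \<in> carrier T. finite (support w)}"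
      by (simp add: support_def lin_map_zero[OF module_T module_V coord_lin] cong: conj_cong)
  next
    fix v w assume vw: "v \<in> {w \<in> carrier T. finite (support w)}"
      "w \<in> {w \<in> carrier T. finite (support w)}"
    have "coord t v \<noteq> \<zero>\<^bsub>V\<^esub> \<or> coord t w \<noteq> \<zero>\<^bsub>V\<^esub>"
      if "t \<in> L" "coord t (v \<oplus>\<^bsub>T\<^esub> w) \<noteq> \<zero>\<^bsub>V\<^esub>" for t
      using that vw by (auto simp: lin_map_add[OF coord_lin])
    then have "support (v \<oplus>\<^bsub>T\<^esub> w) \<subseteq> support v \<union> support w"
      unfolding support_def by blast
    then show "v \<oplus>\<^bsub>T\<^esub> w \<in> {w \<in> carrier T. finite (support w)}"
      using vw by (auto intro: finite_subset)
  next
    fix k w assume kw: "k \<in> carrier K" "w \<in> {w \<in> carrier T. finite (support w)}"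
    then have "support (k \<odot>\<^bsub>T\<^esub> w) \<subseteq> support w"
      by (auto simp: support_def lin_map_smult[OF coord_lin])
    then show "k \<odot>\<^bsub>T\<^esub> w \<in> {w \<in> carrier T. finite (support w)}"
      using kw by (auto intro: finite_subset)
  qed auto
  moreover have "embed s v \<in> {w \<in> carrier T. finite (support w)}"
    if "s \<in> L" "v \<in> carrier V" for s v
  proof -
    have "support (embed s v) \<subseteq> {rn G s}"
      using that by (auto simp: support_def coord_embed split: if_splits)
    then show ?thesis using that embed_closed finite_subset by blast
  qed
  ultimately have "carrier T \<subseteq> {w \<in> carrier T. finite (support w)}" by (rule embed_span)
  then show ?thesis using assms by auto
qed

text \<open>Demanding the formula for all finite \<open>Z\<close> above some \<open>Y\<close> makes
  the property additive, because the index sets of two summands can be united. It also allows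
  \<open>lact_one_local\<close> to adjoin a further index.\<close>

lemma decomposition:
  assumes "\<forall>y \<in> orbit_of G x. \<tau> y \<in> L \<and> rn G (\<tau> y) = y"
    and w: "w \<in> carrier T"
  shows "\<exists>Y. finite Y \<and> Y \<subseteq> orbit_of G x \<and> (\<forall>Z. finite Z \<and> Y \<subseteq> Z \<and> Z \<subseteq> orbit_of G x \<longrightarrow>
    w = (\<Oplus>\<^bsub>T\<^esub>y \<in> Z. embed (\<tau> y) (coord (\<tau> y) w)))" (is "?P w")
proof -
  interpret T: Module.module K T by (rule module_T)
  interpret V: Module.module K V by (rule module_V)
  note \<tau> = assms(1)[rule_format]
  let ?O = "orbit_of G x"
  let ?p = "\<lambda>y w. embed (\<tau> y) (coord (\<tau> y) w)"
  have p: "lin_map K T T (?p y)" if "y \<in> ?O" for y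
    using \<tau>[OF that] by (intro lin_map_comp[OF coord_lin embed_lin]) auto
  have pc: "?p y w \<in> carrier T" if "y \<in> ?O" "w \<in> carrier T" for y w
    using p[OF that(1)] that(2) by (rule lin_map_closed)
  have "submodule {w \<in> carrier T. ?P w} K T"
  proof (rule submoduleI'[OF module_T])
    have "\<zero>\<^bsub>T\<^esub> = (\<Oplus>\<^bsub>T\<^esub>y \<in> Z. ?p y \<zero>\<^bsub>T\<^esub>)" if "Z \<subseteq> ?O" for Z
    proof -
      have "(\<Oplus>\<^bsub>T\<^esub>y \<in> Z. ?p y \<zero>\<^bsub>T\<^esub>) = \<zero>\<^bsub>T\<^esub>"
        by (rule T.add.finprod_one_eqI) (use that lin_map_zero[OF module_T module_T p] in auto)
      then show ?thesis ..
    qed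
    then show "\<zero>\<^bsub>T\<^esub> \<in> {w \<in> carrier T. ?P w}" by (auto intro!: exI[of _ "{}"])
  next
    fix v w assume "v \<in> {w \<in> carrier T. ?P w}" "w \<in> {w \<in> carrier T. ?P w}"
    then have vw: "v \<in> carrier T" "w \<in> carrier T" and "?P v" "?P w" by auto
    have ball: "\<forall>y \<in> orbit_of G x. \<tau> y \<in> L \<and> rn G (\<tau> y) = y" using \<tau> by simp
  obtain Y where Y: "finite Y" "Y \<subseteq> ?O"
      "\<And>Z. \<lbrakk>finite Z; Y \<subseteq> Z; Z \<subseteq> ?O\<rbrakk> \<Longrightarrow> v = (\<Oplus>\<^bsub>T\<^esub>y \<in> Z. ?p y v)"
      using \<open>?P v\<close> by auto
    obtain Y' where Y': "finite Y'" "Y' \<subseteq> ?O"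
      "\<And>Z. \<lbrakk>finite Z; Y' \<subseteq> Z; Z \<subseteq> ?O\<rbrakk> \<Longrightarrow> w = (\<Oplus>\<^bsub>T\<^esub>y \<in> Z. ?p y w)"
      using \<open>?P w\<close> by auto
    have "v \<oplus>\<^bsub>T\<^esub> w = (\<Oplus>\<^bsub>T\<^esub>y \<in> Z. ?p y (v \<oplus>\<^bsub>T\<^esub> w))"
      if Z: "finite Z" "Y \<union> Y' \<subseteq> Z" "Z \<subseteq> ?O" for Z
    proof -
      have "(\<Oplus>\<^bsub>T\<^esub>y \<in> Z. ?p y (v \<oplus>\<^bsub>T\<^esub> w)) = (\<Oplus>\<^bsub>T\<^esub>y \<in> Z. ?p y v \<oplus>\<^bsub>T\<^esub> ?p y w)"
        by (rule T.finsum_cong') (use Z vw pc in \<open>auto simp: lin_map_add[OF p] subset_iff\<close>)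
      also have "\<dots> = (\<Oplus>\<^bsub>T\<^esub>y \<in> Z. ?p y v) \<oplus>\<^bsub>T\<^esub> (\<Oplus>\<^bsub>T\<^esub>y \<in> Z. ?p y w)"
        by (rule T.finsum_addf) (use Z vw pc in auto)
      also have "\<dots> = v \<oplus>\<^bsub>T\<^esub> w" using Y(3)[of Z] Y'(3)[of Z] Z by simp
      finally show ?thesis ..
    qed
    then have "?P (v \<oplus>\<^bsub>T\<^esub> w)"
      using Y(1,2) Y'(1,2) by (intro exI[of _ "Y \<union> Y'"]) auto
    then show "v \<oplus>\<^bsub>T\<^esub> w \<in> {w \<in> carrier T. ?P w}" using vw by simp
  next
    fix k w assume k: "k \<in> carrier K" and "w \<in> {w \<in> carrier T. ?P w}"
    then have w: "w \<in> carrier T" and "?P w" by auto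
    then obtain Y where Y: "finite Y" "Y \<subseteq> ?O"
      "\<And>Z. \<lbrakk>finite Z; Y \<subseteq> Z; Z \<subseteq> ?O\<rbrakk> \<Longrightarrow> w = (\<Oplus>\<^bsub>T\<^esub>y \<in> Z. ?p y w)"
      by auto
    have "k \<odot>\<^bsub>T\<^esub> w = (\<Oplus>\<^bsub>T\<^esub>y \<in> Z. ?p y (k \<odot>\<^bsub>T\<^esub> w))"
      if Z: "finite Z" "Y \<subseteq> Z" "Z \<subseteq> ?O" for Z
    proof -
      have "(\<Oplus>\<^bsub>T\<^esub>y \<in> Z. ?p y (k \<odot>\<^bsub>T\<^esub> w)) = (\<Oplus>\<^bsub>T\<^esub>y \<in> Z. k \<odot>\<^bsub>T\<^esub> ?p y w)"
        by (rule T.finsum_cong') (use Z w k pc in \<open>auto simp: lin_map_smult[OF p] subset_iff\<close>)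
      also have "\<dots> = k \<odot>\<^bsub>T\<^esub> (\<Oplus>\<^bsub>T\<^esub>y \<in> Z. ?p y w)"
        by (rule T.finsum_smult_ldistr[symmetric]) (use Z w k pc in auto)
      also have "\<dots> = k \<odot>\<^bsub>T\<^esub> w" using Y(3)[of Z] Z by simp
      finally show ?thesis ..
    qed
    then have "?P (k \<odot>\<^bsub>T\<^esub> w)" using Y(1,2) by blast
    then show "k \<odot>\<^bsub>T\<^esub> w \<in> {w \<in> carrier T. ?P w}" using k w by simp
  qed auto
  moreover have "embed s v \<in> {w \<in> carrier T. ?P w}" if s: "s \<in> L" and v: "v \<in> carrier V" for s v
  proof -
    have rs: "rn G s \<in> ?O" using s by (simp add: orbit_of_def)
    have "embed s v = (\<Oplus>\<^bsub>T\<^esub>y \<in> Z. ?p y (embed s v))"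
      if Z: "finite Z" "{rn G s} \<subseteq> Z" "Z \<subseteq> ?O" for Z
    proof -
      have "?p y (embed s v) = (if rn G s = y then embed s v else \<zero>\<^bsub>T\<^esub>)" if "y \<in> Z" for y
      proof -
        have ty: "\<tau> y \<in> L" "rn G (\<tau> y) = y" using \<tau>[of y] that Z by auto
        show ?thesis
        proof (cases "rn G s = y")
          case True
          with ty show ?thesis by (simp add: coord_embed[OF ty(1) s v] embed_change[OF ty(1) s _ v, symmetric])
        next
          case False
          with ty show ?thesis
            by (simp add: coord_embed[OF ty(1) s v] lin_map_zero[OF module_V module_T embed_lin])
        qed
      qed
      then have "(\<Oplus>\<^bsub>T\<^esub>y \<in> Z. ?p y (embed s v)) =
          (\<Oplus>\<^bsub>T\<^esub>y \<in> Z. if rn G s = y then embed s v else \<zero>\<^bsub>T\<^esub>)"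
        by (intro T.finsum_cong') (use s v embed_closed in auto)
      also have "\<dots> = embed s v"
        using Z s v by (intro T.finsum_singleton) (auto intro: embed_closed)
      finally show ?thesis ..
    qed
    then have "?P (embed s v)" using rs by (intro exI[of _ "{rn G s}"]) auto
    then show ?thesis using s v by (simp add: embed_closed)
  qed
  ultimately have "carrier T \<subseteq> {w \<in> carrier T. ?P w}" by (rule embed_span)
  then show ?thesis using w by auto
qed

text \<open>Prescribing one representative makes the summand at \<open>r(t)\<close> equal to
  \<open>embed t (coord t w)\<close>, without a correcting isotropy element.\<close>

lemma transversal_through:
  assumes "t \<in> L"
  obtains \<tau> where "\<And>y. y \<in> orbit_of G x \<Longrightarrow> \<tau> y \<in> L \<and> rn G (\<tau> y) = y" "\<tau> (rn G t) = t"
proof -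
  define \<tau> where "\<tau> y = (if y = rn G t then t else (SOME s. s \<in> L \<and> rn G s = y))" for y
  have "\<tau> y \<in> L \<and> rn G (\<tau> y) = y" if "y \<in> orbit_of G x" for y
  proof (cases "y = rn G t")
    case False
    have "\<exists>s. s \<in> L \<and> rn G s = y" using that by (auto simp: orbit_of_def)
    then have "(SOME s. s \<in> L \<and> rn G s = y) \<in> L \<and> rn G (SOME s. s \<in> L \<and> rn G s = y) = y"
      by (rule someI_ex)
    moreover have "\<tau> y = (SOME s. s \<in> L \<and> rn G s = y)"
      unfolding \<tau>_def using False by (rule if_not_P)
    ultimately show ?thesis by metis
  qed (use assms in \<open>simp add: \<tau>_def\<close>)
  then show ?thesis using that[of \<tau>] by (simp add: \<tau>_def)
qed

lemma eq_zeroI: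
  assumes w: "w \<in> carrier T" and "\<And>t. t \<in> L \<Longrightarrow> coord t w = \<zero>\<^bsub>V\<^esub>"
  shows "w = \<zero>\<^bsub>T\<^esub>"
proof -
  interpret T: Module.module K T by (rule module_T)
  obtain \<tau> where \<tau>: "\<And>y. y \<in> orbit_of G x \<Longrightarrow> \<tau> y \<in> L \<and> rn G (\<tau> y) = y"
    using transversal_through[OF x_fibre] by metis
  have ball: "\<forall>y \<in> orbit_of G x. \<tau> y \<in> L \<and> rn G (\<tau> y) = y" using \<tau> by simp
  obtain Y where Y: "finite Y" "Y \<subseteq> orbit_of G x" "\<forall>Z. finite Z \<and> Y \<subseteq> Z \<and> Z \<subseteq> orbit_of G x \<longrightarrow>
      w = (\<Oplus>\<^bsub>T\<^esub>y \<in> Z. embed (\<tau> y) (coord (\<tau> y) w))"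
    using decomposition[OF ball w] by (elim exE conjE) (rule that)
  have "embed (\<tau> y) (coord (\<tau> y) w) = \<zero>\<^bsub>T\<^esub>" if "y \<in> orbit_of G x" for y
    using \<tau>[OF that] assms(2) lin_map_zero[OF module_V module_T embed_lin] by simp
  then have "(\<Oplus>\<^bsub>T\<^esub>y \<in> Y. embed (\<tau> y) (coord (\<tau> y) w)) = \<zero>\<^bsub>T\<^esub>"
    using Y(2) by (intro T.add.finprod_one_eqI) auto
  then show ?thesis using Y(3)[rule_format, of Y] Y(1,2) by simp
qed

section \<open>Indicator functions of slices acting on the induced module\<close>

lemma one_on_A':
  assumes U: "U \<subseteq> carrier G" "inj_on (dm G) U"
  shows "one_on K U \<in> carrier A'"
proof -
  have "finite {g \<in> fibre G y. one_on K U g \<noteq> \<zero>\<^bsub>K\<^esub>}" for y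
  proof -
    let ?S = "{g \<in> fibre G y. one_on K U g \<noteq> \<zero>\<^bsub>K\<^esub>}"
    have sub: "?S \<subseteq> U" by (auto simp: one_on_def)
    have "dm G ` ?S \<subseteq> {y}" by (auto simp: fibre_iff)
    then show ?thesis by (rule finite_imageD[OF finite_subset inj_on_subset[OF U(2) sub]]) simp
  qed
  then show ?thesis
    using U(1) by (auto simp: carrier_A'_iff K.function_module_carrier_iff one_on_def)
qed

text \<open>For \<open>y\<close> in \<open>L_x\<close> the arrow \<open>y t^-1\<close> has source
  \<open>r(t)\<close>, and \<open>U\<close> contains at most one arrow with that source. So the
  vector \<open>1_U \<cdot> t\<close> is a basis vector or zero.\<close>

lemma lact_one_embed:
  assumes U: "U \<subseteq> carrier G" "inj_on (dm G) U" and t: "t \<in> L" and v: "v \<in> carrier V"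
  shows "\<lbrakk>u \<in> U; dm G u = rn G t\<rbrakk> \<Longrightarrow> lact T (one_on K U) (embed t v) = embed (u \<cdot> t) v"
    and "(\<And>u. u \<in> U \<Longrightarrow> dm G u \<noteq> rn G t) \<Longrightarrow> lact T (one_on K U) (embed t v) = \<zero>\<^bsub>T\<^esub>"
proof -
  note oneA = one_on_A'[OF U]
  have eq: "lact T (one_on K U) (embed t v) = tens (translate (one_on K U) t) v"
    unfolding embed_def using t v by (simp add: lact_T_tens[OF oneA] basis_M lact_M_basis[OF oneA])
  {
    assume u: "u \<in> U" "dm G u = rn G t"
    have "y \<cdot> ginv G t \<in> U \<longleftrightarrow> y = u \<cdot> t" if y: "y \<in> L" for y
    proof
      assume "y \<cdot> ginv G t \<in> U"
      moreover have "dm G (y \<cdot> ginv G t) = dm G u" using y t u by (simp add: fibre_iff)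
      ultimately have "y \<cdot> ginv G t = u" by (intro inj_onD[OF U(2) _ _ u(1)])
      then show "y = u \<cdot> t" using comp_ginv_cancel'[of y t] y t by (simp add: fibre_iff)
    next
      assume "y = u \<cdot> t"
      then show "y \<cdot> ginv G t \<in> U" using u t U(1) by (auto simp: fibre_iff)
    qed
    moreover have "u \<cdot> t \<in> L" using u t U(1) by (auto simp: fibre_iff)
    ultimately have "translate (one_on K U) t = basis_vec K (u \<cdot> t)"
      by (auto simp: translate_def one_on_def basis_vec_def fun_eq_iff)
    then show "lact T (one_on K U) (embed t v) = embed (u \<cdot> t) v"
      using eq by (simp add: embed_def)
  next
    assume none: "\<And>u. u \<in> U \<Longrightarrow> dm G u \<noteq> rn G t"
    have "y \<cdot> ginv G t \<notin> U" if "y \<in> L" for y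
      using none[of "y \<cdot> ginv G t"] that t by (auto simp: fibre_iff)
    then have "translate (one_on K U) t = \<zero>\<^bsub>M\<^esub>"
      by (auto simp: translate_def one_on_def M_ops fun_eq_iff)
    then show "lact T (one_on K U) (embed t v) = \<zero>\<^bsub>T\<^esub>"
      using eq lin_map_zero[OF module_M' module_T lin_map_tens_left[OF v]] by simp
  }
qed

text \<open>Decompose \<open>w\<close> along a transversal through \<open>t\<close>. The summand at
  \<open>r(t)\<close> is carried along by \<open>h\<close>. A summand at another \<open>y\<close>
  either is zero, because \<open>y\<close> is the source of an arrow of \<open>U\<close> and so
  outside the support by \<open>sep\<close>, or is killed, because no arrow of \<open>U\<close>
  starts at \<open>y\<close>.\<close>

lemma lact_one_local:
  assumes U: "U \<subseteq> carrier G" "inj_on (dm G) U" and w: "w \<in> carrier T" and t: "t \<in> L"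
    and h: "h \<in> U" "dm G h = rn G t" and sep: "\<And>g. \<lbrakk>g \<in> U; dm G g \<in> support w\<rbrakk> \<Longrightarrow> dm G g = dm G h"
  shows "lact T (one_on K U) w = embed (h \<cdot> t) (coord t w)"
proof -
  interpret T: Module.module K T by (rule module_T)
  let ?O = "orbit_of G x" and ?f = "lact T (one_on K U)"
  have hc: "h \<in> carrier G" using h(1) U(1) by auto
  note f = lact_T_lin[OF one_on_A'[OF U]]
  obtain \<tau> where \<tau>: "\<And>y. y \<in> ?O \<Longrightarrow> \<tau> y \<in> L \<and> rn G (\<tau> y) = y" and \<tau>t: "\<tau> (rn G t) = t"
    using transversal_through[OF t] by metis
  let ?p = "\<lambda>y. embed (\<tau> y) (coord (\<tau> y) w)"
  have cc: "coord (\<tau> y) w \<in> carrier V" if "y \<in> ?O" for y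
    using \<tau>[OF that] w by (auto intro: lin_map_closed[OF coord_lin])
  have pc: "?p y \<in> carrier T" if "y \<in> ?O" for y
    using \<tau>[OF that] cc[OF that] by (auto intro: embed_closed)
  have rt: "rn G t \<in> ?O" using t by (simp add: orbit_of_def)
  have ball: "\<forall>y \<in> orbit_of G x. \<tau> y \<in> L \<and> rn G (\<tau> y) = y" using \<tau> by simp
  obtain Y where Y: "finite Y" "Y \<subseteq> ?O" "\<forall>Z. finite Z \<and> Y \<subseteq> Z \<and> Z \<subseteq> ?O \<longrightarrow> w = (\<Oplus>\<^bsub>T\<^esub>y \<in> Z. ?p y)"
    using decomposition[OF ball w] by (elim exE conjE) (rule that)
  \<comment> \<open>The range of \<open>t\<close> may be missing from \<open>Y\<close>; with it
    adjoined, exactly one index survives the action, even if its component is zero.\<close>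
  define Z where "Z = insert (rn G t) Y"
  have Z: "finite Z" "Z \<subseteq> ?O" "rn G t \<in> Z" and wZ: "w = (\<Oplus>\<^bsub>T\<^esub>y \<in> Z. ?p y)"
    using Y(1,2) rt Y(3)[rule_format, of Z] by (auto simp: Z_def)
  have fp: "?f (?p y) = (if rn G t = y then embed (h \<cdot> t) (coord t w) else \<zero>\<^bsub>T\<^esub>)" if y: "y \<in> ?O" for y
  proof (cases "rn G t = y")
    case True
    then show ?thesis
      using lact_one_embed(1)[OF U t _ h] cc[OF y] \<tau>t by auto
  next
    case False
    show ?thesis
    proof (cases "\<exists>u \<in> U. dm G u = y")
      case True
      then have "y \<notin> support w" using sep h(2) False by auto
      then have "coord (\<tau> y) w = \<zero>\<^bsub>V\<^esub>" using \<tau>[OF y] by (force simp: support_def)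
      then have "?p y = \<zero>\<^bsub>T\<^esub>" using lin_map_zero[OF module_V module_T embed_lin] \<tau>[OF y] by simp
      then show ?thesis using False lin_map_zero[OF module_T module_T f] by simp
    next
      case nex: False
      then have "?f (?p y) = \<zero>\<^bsub>T\<^esub>" using \<tau>[OF y] cc[OF y] by (intro lact_one_embed(2)[OF U]) auto
      then show ?thesis using False by simp
    qed
  qed
  have ec: "embed (h \<cdot> t) (coord t w) \<in> carrier T"
    using hc h(2) t w by (intro embed_closed lin_map_closed[OF coord_lin]) (auto simp: fibre_iff)
  have fsum: "?f (finsum T ?p S) = (\<Oplus>\<^bsub>T\<^esub>y \<in> S. ?f (?p y))" if "finite S" "S \<subseteq> ?O" for S
    using that
  proof (induction S)
    case empty
    then show ?case using lin_map_zero[OF module_T module_T f] by simp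
  next
    case (insert a S)
    have S: "?p \<in> S \<rightarrow> carrier T" "?p a \<in> carrier T"
      "(\<lambda>y. ?f (?p y)) \<in> S \<rightarrow> carrier T" "?f (?p a) \<in> carrier T"
      using insert.prems pc lin_map_closed[OF f] by auto
    show ?case
      using insert S
      by (simp add: T.finsum_insert[OF insert.hyps(1,2) S(1,2)] lin_map_add[OF f]
          T.finsum_insert[OF insert.hyps(1,2) S(3,4)])
  qed
  have "?f w = (\<Oplus>\<^bsub>T\<^esub>y \<in> Z. ?f (?p y))" using fsum[OF Z(1,2)] wZ by simp
  also have "\<dots> = (\<Oplus>\<^bsub>T\<^esub>y \<in> Z. if rn G t = y then embed (h \<cdot> t) (coord t w) else \<zero>\<^bsub>T\<^esub>)"
    by (rule T.finsum_cong') (use Z fp ec in auto)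
  also have "\<dots> = embed (h \<cdot> t) (coord t w)"
    using Z ec by (intro T.finsum_singleton) auto
  finally show ?thesis .
qed

text \<open>The retraction \<open>coord x\<close> sends generators of \<open>T\<close> to generators
  of \<open>V\<close>. Moreover the supports of generators of \<open>T\<close> cover the orbit:
  otherwise some \<open>coord t\<close> would vanish on \<open>T\<close>, but it maps
  \<open>embed t v\<close> to \<open>v\<close>. Conversely, generators of \<open>V\<close> placed at
  each point of a finite orbit generate \<open>T\<close>.\<close>

lemma finite_dimensional_T_iff:
  assumes "carrier V \<noteq> {\<zero>\<^bsub>V\<^esub>}"
  shows "finite_dimensional K T \<longleftrightarrow> finite_index G x \<and> finite_dimensional K V"
proof
  interpret T: Module.module K T by (rule module_T)
  interpret V: Module.module K V by (rule module_V)
  assume "finite_dimensional K T"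
  then obtain S where S: "finite S" "S \<subseteq> carrier T" "lin_span K T S = carrier T"
    by (auto simp: finite_dimensional_def)
  have Tle: "carrier T \<subseteq> N" if "submodule N K T" "S \<subseteq> N" for N
    using lin_span_least[OF that] S(3) by simp
  have "finite_dimensional K V"
    unfolding finite_dimensional_def
  proof (intro exI conjI)
    note cx = coord_lin[OF x_fibre]
    show im: "coord x ` S \<subseteq> carrier V" using S(2) lin_map_closed[OF cx] by auto
    show "lin_span K V (coord x ` S) = carrier V"
    proof (rule lin_span_eq_carrierI[OF module_V im])
      fix N assume N: "submodule N K V" "coord x ` S \<subseteq> N"
      have "carrier T \<subseteq> {w \<in> carrier T. coord x w \<in> N}"
        by (rule Tle[OF submodule_vimage[OF module_T module_V cx N(1)]]) (use S(2) N(2) in auto)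
      then show "carrier V \<subseteq> N"
        using coord_embed_self[OF x_fibre] embed_closed[OF x_fibre] by force
    qed
  qed (use S(1) in simp)
  moreover have "finite_index G x"
  proof -
    let ?Y = "\<Union>b \<in> S. support b"
    have "finite ?Y" using S finite_support by auto
    obtain v where v: "v \<in> carrier V" "v \<noteq> \<zero>\<^bsub>V\<^esub>" using assms by auto
    have "orbit_of G x \<subseteq> ?Y"
    proof
      fix y assume "y \<in> orbit_of G x"
      then obtain t where t: "t \<in> L" "y = rn G t" by (auto simp: orbit_of_def)
      show "y \<in> ?Y"
      proof (rule ccontr)
        assume "y \<notin> ?Y"
        then have "S \<subseteq> {w \<in> carrier T. coord t w = \<zero>\<^bsub>V\<^esub>}"
          using S(2) t by (auto simp: support_def)
        then have "coord t (embed t v) = \<zero>\<^bsub>V\<^esub>"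
          using Tle[OF submodule_kernel[OF module_T module_V coord_lin[OF t(1)]]]
            embed_closed[OF t(1) v(1)] by auto
        then show False using v by (simp add: coord_embed_self[OF t(1)])
      qed
    qed
    then show ?thesis using \<open>finite ?Y\<close> finite_subset unfolding finite_index_def by blast
  qed
  ultimately show "finite_index G x \<and> finite_dimensional K V" by simp
next
  assume "finite_index G x \<and> finite_dimensional K V"
  then obtain S where S: "finite S" "S \<subseteq> carrier V" "lin_span K V S = carrier V"
    and fin: "finite (orbit_of G x)"
    by (auto simp: finite_dimensional_def finite_index_def)
  obtain \<tau> where \<tau>: "\<And>y. y \<in> orbit_of G x \<Longrightarrow> \<tau> y \<in> L \<and> rn G (\<tau> y) = y"
    using transversal_through[OF x_fibre] by metis
  let ?S = "\<Union>y \<in> orbit_of G x. embed (\<tau> y) ` S"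
  have im: "?S \<subseteq> carrier T" using \<tau> S(2) embed_closed by blast
  moreover have "finite ?S" using S(1) fin by simp
  moreover have "lin_span K T ?S = carrier T"
  proof (rule lin_span_eq_carrierI[OF module_T im])
    fix N assume N: "submodule N K T" "?S \<subseteq> N"
    show "carrier T \<subseteq> N"
    proof (rule embed_span[OF N(1)])
      fix t v assume t: "t \<in> L" and v: "v \<in> carrier V"
      \<comment> \<open>The generating set contains only elements over the representatives, so
        \<open>t\<close> is replaced by the one with its range, at the price of an isotropy element
        acting on \<open>v\<close>.\<close>
      let ?s = "\<tau> (rn G t)"
      have rt: "rn G t \<in> orbit_of G x" using t by (simp add: orbit_of_def)
      note s = \<tau>[OF rt]
      have "carrier V \<subseteq> {v \<in> carrier V. embed ?s v \<in> N}"
        unfolding S(3)[symmetric]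
        by (subst (2) S(3), rule lin_span_least[OF
              submodule_vimage[OF module_V module_T embed_lin[OF s[THEN conjunct1]] N(1)]])
          (use S(2) N(2) rt in auto)
      moreover have "act (ginv G ?s \<cdot> t) v \<in> carrier V"
        using s t v by (intro act_closed quotient_H) auto
      ultimately show "embed t v \<in> N"
        using embed_change[of ?s t v] s t v by auto
    qed
  qed
  ultimately show "finite_dimensional K T" unfolding finite_dimensional_def by blast
qed

end

section \<open>Compact slices\<close>

text \<open>Continuity is a local property. This is where the continuity of the source map comes
  from in \<open>slice_avoiding\<close>.\<close>

lemma local_homeomorphism_openin_preimage:
  assumes "local_homeomorphism X Y f" "openin Y W"
  shows "openin X {z \<in> topspace X. f z \<in> W}"
proof (subst openin_subopen, intro ballI)
  fix z assume z: "z \<in> {z \<in> topspace X. f z \<in> W}"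
  then obtain U where U: "openin X U" "z \<in> U"
    and hom: "homeomorphic_map (subtopology X U) (subtopology Y (f ` U)) f"
    using assms(1) unfolding local_homeomorphism_def by blast
  have "continuous_map (subtopology X U) Y f"
    using homeomorphic_imp_continuous_map[OF hom] by (rule continuous_map_into_fulltopology)
  then have "openin (subtopology X U) {z \<in> topspace (subtopology X U). f z \<in> W}"
    using assms(2) by (rule openin_continuous_map_preimage)
  then have "openin X {z \<in> topspace (subtopology X U). f z \<in> W}"
    using U(1) by (rule openin_trans_full)
  then show "\<exists>T. openin X T \<and> z \<in> T \<and> T \<subseteq> {z \<in> topspace X. f z \<in> W}"
    using z U by (intro exI[of _ "{z \<in> topspace (subtopology X U). f z \<in> W}"]) auto
qed

context ample_groupoid
begin

text \<open>Finite sets are closed in the Hausdorff unit space. Removing one and pulling back along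
  the source map leaves an open set around \<open>h\<close>, and compact slices form a
  basis.\<close>

lemma slice_avoiding:
  assumes h: "h \<in> carrier G" and Y: "finite Y"
  obtains U where "compact_slice G U" "h \<in> U" "\<And>g. \<lbrakk>g \<in> U; dm G g \<in> Y\<rbrakk> \<Longrightarrow> dm G g = dm G h"
proof -
  let ?X0 = "subtopology (gtop G) (unit_space G)"
  have ts: "topspace ?X0 = unit_space G"
    by (auto simp: topspace_gtop unit_space_def)
  \<comment> \<open>The source of \<open>h\<close> is kept, as it may belong to \<open>Y\<close>;
    the intersection with the unit space turns \<open>Y\<close> into a subset of the space in which
    it is to be closed.\<close>
  let ?Y = "(Y \<inter> unit_space G) - {dm G h}"
  have "finite ?Y" "?Y \<subseteq> topspace ?X0" using Y ts by auto
  then have "closedin ?X0 ?Y"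
    using Hausdorff_imp_t1_space[OF Hausdorff_units] unfolding t1_space_closedin_finite by blast
  then have "openin ?X0 (unit_space G - ?Y)"
    using openin_diff[OF openin_topspace, of ?X0 ?Y] ts by simp
  then have "openin (gtop G) {g \<in> topspace (gtop G). dm G g \<in> unit_space G - ?Y}"
    by (rule local_homeomorphism_openin_preimage[OF dm_local_homeo])
  then obtain \<U> where \<U>: "\<U> \<subseteq> Collect (compact_slice G)"
    "\<Union>\<U> = {g \<in> topspace (gtop G). dm G g \<in> unit_space G - ?Y}"
    unfolding compact_slices_base union_of_def by auto
  have units: "dm G g \<in> unit_space G" if "g \<in> carrier G" for g
    using that by (simp add: unit_space_def)
  have "h \<in> \<Union>\<U>" unfolding \<U>(2) using h units by (simp add: topspace_gtop)
  then obtain U where U: "U \<in> \<U>" "h \<in> U" by blast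
  show ?thesis
  proof (rule that)
    show "compact_slice G U" using \<U>(1) U(1) by blast
    show "h \<in> U" by (rule U(2))
    fix g assume "g \<in> U" "dm G g \<in> Y"
    then have "g \<in> {g \<in> topspace (gtop G). dm G g \<in> unit_space G - ?Y}" using \<U>(2) U(1) by blast
    then show "dm G g = dm G h" using \<open>dm G g \<in> Y\<close> by auto
  qed
qed

lemma compact_sliceD:
  assumes "compact_slice G U"
  shows "U \<subseteq> carrier G" "inj_on (dm G) U"
  using assms openin_subset[of "gtop G" U] by (auto simp: compact_slice_def slice_def topspace_gtop)

end

text \<open>The slice itself is the Hausdorff open set of the definition: on it the function is
  constantly one, and a closed subset of a compact space is compact.\<close>

lemma (in cring) one_on_generator:
  assumes U: "compact_slice G U" and top: "topspace (gtop G) = carrier G"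
  shows "one_on R U \<in> steinberg_generators R G"
proof -
  let ?S = "subtopology (gtop G) U"
  have op: "openin (gtop G) U" and comp: "compactin (gtop G) U" and Hd: "Hausdorff_space ?S"
    using U by (auto simp: compact_slice_def slice_def)
  have Uc: "U \<subseteq> carrier G" using openin_subset[OF op] top by simp
  have "one_on R U \<in> carrier (function_module R (carrier G))"
    using Uc by (auto simp: function_module_carrier_iff one_on_def)
  moreover have "continuous_map ?S (discrete_topology (carrier R)) (one_on R U)"
    by (rule continuous_map_eq[of _ _ "\<lambda>_. \<one>"]) (auto simp: one_on_def)
  moreover have "compactin ?S (?S closure_of {g \<in> U. one_on R U g \<noteq> \<zero>})"
    using compact_space_subtopology[OF comp] closedin_closure_of by (rule closedin_compact_space)
  ultimately show ?thesis
    unfolding steinberg_generators_def using op Hd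
    by (intro CollectI conjI exI[of _ U]) (simp_all add: one_on_def)
qed

section \<open>The Steinberg algebra inside the functions with finite support on fibres\<close>

locale ample_pointed = ample_groupoid G + pointed_groupoid G K x
  for G :: "('g, 'e) top_groupoid_scheme" (structure) and K :: "('k, 'c) ring_scheme" and x :: 'g
begin

abbreviation "A \<equiv> steinberg_algebra K G"

lemma A_ops:
  "f \<oplus>\<^bsub>A\<^esub> g = f \<oplus>\<^bsub>A'\<^esub> g" "k \<odot>\<^bsub>A\<^esub> f = k \<odot>\<^bsub>A'\<^esub> f" "f \<otimes>\<^bsub>A\<^esub> g = f \<otimes>\<^bsub>A'\<^esub> g"
  by (simp_all add: steinberg_algebra_def function_module_def)

text \<open>The compact closure of the nonvanishing set is covered by finitely many compact slices,
  and injectivity of the source map lets each of them meet a fibre in at most one arrow.\<close>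

lemma generators_A':
  assumes "f \<in> steinberg_generators K G"
  shows "f \<in> carrier A'"
proof -
  obtain V where fc: "f \<in> carrier (function_module K (carrier G))" and V: "openin (gtop G) V"
    and f0: "\<And>g. g \<notin> V \<Longrightarrow> f g = \<zero>\<^bsub>K\<^esub>"
    and comp: "compactin (subtopology (gtop G) V)
        (subtopology (gtop G) V closure_of {g \<in> V. f g \<noteq> \<zero>\<^bsub>K\<^esub>})" (is "compactin ?V ?C")
    using assms unfolding steinberg_generators_def by blast
  have C: "compactin (gtop G) ?C" using comp by (simp add: compactin_subtopology)
  have slice_open: "\<And>U. U \<in> Collect (compact_slice G) \<Longrightarrow> openin (gtop G) U"
    by (simp add: compact_slice_def slice_def)
  have cover: "?C \<subseteq> \<Union>(Collect (compact_slice G))"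
  proof
    fix g assume "g \<in> ?C"
    then have "g \<in> carrier G" using closure_of_subset_topspace topspace_gtop by fastforce
    then obtain U where "compact_slice G U" "g \<in> U" by (rule slice_avoiding[of g "{}"]) auto
    then show "g \<in> \<Union>(Collect (compact_slice G))" by blast
  qed
  have "\<exists>\<F>. finite \<F> \<and> \<F> \<subseteq> Collect (compact_slice G) \<and> ?C \<subseteq> \<Union>\<F>"
    by (rule compactinD[OF C _ cover]) (rule slice_open)
  then obtain \<F> where \<F>: "finite \<F>" "\<F> \<subseteq> Collect (compact_slice G)" "?C \<subseteq> \<Union>\<F>"
    by (elim exE conjE) (rule that)
  have VC: "{g \<in> V. f g \<noteq> \<zero>\<^bsub>K\<^esub>} \<subseteq> ?C"
    by (rule closure_of_subset) (use openin_subset[OF V] in auto)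
  have "finite {g \<in> fibre G y. f g \<noteq> \<zero>\<^bsub>K\<^esub>}" for y
  proof (rule finite_subset)
    show "{g \<in> fibre G y. f g \<noteq> \<zero>\<^bsub>K\<^esub>} \<subseteq> (\<Union>U \<in> \<F>. U \<inter> fibre G y)"
      using VC \<F>(3) f0 by blast
    have "finite (U \<inter> fibre G y)" if "U \<in> \<F>" for U
    proof (rule finite_imageD)
      show "inj_on (dm G) (U \<inter> fibre G y)"
        using compact_sliceD(2) that \<F>(2) by (blast intro: inj_on_subset)
      show "finite (dm G ` (U \<inter> fibre G y))"
        by (rule finite_subset[of _ "{y}"]) (auto simp: fibre_iff)
    qed
    then show "finite (\<Union>U \<in> \<F>. U \<inter> fibre G y)" using \<F>(1) by blast
  qed
  then show ?thesis using fc by (simp add: carrier_A'_iff)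
qed

lemma carrier_A: "carrier A = lin_span K (function_module K (carrier G)) (steinberg_generators K G)"
  by (simp add: steinberg_algebra_def)

lemma carrier_A_subset: "carrier A \<subseteq> carrier A'"
  unfolding carrier_A
proof (rule lin_span_least)
  show "submodule (carrier A') K (function_module K (carrier G))"
  proof (rule submoduleI'[OF K.module_function_module])
    show "f \<oplus>\<^bsub>function_module K (carrier G)\<^esub> g \<in> carrier A'"
      if "f \<in> carrier A'" "g \<in> carrier A'" for f g
      using A'_add_closed[OF that] by simp
    show "k \<odot>\<^bsub>function_module K (carrier G)\<^esub> f \<in> carrier A'"
      if "k \<in> carrier K" "f \<in> carrier A'" for k f
      using A'_smult_closed[OF that] by simp
  qed (auto simp: carrier_A'_iff K.function_module_carrier_iff)
qed (use generators_A' in blast)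

lemma one_on_A: "compact_slice G U \<Longrightarrow> one_on K U \<in> carrier A"
  unfolding carrier_A
  by (rule subsetD[OF lin_span_superset]) (rule K.one_on_generator[OF _ topspace_gtop])

end

section \<open>Simplicity of the induced module\<close>

locale ample_induced = ample_pointed G K x + induced_setting G K x V
  for G :: "('g, 'e) top_groupoid_scheme" (structure) and K :: "('k, 'c) ring_scheme" and x :: 'g
    and V :: "('k, 'g \<Rightarrow> 'k, 'v, 'f) amodule_scheme"
begin

text \<open>The arrow \<open>s t^-1\<close> carries \<open>t\<close> to \<open>s\<close>; a slice
  around it that avoids the rest of the support isolates the component at \<open>r(t)\<close>. That
  the slice contains this arrow is recorded for \<open>hom_embed\<close>, where the same slice acts
  on a second module.\<close>

lemma slice_through:
  assumes w: "w \<in> carrier T" and t: "t \<in> L" and s: "s \<in> L"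
  obtains U where "compact_slice G U" "lact T (one_on K U) w = embed s (coord t w)"
    "s \<cdot> ginv G t \<in> U"
proof -
  let ?h = "s \<cdot> ginv G t"
  have h: "?h \<in> carrier G" "dm G ?h = rn G t" "?h \<cdot> t = s" using s t by (auto simp: fibre_iff)
  obtain U where U: "compact_slice G U" "?h \<in> U"
    "\<And>g. \<lbrakk>g \<in> U; dm G g \<in> support w\<rbrakk> \<Longrightarrow> dm G g = dm G ?h"
    by (rule slice_avoiding[OF h(1) finite_support[OF w]]) blast
  have "lact T (one_on K U) w = embed (?h \<cdot> t) (coord t w)"
    by (rule lact_one_local[OF compact_sliceD[OF U(1)] w t U(2) h(2) U(3)])
  then show ?thesis using that U h(3) by simp
qed

text \<open>Taking \<open>s = t\<close> in \<open>slice_through\<close> gives a slice that fixes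
  \<open>embed t v\<close>, so each generator of \<open>T\<close> is itself of the form
  \<open>a w\<close>.\<close>

lemma nondegenerate_T: "nondegenerate_module K A T"
proof (rule nondegenerate_module.intro[OF module_T], rule nondegenerate_module_axioms.intro)
  let ?S = "{lact T a w | a w. a \<in> carrier A \<and> w \<in> carrier T}"
  have AA: "a \<in> carrier A'" if "a \<in> carrier A" for a using that carrier_A_subset by blast
  note lin = lact_T_lin[OF AA]
  show "lin_span K T ?S = carrier T"
  proof (rule lin_span_eq_carrierI[OF module_T])
    show "?S \<subseteq> carrier T" using lin_map_closed[OF lin] by blast
    fix N assume N: "submodule N K T" "?S \<subseteq> N"
    show "carrier T \<subseteq> N"
    proof (rule embed_span[OF N(1)])
      fix t v assume t: "t \<in> L" and v: "v \<in> carrier V"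
      note e = embed_closed[OF t v]
      obtain U where "compact_slice G U" "lact T (one_on K U) (embed t v) = embed t (coord t (embed t v))"
        by (rule slice_through[OF e t t])
      then have "embed t v \<in> ?S"
        using one_on_A e by (force simp: coord_embed_self[OF t v])
      then show "embed t v \<in> N" using N(2) by blast
    qed
  qed
qed (use carrier_A_subset in \<open>auto simp: A_ops lin_map_closed[OF lact_T_lin] lin_map_add[OF lact_T_lin]
    lin_map_smult[OF lact_T_lin] lact_T_add lact_T_smult lact_T_mult subset_iff simp del: A'_ops\<close>)

lemma simple_T:
  assumes "simple_amodule K B V"
  shows "simple_amodule K A T"
  unfolding simple_amodule_def
proof (intro conjI allI impI nondegenerate_T)
  have V0: "carrier V \<noteq> {\<zero>\<^bsub>V\<^esub>}"
    and simple: "\<And>N. asubmodule N K B V \<Longrightarrow> N = {\<zero>\<^bsub>V\<^esub>} \<or> N = carrier V"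
    using assms by (auto simp: simple_amodule_def)
  interpret T: Module.module K T by (rule module_T)
  interpret V: Module.module K V by (rule module_V)
  obtain v where v: "v \<in> carrier V" "v \<noteq> \<zero>\<^bsub>V\<^esub>" using V0 by auto
  have "embed x v \<noteq> \<zero>\<^bsub>T\<^esub>"
    using coord_embed_self[OF x_fibre v(1)] v(2) lin_map_zero[OF module_T module_V coord_lin[OF x_fibre]]
    by auto
  then show "carrier T \<noteq> {\<zero>\<^bsub>T\<^esub>}" using embed_closed[OF x_fibre v(1)] by auto
  fix N assume "asubmodule N K A T"
  then have N: "submodule N K T" and NA: "\<And>a n. \<lbrakk>a \<in> carrier A; n \<in> N\<rbrakk> \<Longrightarrow> lact T a n \<in> N"
    by (auto simp: asubmodule_def)
  show "N = {\<zero>\<^bsub>T\<^esub>} \<or> N = carrier T"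
  proof (cases "N = {\<zero>\<^bsub>T\<^esub>}")
    case False
    then obtain w where w: "w \<in> N" "w \<noteq> \<zero>\<^bsub>T\<^esub>" using submodule_zero[OF N] by blast
    have wc: "w \<in> carrier T" using w(1) submodule_subset[OF N] by blast
    then obtain t where t: "t \<in> L" "coord t w \<noteq> \<zero>\<^bsub>V\<^esub>" using eq_zeroI w(2) by blast
    \<comment> \<open>Letting \<open>s\<close> range over all of \<open>L_x\<close> makes
      \<open>P\<close> stable under the isotropy group, because
      \<open>s \<otimes> g v = s g \<otimes> v\<close>.\<close>
    define P where "P = {v \<in> carrier V. \<forall>s \<in> L. embed s v \<in> N}"
    have subP: "submodule P K V"
    proof (rule submoduleI'[OF module_V])
      show "\<zero>\<^bsub>V\<^esub> \<in> P"
        using submodule_zero[OF N] by (simp add: P_def lin_map_zero[OF module_V module_T embed_lin])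
      show "u \<oplus>\<^bsub>V\<^esub> v \<in> P" if "u \<in> P" "v \<in> P" for u v
        using that by (simp add: P_def lin_map_add[OF embed_lin] submodule_add[OF N])
      show "k \<odot>\<^bsub>V\<^esub> v \<in> P" if "k \<in> carrier K" "v \<in> P" for k v
        using that by (simp add: P_def lin_map_smult[OF embed_lin] submodule_smult[OF N])
    qed (auto simp: P_def)
    have "lact V b v \<in> P" if b: "b \<in> carrier B" and v: "v \<in> P" for b v
    proof -
      have vc: "v \<in> carrier V" using v by (simp add: P_def)
      have "carrier (free_module K H) \<subseteq> {b \<in> carrier (free_module K H). lact V b v \<in> P}"
      proof (rule K.free_module_span)
        show "submodule {b \<in> carrier (free_module K H). lact V b v \<in> P} K (free_module K H)"
          using lact_V_lin_left[OF vc] unfolding lin_map_B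
          by (rule submodule_vimage[OF K.module_free_module module_V _ subP])
        fix g assume g: "g \<in> H"
        have "embed s (act g v) \<in> N" if "s \<in> L" for s
          using v L_comp_H[OF that g] by (simp add: embed_comp[OF that g vc, symmetric] P_def)
        then have "act g v \<in> P" using act_closed[OF g vc] by (simp add: P_def)
        then show "basis_vec K g \<in> {b \<in> carrier (free_module K H). lact V b v \<in> P}"
          using g by (simp add: act_def K.basis_vec_closed)
      qed
      then show ?thesis using b unfolding B_ops by blast
    qed
    then have "asubmodule P K B V" using subP by (simp add: asubmodule_def)
    moreover have "coord t w \<in> P"
    proof -
      have "embed s (coord t w) \<in> N" if "s \<in> L" for s
        by (rule slice_through[OF wc t(1) that]) (use NA[OF one_on_A w(1)] in metis)
      then show ?thesis using lin_map_closed[OF coord_lin[OF t(1)] wc] by (simp add: P_def)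
    qed
    ultimately have "P = carrier V" using simple t(2) by blast
    then have "carrier T \<subseteq> N" using embed_span[OF N] by (auto simp: P_def)
    then show ?thesis using submodule_subset[OF N] by blast
  qed simp
qed

end

section \<open>Homomorphisms between induced modules\<close>

definition amodule_hom :: "('k, 'c) ring_scheme \<Rightarrow> ('k, 'a, 'd) module_scheme
    \<Rightarrow> ('k, 'a, 'm, 'e) amodule_scheme \<Rightarrow> ('k, 'a, 'n, 'f) amodule_scheme \<Rightarrow> ('m \<Rightarrow> 'n) \<Rightarrow> bool" where
  "amodule_hom K A M N \<phi> \<longleftrightarrow> lin_map K M N \<phi> \<and>
    (\<forall>a \<in> carrier A. \<forall>m \<in> carrier M. \<phi> (lact M a m) = lact N a (\<phi> m))"

lemma amodule_isomorphic_iff: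
  "amodule_isomorphic K A M N \<longleftrightarrow>
    (\<exists>\<phi>. bij_betw \<phi> (carrier M) (carrier N) \<and> amodule_hom K A M N \<phi>)"
  unfolding amodule_isomorphic_def amodule_hom_def lin_map_def
  by (intro iff_exI) (auto dest: bij_betwE)

lemma amodule_hom_inv_into:
  assumes "nondegenerate_module K A M" "bij_betw \<phi> (carrier M) (carrier N)" "amodule_hom K A M N \<phi>"
  shows "amodule_hom K A N M (inv_into (carrier M) \<phi>)"
proof -
  interpret M: nondegenerate_module K A M by fact
  let ?\<psi> = "inv_into (carrier M) \<phi>"
  have inv: "?\<psi> (\<phi> m) = m" if "m \<in> carrier M" for m
    using assms(2) that by (simp add: bij_betw_inv_into_left)
  have ex: "\<exists>m \<in> carrier M. n = \<phi> m" if "n \<in> carrier N" for n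
    using assms(2) that by (auto simp: bij_betw_def)
  have lin: "lin_map K M N \<phi>" and eq: "\<And>a m. \<lbrakk>a \<in> carrier A; m \<in> carrier M\<rbrakk> \<Longrightarrow> lact N a (\<phi> m) = \<phi> (lact M a m)"
    using assms(3) by (auto simp: amodule_hom_def)
  show ?thesis
    unfolding amodule_hom_def
  proof (intro conjI lin_mapI ballI)
    show "?\<psi> n \<in> carrier M" if "n \<in> carrier N" for n
      using ex[OF that] inv by auto
  next
    fix n n' assume "n \<in> carrier N" "n' \<in> carrier N"
    then obtain m m' where m: "m \<in> carrier M" "m' \<in> carrier M" "n = \<phi> m" "n' = \<phi> m'" using ex by blast
    have "n \<oplus>\<^bsub>N\<^esub> n' = \<phi> (m \<oplus>\<^bsub>M\<^esub> m')" using m by (simp add: lin_map_add[OF lin])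
    then show "?\<psi> (n \<oplus>\<^bsub>N\<^esub> n') = ?\<psi> n \<oplus>\<^bsub>M\<^esub> ?\<psi> n'" using m by (simp add: inv)
  next
    fix k n assume k: "k \<in> carrier K" and "n \<in> carrier N"
    then obtain m where m: "m \<in> carrier M" "n = \<phi> m" using ex by blast
    have "k \<odot>\<^bsub>N\<^esub> n = \<phi> (k \<odot>\<^bsub>M\<^esub> m)" using m k by (simp add: lin_map_smult[OF lin])
    then show "?\<psi> (k \<odot>\<^bsub>N\<^esub> n) = k \<odot>\<^bsub>M\<^esub> ?\<psi> n" using m k by (simp add: inv)
  next
    fix a n assume a: "a \<in> carrier A" and "n \<in> carrier N"
    then obtain m where m: "m \<in> carrier M" "n = \<phi> m" using ex by blast
    then show "?\<psi> (lact N a n) = lact M a (?\<psi> n)" using a by (simp add: eq inv M.lact_closed)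
  qed
qed

context ample_pointed
begin

text \<open>The vector \<open>x \<otimes> v\<close> is fixed by all small slices around \<open>x\<close>, hence so is its image under a
  homomorphism, which therefore lies in \<open>x \<otimes> W\<close>.\<close>

lemma hom_embed:
  assumes V: "ample_induced G K x V" and W: "ample_induced G K x W"
    and \<phi>: "amodule_hom K A (induced_module K G x V) (induced_module K G x W) \<phi>"
    and t: "t \<in> L" and v: "v \<in> carrier V"
  shows "\<phi> (induced_setting.embed G K x V t v) = induced_setting.embed G K x W t
    (induced_setting.coord G K x W x (\<phi> (induced_setting.embed G K x V x v)))"
proof -
  interpret V: ample_induced G K x V by (rule V)
  interpret W: ample_induced G K x W by (rule W)
  note \<phi>' = \<phi>[unfolded induced_module_def amodule_hom_def]
  let ?v = "V.embed x v"
  have vc: "?v \<in> carrier V.T" by (rule V.embed_closed[OF x_fibre v])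
  have wc: "\<phi> ?v \<in> carrier W.T" using \<phi>' vc by (auto intro: lin_map_closed)
  \<comment> \<open>The slice is adapted to the support of the image vector, which is not known in
    advance. On the side of \<open>V\<close> it is enough that it contains the arrow
    \<open>t x^-1\<close>, as \<open>x \<otimes> v\<close> has a single component.\<close>
  obtain U where U: "compact_slice G U" "lact W.T (one_on K U) (\<phi> ?v) = W.embed t (W.coord x (\<phi> ?v))"
    "t \<cdot> ginv G x \<in> U"
    by (rule W.slice_through[OF wc x_fibre t])
  have tx: "t \<cdot> ginv G x \<cdot> x = t" "dm G (t \<cdot> ginv G x) = rn G x" using t by (auto simp: fibre_iff)
  have "lact V.T (one_on K U) ?v = V.embed (t \<cdot> ginv G x \<cdot> x) v"
    by (rule V.lact_one_embed(1)[OF compact_sliceD[OF U(1)] x_fibre v U(3) tx(2)])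
  then have "\<phi> (V.embed t v) = \<phi> (lact V.T (one_on K U) ?v)" using tx(1) by simp
  also have "\<dots> = lact W.T (one_on K U) (\<phi> ?v)" using \<phi>' one_on_A[OF U(1)] vc by blast
  finally show ?thesis using U(2) by simp
qed

text \<open>By \<open>hom_embed\<close> an isomorphism sends \<open>t \<otimes> v\<close> to
  \<open>t \<otimes> \<psi> v\<close> with a map \<open>\<psi>\<close> that does not depend on
  \<open>t\<close>. The inverse isomorphism yields the inverse of \<open>\<psi>\<close> in the same
  way.\<close>

lemma isomorphic_of_induced:
  fixes V :: "('k, 'g \<Rightarrow> 'k, 'v, 'f1) amodule_scheme" and W :: "('k, 'g \<Rightarrow> 'k, 'w, 'f2) amodule_scheme"
  assumes "nondegenerate_module K B V" "nondegenerate_module K B W"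
    and "amodule_isomorphic K A (induced_module K G x V) (induced_module K G x W)"
  shows "amodule_isomorphic K B V W"
proof -
  have VI: "ample_induced G K x V" and WI: "ample_induced G K x W"
    using assms(1,2) by (auto intro!: ample_induced.intro ample_pointed_axioms induced_setting.intro
        pointed_groupoid_axioms induced_setting_axioms.intro)
  interpret V: ample_induced G K x V by (rule VI)
  interpret W: ample_induced G K x W by (rule WI)
  obtain \<phi> where bij: "bij_betw \<phi> (carrier V.T) (carrier W.T)" and \<phi>: "amodule_hom K A V.T W.T \<phi>"
    using assms(3) unfolding amodule_isomorphic_iff induced_module_def by blast
  define \<phi>' where "\<phi>' = inv_into (carrier V.T) \<phi>"
  have \<phi>': "amodule_hom K A W.T V.T \<phi>'"
    unfolding \<phi>'_def by (rule amodule_hom_inv_into[OF V.nondegenerate_T bij \<phi>])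
  have inv1: "\<phi>' (\<phi> w) = w" if "w \<in> carrier V.T" for w
    unfolding \<phi>'_def using bij that by (rule bij_betw_inv_into_left)
  have inv2: "\<phi> (\<phi>' w) = w" if "w \<in> carrier W.T" for w
    unfolding \<phi>'_def using bij that by (rule bij_betw_inv_into_right)
  have lin: "lin_map K V.T W.T \<phi>" and lin': "lin_map K W.T V.T \<phi>'"
    using \<phi> \<phi>' by (auto simp: amodule_hom_def)
  define \<psi> where "\<psi> v = W.coord x (\<phi> (V.embed x v))" for v
  define \<psi>' where "\<psi>' w = V.coord x (\<phi>' (W.embed x w))" for w
  have emb: "\<phi> (V.embed t v) = W.embed t (\<psi> v)" if "t \<in> L" "v \<in> carrier V" for t v
    unfolding \<psi>_def by (rule hom_embed[OF VI WI _ that]) (simp add: \<phi> induced_module_def)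
  have emb': "\<phi>' (W.embed t w) = V.embed t (\<psi>' w)" if "t \<in> L" "w \<in> carrier W" for t w
    unfolding \<psi>'_def by (rule hom_embed[OF WI VI _ that]) (simp add: \<phi>' induced_module_def)
  have \<psi>lin: "lin_map K V W \<psi>"
    unfolding \<psi>_def
    by (intro lin_map_comp[OF V.embed_lin[OF x_fibre]] lin_map_comp[OF lin] W.coord_lin x_fibre)
  have \<psi>'lin: "lin_map K W V \<psi>'"
    unfolding \<psi>'_def
    by (intro lin_map_comp[OF W.embed_lin[OF x_fibre]] lin_map_comp[OF lin'] V.coord_lin x_fibre)
  note \<psi>c = lin_map_closed[OF \<psi>lin] and \<psi>'c = lin_map_closed[OF \<psi>'lin]
  have \<psi>\<psi>': "\<psi> (\<psi>' w) = w" if w: "w \<in> carrier W" for w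
  proof -
    have "W.embed x (\<psi> (\<psi>' w)) = W.embed x w"
      using emb[OF x_fibre \<psi>'c[OF w]] emb'[OF x_fibre w] inv2[OF W.embed_closed[OF x_fibre w]] by simp
    then show ?thesis using W.coord_embed_self[OF x_fibre] w \<psi>c \<psi>'c by metis
  qed
  have \<psi>'\<psi>: "\<psi>' (\<psi> v) = v" if v: "v \<in> carrier V" for v
  proof -
    have "V.embed x (\<psi>' (\<psi> v)) = V.embed x v"
      using emb'[OF x_fibre \<psi>c[OF v]] emb[OF x_fibre v] inv1[OF V.embed_closed[OF x_fibre v]] by simp
    then show ?thesis using V.coord_embed_self[OF x_fibre] v \<psi>c \<psi>'c by metis
  qed
  have "bij_betw \<psi> (carrier V) (carrier W)"
    by (rule bij_betw_byWitness[where f' = \<psi>']) (use \<psi>\<psi>' \<psi>'\<psi> \<psi>c \<psi>'c in auto)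
  moreover have "\<psi> (lact V b v) = lact W b (\<psi> v)" if b: "b \<in> carrier B" and v: "v \<in> carrier V" for b v
  proof (rule K.lin_map_eqI[where X = H and P = W and f = "\<lambda>b. \<psi> (lact V b v)"
        and g = "\<lambda>b. lact W b (\<psi> v)"])
    show "lin_map K (free_module K H) W (\<lambda>b. \<psi> (lact V b v))"
      using lin_map_comp[OF V.lact_V_lin_left[OF v] \<psi>lin] unfolding lin_map_B .
    show "lin_map K (free_module K H) W (\<lambda>b. lact W b (\<psi> v))"
      using W.lact_V_lin_left[OF \<psi>c[OF v]] unfolding lin_map_B .
    fix g assume g: "g \<in> H"
    then have gL: "g \<in> L" and xg: "x \<cdot> g = g"
      using rn_comp_self[of g] by (auto simp: isotropy_iff fibre_iff)
    \<comment> \<open>Equivariance results from the case \<open>t = g\<close>: as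
      \<open>g = x g\<close>, the vector \<open>g \<otimes> v\<close> equals
      \<open>x \<otimes> g v\<close>, and \<open>\<psi>\<close> is the same for both arrows
      \<open>g\<close> and \<open>x\<close>.\<close>
    have "W.embed x (\<psi> (V.act g v)) = W.embed x (W.act g (\<psi> v))"
      using emb[OF x_fibre V.act_closed[OF g v]] emb[OF gL v] V.embed_comp[OF x_fibre g v]
        W.embed_comp[OF x_fibre g \<psi>c[OF v]] xg by simp
    then have "\<psi> (V.act g v) = W.act g (\<psi> v)"
      using W.coord_embed_self[OF x_fibre] \<psi>c V.act_closed[OF g v] W.act_closed[OF g \<psi>c[OF v]] v by metis
    then show "\<psi> (lact V (basis_vec K g) v) = lact W (basis_vec K g) (\<psi> v)"
      by (simp add: V.act_def W.act_def)
  qed (use b W.module_V in \<open>simp_all add: B_ops\<close>)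
  ultimately show ?thesis
    using \<psi>lin unfolding amodule_isomorphic_iff amodule_hom_def by blast
qed

end

theorem proposition6p19:
  fixes G :: "'g top_groupoid" and K :: "'k ring" and x :: 'g
  assumes "ample_groupoid G"
    and "cring K"
    and "x \<in> unit_space G"
  shows "(\<forall>V :: ('k, 'g \<Rightarrow> 'k, 'v) amodule.
            simple_amodule K (group_algebra K (isotropy_group G x)) V \<longrightarrow>
              simple_amodule K (steinberg_algebra K G) (induced_module K G x V) \<and>
              (field K \<longrightarrow>
                (finite_dimensional K (induced_module K G x V) \<longleftrightarrow>
                  finite_index G x \<and> finite_dimensional K V))) \<and>
         (\<forall>(V :: ('k, 'g \<Rightarrow> 'k, 'v) amodule) (W :: ('k, 'g \<Rightarrow> 'k, 'w) amodule).
            nondegenerate_module K (group_algebra K (isotropy_group G x)) V \<longrightarrow>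
            nondegenerate_module K (group_algebra K (isotropy_group G x)) W \<longrightarrow>
            \<not> amodule_isomorphic K (group_algebra K (isotropy_group G x)) V W \<longrightarrow>
            \<not> amodule_isomorphic K (steinberg_algebra K G)
                (induced_module K G x V) (induced_module K G x W))"
proof -
  interpret ample: ample_groupoid G by fact
  have pointed: "pointed_groupoid G K x"
    by (intro pointed_groupoid.intro pointed_groupoid_axioms.intro ample.groupoid_axioms assms)
  interpret ample_pointed G K x
    by (rule ample_pointed.intro[OF assms(1) pointed])
  have "simple_amodule K A (induced_module K G x V) \<and>
      (finite_dimensional K (induced_module K G x V) \<longleftrightarrow>
        finite_index G x \<and> finite_dimensional K V)"
    if V: "simple_amodule K B V" for V :: "('k, 'g \<Rightarrow> 'k, 'v) amodule"
  proof -
    have nd: "nondegenerate_module K B V" and nz: "carrier V \<noteq> {\<zero>\<^bsub>V\<^esub>}"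
      using V by (auto simp: simple_amodule_def)
    interpret V: ample_induced G K x V
      by (rule ample_induced.intro[OF ample_pointed_axioms induced_setting.intro[OF
            pointed induced_setting_axioms.intro[OF nd]]])
    show ?thesis
      unfolding induced_module_def using V.simple_T[OF V] V.finite_dimensional_T_iff[OF nz] by blast
  qed
  \<comment> \<open>The claim on non-isomorphic modules is the contrapositive of
    \<open>isomorphic_of_induced\<close>.\<close>
  then show ?thesis using isomorphic_of_induced by blast
qed

end
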